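(* Let $\mathcal E$ be a separable Hilbert space. A map $F:[B(\mathcal H)^n]_1\to B(\mathcal H)\bar\otimes_{min}B(\mathcal E)$ is a bounded free holomorphic function such that $\|F\|_\infty\le1$ and $\|F(0)\|<1$ if and only if there exist a strict contraction $A_0\in B(\mathcal E)$, an $n$-tuple of isometries $(V_1,\dots,V_n)$ with orthogonal ranges on a Hilbert space $\mathcal K$, and an isometry $W:\mathcal E\to\mathcal K$, such that $$F=(\Psi_{I\otimes A_0}\circ\boldsymbol{\mathcal C})[G],$$ where $\boldsymbol{\mathcal C}$ is the noncommutative Cayley transform and $G$ is defined by $$G(X_1,\dots,X_n)=(I\otimes W^* )\left[2(I-X_1\otimes V_1^*-\cdots-X_n\otimes V_n^* )^{-1}-I\right](I\otimes W)$$ for any $X=(X_1,\dots,X_n)\in[B(\mathcal H)^n]_1$. In this case, $F(0)=I\otimes A_0$.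
   Context: $\mathcal H$ is a separable infinite dimensional Hilbert space and $n\in\{1,2,\dots\}\cup\{\infty\}$. For $X=(X_1,\dots,X_n)\in B(\mathcal H)^n$, $\|X\|=\|\sum_iX_iX_i^*\|^{1/2}$, and $[B(\mathcal H)^n]_1=\{X:\|X\|<1\}$. $\mathbb F_n^+$ is the unital free semigroup on $g_1,\dots,g_n$; for $\alpha=g_{i_1}\cdots g_{i_k}$ put $|\alpha|=k$, $X_\alpha=X_{i_1}\cdots X_{i_k}$ ($X_\alpha=I$ for the neutral element, of length $0$). A free holomorphic function on $[B(\mathcal H)^n]_1$ with coefficients in $B(\mathcal E)$ is a map $F(X)=\sum_{k=0}^\infty\sum_{|\alpha|=k}X_\alpha\otimes A_{(\alpha)}$ with $A_{(\alpha)}\in B(\mathcal E)$, the series in $k$ converging in operator norm for all $X\in[B(\mathcal H)^n]_1$; $B(\mathcal H)\bar\otimes_{min}B(\mathcal E)$ is the spatial (minimal) tensor product. $\|F\|_\infty=\sup_{\|X\|<1}\|F(X)\|$; $F$ is bounded if this is finite. Noncommutative Cayley transform: for a free holomorphic $G$ with coefficients in $B(\mathcal E)$ and $\Re G\ge0$ (i.e. $\frac12(G(X)+G(X)^* )\ge0$ for all $X\in[B(\mathcal H)^n]_1$), $\boldsymbol{\mathcal C}[G](X)=[G(X)-I][I+G(X)]^{-1}$. Fractional transform: for $A=I_{\mathcal H}\otimes A_0$, $\|A_0\|<1$, and a free holomorphic $H$ with $\|H\|_\infty\le1$, $\Psi_A[H](X)=A-D_{A^*}[I-H(X)A^*]^{-1}H(X)D_A$,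 where $D_A=(I-A^*A)^{1/2}$, $D_{A^*}=(I-AA^* )^{1/2}$. *)

theory Defs
  imports "HOL-Analysis.Analysis"
begin

section \<open>Complex Hilbert spaces\<close>

text \<open>
  The norm, the metric and the completeness come from the underlying real Hilbert space, whose
  inner product is the real part of the complex one. The inner product is linear in its first
  argument. The zero space is allowed.
\<close>

class complex_hilbert = real_inner + complete_space +
  fixes scaleC :: "complex \<Rightarrow> 'a \<Rightarrow> 'a" (infixr \<open>*\<^sub>C\<close> 75)
    and cinner :: "'a \<Rightarrow> 'a \<Rightarrow> complex"
  assumes scaleC_add_right: "a *\<^sub>C (x + y) = a *\<^sub>C x + a *\<^sub>C y"
    and scaleC_add_left: "(a + b) *\<^sub>C x = a *\<^sub>C x + b *\<^sub>C x"
    and scaleC_scaleC: "a *\<^sub>C b *\<^sub>C x = (a * b) *\<^sub>C x"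
    and scaleR_scaleC: "r *\<^sub>R x = complex_of_real r *\<^sub>C x"
    and cinner_commute: "cinner x y = cnj (cinner y x)"
    and cinner_add_left: "cinner (x + y) z = cinner x z + cinner y z"
    and cinner_scaleC_left: "cinner (a *\<^sub>C x) y = a * cinner x y"
    and inner_eq_Re_cinner: "inner x y = Re (cinner x y)"

global_interpretation complex_vector:
  vector_space "scaleC :: complex \<Rightarrow> 'a \<Rightarrow> 'a::complex_hilbert"
proof
  fix x :: 'a
  have "1 *\<^sub>C x = 1 *\<^sub>R x"
    by (simp only: scaleR_scaleC of_real_1)
  then show "1 *\<^sub>C x = x"
    by simp
qed (simp_all add: scaleC_add_right scaleC_add_left scaleC_scaleC)

definition separable_hilbert :: "'a::complex_hilbert itself \<Rightarrow> bool"
  where "separable_hilbert _ \<longleftrightarrow> separable_space (euclidean :: 'a topology)"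

definition infinite_dimensional :: "'a::complex_hilbert itself \<Rightarrow> bool"
  where "infinite_dimensional _ \<longleftrightarrow> (\<nexists>B :: 'a set. finite B \<and> complex_vector.span B = UNIV)"


section \<open>Bounded operators\<close>

text \<open>
  \<open>bounded_ops\<close> is the space of bounded complex-linear operators, inside the real-linear ones; the
  operator norm of such an operator is its norm as an element of the type of bounded
  real-linear maps.
\<close>

definition bounded_ops :: "('a::complex_hilbert \<Rightarrow>\<^sub>L 'b::complex_hilbert) set"
  where "bounded_ops = {T. \<forall>c x. blinfun_apply T (c *\<^sub>C x) = c *\<^sub>C blinfun_apply T x}"

definition adj :: "('a::complex_hilbert \<Rightarrow>\<^sub>L 'b::complex_hilbert) \<Rightarrow> ('b \<Rightarrow>\<^sub>L 'a)"
  where "adj T = (THE S. S \<in> bounded_ops \<and>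
    (\<forall>x y. cinner (blinfun_apply T x) y = cinner x (blinfun_apply S y)))"

definition op_inv :: "('a::complex_hilbert \<Rightarrow>\<^sub>L 'a) \<Rightarrow> ('a \<Rightarrow>\<^sub>L 'a)"
  where "op_inv T = (THE S. S \<in> bounded_ops \<and> S o\<^sub>L T = id_blinfun \<and> T o\<^sub>L S = id_blinfun)"

definition positive_op :: "('a::complex_hilbert \<Rightarrow>\<^sub>L 'a) \<Rightarrow> bool"
  where "positive_op T \<longleftrightarrow> T \<in> bounded_ops \<and> (\<forall>x. cinner (blinfun_apply T x) x \<in> \<real>\<^sub>\<ge>\<^sub>0)"

definition op_sqrt :: "('a::complex_hilbert \<Rightarrow>\<^sub>L 'a) \<Rightarrow> ('a \<Rightarrow>\<^sub>L 'a)"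
  where "op_sqrt T = (THE S. positive_op S \<and> S o\<^sub>L S = T)"

definition defect_op :: "('a::complex_hilbert \<Rightarrow>\<^sub>L 'a) \<Rightarrow> ('a \<Rightarrow>\<^sub>L 'a)"
  where "defect_op T = op_sqrt (id_blinfun - (adj T o\<^sub>L T))"

text \<open>
  Sums of operators over an index set converge unconditionally in the strong operator topology.
  Over a finite index set this is the ordinary finite sum.
\<close>

definition strong_has_sum ::
    "('i \<Rightarrow> 'a::complex_hilbert \<Rightarrow>\<^sub>L 'b::complex_hilbert) \<Rightarrow> 'i set \<Rightarrow> ('a \<Rightarrow>\<^sub>L 'b) \<Rightarrow> bool"
  where "strong_has_sum f I T \<longleftrightarrow>
    (\<forall>x. ((\<lambda>i. blinfun_apply (f i) x) has_sum blinfun_apply T x) I)"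

definition strong_sum ::
    "('i \<Rightarrow> 'a::complex_hilbert \<Rightarrow>\<^sub>L 'b::complex_hilbert) \<Rightarrow> 'i set \<Rightarrow> ('a \<Rightarrow>\<^sub>L 'b)"
  where "strong_sum f I = (THE T. strong_has_sum f I T)"


section \<open>Hilbert and spatial tensor products\<close>

text \<open>
  A realization \<open>t x y\<close> of the elementary tensors in a Hilbert space \<open>'c\<close> exhibits \<open>'c\<close> as the
  completion of the algebraic tensor product of \<open>'a\<close> and \<open>'b\<close> with respect to the product inner
  product; it is unique up to a unique unitary operator.
\<close>

locale hilbert_tensor =
  fixes t :: "'a::complex_hilbert \<Rightarrow> 'b::complex_hilbert \<Rightarrow> 'c::complex_hilbert"
  assumes tensor_add_left: "t (x + x') y = t x y + t x' y"
    and tensor_add_right: "t x (y + y') = t x y + t x y'"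
    and tensor_scaleC_left: "t (c *\<^sub>C x) y = c *\<^sub>C t x y"
    and tensor_scaleC_right: "t x (c *\<^sub>C y) = c *\<^sub>C t x y"
    and cinner_tensor: "cinner (t x y) (t x' y') = cinner x x' * cinner y y'"
    and tensor_dense: "closure (complex_vector.span {t x y | x y. True}) = UNIV"

text \<open>\<open>tensor_op t t' S T\<close> is the operator usually written as the tensor product of \<open>S\<close> and \<open>T\<close>.\<close>

definition tensor_op ::
    "('a::complex_hilbert \<Rightarrow> 'b::complex_hilbert \<Rightarrow> 'c::complex_hilbert) \<Rightarrow>
     ('a'::complex_hilbert \<Rightarrow> 'b'::complex_hilbert \<Rightarrow> 'c'::complex_hilbert) \<Rightarrow>
     ('a \<Rightarrow>\<^sub>L 'a') \<Rightarrow> ('b \<Rightarrow>\<^sub>L 'b') \<Rightarrow> ('c \<Rightarrow>\<^sub>L 'c')"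
  where "tensor_op t t' S T = (THE R. R \<in> bounded_ops \<and>
    (\<forall>x y. blinfun_apply R (t x y) = t' (blinfun_apply S x) (blinfun_apply T y)))"

text \<open>
  The spatial (minimal) tensor product of the two algebras of all bounded operators: the
  norm closure of their algebraic tensor product. The real span of the elementary tensors is
  already a complex subspace.
\<close>

definition spatial_tensor ::
    "('a::complex_hilbert \<Rightarrow> 'b::complex_hilbert \<Rightarrow> 'c::complex_hilbert) \<Rightarrow> ('c \<Rightarrow>\<^sub>L 'c) set"
  where "spatial_tensor t =
    closure (span {tensor_op t t S T | S T. S \<in> bounded_ops \<and> T \<in> bounded_ops})"


section \<open>The noncommutative ball and free holomorphic functions\<close>

text \<open>
  An \<open>n\<close>-tuple is a family indexed by a countable type \<open>'n\<close>, which is nonempty and finite or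
  countably infinite. The free semigroup is the type \<open>'n list\<close>, with the empty word as
  neutral element.
\<close>

definition row_norm :: "('n \<Rightarrow> 'h::complex_hilbert \<Rightarrow>\<^sub>L 'h) \<Rightarrow> real"
  where "row_norm X = sqrt (norm (strong_sum (\<lambda>i. X i o\<^sub>L adj (X i)) UNIV))"

text \<open>
  For infinite \<open>'n\<close>, the condition \<open>row_norm X < 1\<close> has to include the convergence of the series
  defining the row norm.
\<close>

definition row_ball :: "('n::countable \<Rightarrow> 'h::complex_hilbert \<Rightarrow>\<^sub>L 'h) set"
  where "row_ball = {X. (\<forall>i. X i \<in> bounded_ops) \<and>
    (\<exists>T. strong_has_sum (\<lambda>i. X i o\<^sub>L adj (X i)) UNIV T) \<and> row_norm X < 1}"

definition word_op :: "('n \<Rightarrow> 'h::complex_hilbert \<Rightarrow>\<^sub>L 'h) \<Rightarrow> 'n list \<Rightarrow> ('h \<Rightarrow>\<^sub>L 'h)"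
  where "word_op X \<alpha> = foldr (\<lambda>i T. X i o\<^sub>L T) \<alpha> id_blinfun"

text \<open>
  The homogeneous parts \<open>Y k\<close>, which are infinite sums if \<open>'n\<close> is infinite, are strong sums; the
  series in \<open>k\<close> converges in the operator norm.
\<close>

definition free_holomorphic ::
    "('h::complex_hilbert \<Rightarrow> 'e::complex_hilbert \<Rightarrow> 'he::complex_hilbert) \<Rightarrow>
     (('n::countable \<Rightarrow> 'h \<Rightarrow>\<^sub>L 'h) \<Rightarrow> ('he \<Rightarrow>\<^sub>L 'he)) \<Rightarrow> bool"
  where "free_holomorphic t F \<longleftrightarrow>
    (\<exists>A :: 'n list \<Rightarrow> ('e \<Rightarrow>\<^sub>L 'e). (\<forall>\<alpha>. A \<alpha> \<in> bounded_ops) \<and>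
      (\<forall>X\<in>row_ball. \<exists>Y :: nat \<Rightarrow> ('he \<Rightarrow>\<^sub>L 'he).
        (\<forall>k. strong_has_sum (\<lambda>\<alpha>. tensor_op t t (word_op X \<alpha>) (A \<alpha>)) {\<alpha>. length \<alpha> = k} (Y k)) \<and>
        Y sums F X))"

definition bounded_on_ball ::
    "(('n::countable \<Rightarrow> 'h::complex_hilbert \<Rightarrow>\<^sub>L 'h) \<Rightarrow> ('c::complex_hilbert \<Rightarrow>\<^sub>L 'c)) \<Rightarrow> bool"
  where "bounded_on_ball F \<longleftrightarrow> bdd_above ((\<lambda>X. norm (F X)) ` row_ball)"

definition sup_norm ::
    "(('n::countable \<Rightarrow> 'h::complex_hilbert \<Rightarrow>\<^sub>L 'h) \<Rightarrow> ('c::complex_hilbert \<Rightarrow>\<^sub>L 'c)) \<Rightarrow> real"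
  where "sup_norm F = (SUP X\<in>row_ball. norm (F X))"


section \<open>Cayley and fractional transforms\<close>

definition cayley_transform :: "('x \<Rightarrow> ('c::complex_hilbert \<Rightarrow>\<^sub>L 'c)) \<Rightarrow> 'x \<Rightarrow> ('c \<Rightarrow>\<^sub>L 'c)"
  where "cayley_transform G X = (G X - id_blinfun) o\<^sub>L op_inv (id_blinfun + G X)"

definition fractional_transform ::
    "('c::complex_hilbert \<Rightarrow>\<^sub>L 'c) \<Rightarrow> ('x \<Rightarrow> ('c \<Rightarrow>\<^sub>L 'c)) \<Rightarrow> 'x \<Rightarrow> ('c \<Rightarrow>\<^sub>L 'c)"
  where "fractional_transform A H X =
    A - (defect_op (adj A) o\<^sub>L op_inv (id_blinfun - (H X o\<^sub>L adj A)) o\<^sub>L H X o\<^sub>L defect_op A)"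


section \<open>The representation\<close>

text \<open>
  The auxiliary Hilbert space is a closed subspace \<open>K\<close> of an ambient Hilbert space \<open>'k\<close>. An operator
  on \<open>K\<close> is identified with its extension by zero on the orthogonal complement of \<open>K\<close>; this
  identification is isometric and compatible with sums, products and adjoints.
\<close>

definition operator_on :: "'k::complex_hilbert set \<Rightarrow> ('k \<Rightarrow>\<^sub>L 'k) \<Rightarrow> bool"
  where "operator_on K T \<longleftrightarrow> T \<in> bounded_ops \<and> blinfun_apply T ` K \<subseteq> K \<and>
    (\<forall>y. (\<forall>x\<in>K. cinner x y = 0) \<longrightarrow> blinfun_apply T y = 0)"

definition isometries_with_orthogonal_ranges ::
    "'k::complex_hilbert set \<Rightarrow> ('n \<Rightarrow> ('k \<Rightarrow>\<^sub>L 'k)) \<Rightarrow> bool"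
  where "isometries_with_orthogonal_ranges K V \<longleftrightarrow>
    (\<forall>i. operator_on K (V i) \<and> (\<forall>x\<in>K. norm (blinfun_apply (V i) x) = norm x)) \<and>
    (\<forall>i j. i \<noteq> j \<longrightarrow>
      (\<forall>x\<in>K. \<forall>y\<in>K. cinner (blinfun_apply (V i) x) (blinfun_apply (V j) y) = 0))"

definition isometry_into ::
    "'k::complex_hilbert set \<Rightarrow> ('e::complex_hilbert \<Rightarrow>\<^sub>L 'k) \<Rightarrow> bool"
  where "isometry_into K W \<longleftrightarrow> W \<in> bounded_ops \<and> range (blinfun_apply W) \<subseteq> K \<and>
    (\<forall>x. norm (blinfun_apply W x) = norm x)"

text \<open>
  The identity and the inverse below are taken on the tensor product with the ambient space
  \<open>'k\<close>. The tensor product with \<open>K\<close> is a reducing subspace of it that contains the range of the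
  rightmost factor, so this is the same function as the one computed over \<open>K\<close>.
\<close>

definition isometric_transfer ::
    "('h::complex_hilbert \<Rightarrow> 'e::complex_hilbert \<Rightarrow> 'he::complex_hilbert) \<Rightarrow>
     ('h \<Rightarrow> 'k::complex_hilbert \<Rightarrow> 'hk::complex_hilbert) \<Rightarrow>
     ('n \<Rightarrow> ('k \<Rightarrow>\<^sub>L 'k)) \<Rightarrow> ('e \<Rightarrow>\<^sub>L 'k) \<Rightarrow> ('n \<Rightarrow> 'h \<Rightarrow>\<^sub>L 'h) \<Rightarrow> ('he \<Rightarrow>\<^sub>L 'he)"
  where "isometric_transfer tE tK V W X =
    tensor_op tK tE id_blinfun (adj W)
    o\<^sub>L (2 *\<^sub>R op_inv (id_blinfun - strong_sum (\<lambda>i. tensor_op tK tK (X i) (adj (V i))) UNIV)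
        - id_blinfun)
    o\<^sub>L tensor_op tE tK id_blinfun W"

definition represents ::
    "('h::complex_hilbert \<Rightarrow> 'e::complex_hilbert \<Rightarrow> 'he::complex_hilbert) \<Rightarrow>
     ('h \<Rightarrow> 'k::complex_hilbert \<Rightarrow> 'hk::complex_hilbert) \<Rightarrow>
     (('n::countable \<Rightarrow> 'h \<Rightarrow>\<^sub>L 'h) \<Rightarrow> ('he \<Rightarrow>\<^sub>L 'he)) \<Rightarrow>
     'k set \<Rightarrow> ('e \<Rightarrow>\<^sub>L 'e) \<Rightarrow> ('n \<Rightarrow> ('k \<Rightarrow>\<^sub>L 'k)) \<Rightarrow> ('e \<Rightarrow>\<^sub>L 'k) \<Rightarrow> bool"
  where "represents tE tK F K A0 V W \<longleftrightarrow>
    complex_vector.subspace K \<and> closed K \<and>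
    A0 \<in> bounded_ops \<and> norm A0 < 1 \<and>
    isometries_with_orthogonal_ranges K V \<and> isometry_into K W \<and>
    (\<forall>X\<in>row_ball. F X =
      (fractional_transform (tensor_op tE tE id_blinfun A0) \<circ> cayley_transform)
        (isometric_transfer tE tK V W) X)"

end

theory Submission
  imports Defs
begin

text \<open>
  Both directions rest on one formula. Let \<open>D\<close> and \<open>D'\<close> be the defect operators of the strict
  contraction \<open>A0\<close> and of its adjoint, put \<open>T = \<Sum>i. X i \<otimes> (V i)*\<close> (a strict contraction, because
  the row \<open>X\<close> is one and the \<open>(V i)*\<close> form a contractive column), and let
  \<open>M = I - W W* + W A0* W*\<close>. If factors \<open>I \<otimes> _\<close> are suppressed, the two transforms are successive
  feedback connections, and eliminating the inner variables gives
  \<open>(\<Psi> \<circ> C)[G](X) = A0 - D' W* T (I - M T)\<^sup>-\<^sup>1 W D\<close>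
  (\<open>fractional_cayley_resolvent\<close>).

  Given a representation, this formula yields everything that is claimed about \<open>F\<close>. The value at \<open>0\<close>
  is \<open>A0\<close>. The values are contractions, because the coefficients of the formula are built from the
  isometry \<open>W\<close> and the unitary Julia operator of \<open>A0\<close>, so that an energy balance holds. The Neumann
  series of \<open>I - M T\<close> is norm convergent, and its terms are the homogeneous parts, with coefficients
  \<open>transfer_coeff\<close>. For infinitely many variables the sum over the words of a fixed length
  converges strongly because it is a bounded row times a bounded column.

  Conversely, let \<open>F\<close> have the coefficients \<open>A \<alpha>\<close>. Evaluating \<open>F\<close> at weighted shifts that are truncated
  to a finite set of words closed under suffixes shows that convolution by \<open>A\<close> is
  contractive on that set (\<open>coefficients_contractive\<close>). The two transforms are then inverted on the level of
  coefficients, by recursion on the length of words, and the Julia identity turns contractivity of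
  the convolution into positivity of the kernel that has the coefficients of \<open>G\<close>
  as its entries (\<open>symbol_positive\<close>, \<open>kernel_positive\<close>). A positive kernel on a countable set is the Gram matrix of
  vectors in any infinite-dimensional space (\<open>positive_kernel_realization\<close>). As the kernel is invariant
  under appending the same letter to both words and vanishes at words with different last letters, appending
  the letter \<open>i\<close> extends to an isometry \<open>V i\<close> on the closed span of those vectors, and these isometries have
  orthogonal ranges; the vectors of the empty word define \<open>W\<close> (\<open>dilation_exists\<close>). Finally \<open>transfer_coeff A0 V W\<close> and \<open>A\<close> satisfy the same recursion, hence
  agree, and so do the two functions (\<open>transfer_coeff_eq\<close>).
\<close>

section \<open>Complex inner products\<close>

instance complex_hilbert \<subseteq> banach ..

lemma cinner_add_right: "cinner x (y + z) = cinner x y + cinner x z"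
  by (metis cinner_add_left cinner_commute complex_cnj_add)

lemma cinner_scaleC_right: "cinner x (a *\<^sub>C y) = cnj a * cinner x y"
  by (metis cinner_commute cinner_scaleC_left complex_cnj_mult)

lemma cinner_self: "cinner x x = complex_of_real ((norm x)\<^sup>2)"
proof (rule complex_eqI)
  show "Re (cinner x x) = Re (complex_of_real ((norm x)\<^sup>2))"
    by (simp add: inner_eq_Re_cinner[symmetric] power2_norm_eq_inner)
  have "cinner x x = cnj (cinner x x)"
    by (rule cinner_commute)
  then have "Im (cinner x x) = Im (cnj (cinner x x))"
    by (rule arg_cong)
  then show "Im (cinner x x) = Im (complex_of_real ((norm x)\<^sup>2))"
    by simp
qed

lemma Re_cinner_self [simp]: "Re (cinner x x) = (norm x)\<^sup>2"
  by (simp add: cinner_self)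

lemma norm_scaleC: "norm (a *\<^sub>C x) = cmod a * norm x"
proof -
  have "cinner (a *\<^sub>C x) (a *\<^sub>C x) = a * cnj a * cinner x x"
    by (simp add: cinner_scaleC_left cinner_scaleC_right)
  then have "complex_of_real ((norm (a *\<^sub>C x))\<^sup>2) = complex_of_real ((cmod a * norm x)\<^sup>2)"
    by (simp only: cinner_self complex_norm_square[symmetric] of_real_mult power_mult_distrib)
  then have "(norm (a *\<^sub>C x))\<^sup>2 = (cmod a * norm x)\<^sup>2"
    by (simp only: of_real_eq_iff)
  then show ?thesis
    by (simp add: power2_eq_iff_nonneg)
qed

lemma norm_cinner_le: "cmod (cinner x y) \<le> norm x * norm y"
proof (cases "cinner x y = 0")
  case False
  \<comment> \<open>After a rotation by the phase \<open>u\<close> the complex inner product is real, and the real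
     Cauchy-Schwarz inequality applies.\<close>
  define u where "u = cnj (sgn (cinner x y))"
  have "u * cinner x y = complex_of_real (cmod (cinner x y))"
    using False
    by (simp add: u_def sgn_eq field_simps complex_norm_square[symmetric] power2_eq_square)
  then have "cmod (cinner x y) = inner (u *\<^sub>C x) y"
    by (simp add: inner_eq_Re_cinner cinner_scaleC_left)
  also have "\<dots> \<le> norm (u *\<^sub>C x) * norm y"
    by (rule norm_cauchy_schwarz)
  also have "norm (u *\<^sub>C x) = norm x"
    using False by (simp add: norm_scaleC u_def norm_sgn)
  finally show ?thesis .
qed simp

lemma cinner_scaleR_left: "cinner (r *\<^sub>R x) y = r *\<^sub>R cinner x y"
  by (simp add: scaleR_scaleC cinner_scaleC_left scaleR_conv_of_real)

lemma cinner_scaleR_right: "cinner x (r *\<^sub>R y) = r *\<^sub>R cinner x y"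
  by (simp add: scaleR_scaleC cinner_scaleC_right scaleR_conv_of_real)

interpretation cinner: bounded_bilinear "cinner :: 'a::complex_hilbert \<Rightarrow> 'a \<Rightarrow> complex"
proof
  show "\<exists>K. \<forall>a b :: 'a. norm (cinner a b) \<le> norm a * norm b * K"
    by (rule exI[of _ 1]) (simp add: norm_cinner_le)
qed (simp_all add: cinner_add_left cinner_add_right cinner_scaleR_left cinner_scaleR_right)

interpretation scaleC: bounded_bilinear "scaleC :: complex \<Rightarrow> 'a::complex_hilbert \<Rightarrow> 'a"
proof
  show "\<exists>K. \<forall>a. \<forall>b :: 'a. norm (a *\<^sub>C b) \<le> norm a * norm b * K"
    by (rule exI[of _ 1]) (simp add: norm_scaleC)
qed (simp_all add: scaleC_add_left scaleC_add_right scaleR_scaleC scaleC_scaleC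
    scaleR_conv_of_real mult.commute)

declare cinner.zero_left [simp] cinner.zero_right [simp]
  scaleC.zero_left [simp] scaleC.zero_right [simp]

lemma cinner_eqI:
  assumes "\<And>z. cinner x z = cinner y z"
  shows "x = y"
proof -
  have "cinner (x - y) (x - y) = 0"
    by (subst cinner.diff_left) (simp add: assms)
  then show ?thesis
    by (simp add: cinner_self)
qed

lemma norm_add_sqr: "(norm (x + y :: 'a::complex_hilbert))\<^sup>2 = (norm x)\<^sup>2 + 2 * Re (cinner x y) + (norm y)\<^sup>2"
  by (simp add: power2_norm_eq_inner inner_add_left inner_add_right inner_commute
      inner_eq_Re_cinner[symmetric])

lemma norm_diff_sqr: "(norm (x - y :: 'a::complex_hilbert))\<^sup>2 = (norm x)\<^sup>2 - 2 * Re (cinner x y) + (norm y)\<^sup>2"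
  by (simp add: power2_norm_eq_inner inner_diff_left inner_diff_right inner_commute
      inner_eq_Re_cinner[symmetric])

section \<open>Bounded complex-linear operators\<close>

lemma bounded_opsD: "T \<in> bounded_ops \<Longrightarrow> blinfun_apply T (c *\<^sub>C x) = c *\<^sub>C blinfun_apply T x"
  by (simp add: bounded_ops_def)

lemma bounded_ops_zero [simp, intro]: "0 \<in> bounded_ops"
  and bounded_ops_id [simp, intro]: "id_blinfun \<in> bounded_ops"
  and bounded_ops_add [intro]: "S \<in> bounded_ops \<Longrightarrow> T \<in> bounded_ops \<Longrightarrow> S + T \<in> bounded_ops"
  and bounded_ops_diff [intro]: "S \<in> bounded_ops \<Longrightarrow> T \<in> bounded_ops \<Longrightarrow> S - T \<in> bounded_ops"
  and bounded_ops_minus [intro]: "S \<in> bounded_ops \<Longrightarrow> - S \<in> bounded_ops"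
  by (simp_all add: bounded_ops_def blinfun.bilinear_simps scaleC.add_right scaleC.diff_right
      scaleC.minus_right)

lemma bounded_ops_scaleR [intro]: "S \<in> bounded_ops \<Longrightarrow> r *\<^sub>R S \<in> bounded_ops"
  by (simp add: bounded_ops_def blinfun.bilinear_simps scaleC.scaleR_right)

lemma bounded_ops_compose [intro]: "S \<in> bounded_ops \<Longrightarrow> T \<in> bounded_ops \<Longrightarrow> S o\<^sub>L T \<in> bounded_ops"
  by (simp add: bounded_ops_def)

lemma bounded_ops_sum [intro]: "(\<And>i. i \<in> I \<Longrightarrow> S i \<in> bounded_ops) \<Longrightarrow> (\<Sum>i\<in>I. S i) \<in> bounded_ops"
  by (induction I rule: infinite_finite_induct) auto

lemma closed_bounded_ops:
  "closed (bounded_ops :: ('a::complex_hilbert \<Rightarrow>\<^sub>L 'b::complex_hilbert) set)"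
  unfolding bounded_ops_def
  by (intro closed_Collect_all closed_Collect_eq continuous_intros blinfun.continuous
      scaleC.continuous_on blinfun.continuous_on)

lemma bounded_ops_limit:
  "f \<longlonglongrightarrow> T \<Longrightarrow> (\<And>n. f n \<in> bounded_ops) \<Longrightarrow> T \<in> bounded_ops"
  using closed_bounded_ops closed_sequentially by blast

lemma blinfun_in_bounded_opsI:
  assumes add: "\<And>x y. f (x + y) = f x + f y"
    and scale: "\<And>c x. f (c *\<^sub>C x) = c *\<^sub>C f x"
    and bound: "\<And>x. norm (f x) \<le> M * norm x"
  shows "Blinfun f \<in> bounded_ops" and "blinfun_apply (Blinfun f) = f"
    and "0 \<le> M \<Longrightarrow> norm (Blinfun f) \<le> M"
proof -
  have "bounded_linear f"
    using bound by (intro bounded_linear_intro[of f M])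
      (simp_all add: add scaleR_scaleC scale mult.commute)
  then show apply_eq: "blinfun_apply (Blinfun f) = f"
    by (simp add: bounded_linear_Blinfun_apply)
  show "Blinfun f \<in> bounded_ops"
    by (simp add: bounded_ops_def apply_eq scale)
  show "norm (Blinfun f) \<le> M" if "0 \<le> M"
    using that by (rule norm_blinfun_bound) (simp add: apply_eq bound)
qed

section \<open>Projections, the Riesz representation and adjoints\<close>

text \<open>
  By the parallelogram law a sequence whose distances to \<open>x\<close> approach the infimum is a Cauchy sequence,
  because the midpoints of its members stay in the subspace.
\<close>

lemma closest_point_exists:
  fixes K :: "'a::complex_hilbert set"
  assumes "complex_vector.subspace K" and "closed K"
  shows "\<exists>p\<in>K. \<forall>z\<in>K. (norm (x - p))\<^sup>2 \<le> (norm (x - z))\<^sup>2"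
proof -
  define d where "d = (INF z\<in>K. (norm (x - z))\<^sup>2)"
  have bdd: "bdd_below ((\<lambda>z. (norm (x - z))\<^sup>2) ` K)"
    by (rule bdd_belowI2[of _ 0]) simp
  have ne: "K \<noteq> {}"
    using assms(1) complex_vector.subspace_0 by blast
  have d_le: "d \<le> (norm (x - z))\<^sup>2" if "z \<in> K" for z
    unfolding d_def using that by (intro cINF_lower bdd) auto
  have "\<exists>z\<in>K. (norm (x - z))\<^sup>2 < d + inverse (real (Suc n))" for n
    using cINF_less_iff[OF ne bdd, of "d + inverse (real (Suc n))"] by (simp add: d_def)
  then obtain k where kK: "\<And>n. k n \<in> K"
    and k: "\<And>n. (norm (x - k n))\<^sup>2 < d + inverse (real (Suc n))"
    by metis
  have par: "(norm (k m - k n))\<^sup>2 \<le> 2 * inverse (real (Suc m)) + 2 * inverse (real (Suc n))" for m n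
  proof -
    define h where "h = complex_of_real (1/2) *\<^sub>C (k m + k n)"
    have "h \<in> K"
      unfolding h_def using assms(1) kK
      by (intro complex_vector.subspace_scale complex_vector.subspace_add)
    then have "d \<le> (norm (x - h))\<^sup>2"
      by (rule d_le)
    moreover have "(norm (k m - k n))\<^sup>2 + 4 * (norm (x - h))\<^sup>2
        = 2 * (norm (x - k m))\<^sup>2 + 2 * (norm (x - k n))\<^sup>2"
      unfolding h_def scaleR_scaleC[symmetric]
      by (simp add: power2_norm_eq_inner inner_diff_left inner_diff_right inner_add_left
          inner_add_right inner_commute field_simps)
    ultimately show ?thesis
      using k[of m] k[of n] by linarith
  qed
  have "Cauchy k"
  proof (rule metric_CauchyI)
    fix e :: real
    assume "0 < e"
    then have "0 < e\<^sup>2 / 4"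
      by simp
    then obtain N where N: "inverse (real (Suc N)) < e\<^sup>2 / 4"
      using reals_Archimedean by blast
    have "dist (k m) (k n) < e" if "N \<le> m" "N \<le> n" for m n
    proof -
      have "inverse (real (Suc m)) \<le> inverse (real (Suc N))"
        "inverse (real (Suc n)) \<le> inverse (real (Suc N))"
        using that by simp_all
      then have "(norm (k m - k n))\<^sup>2 < e\<^sup>2"
        using par[of m n] N by linarith
      then show ?thesis
        using \<open>0 < e\<close> by (simp add: dist_norm power_less_imp_less_base)
    qed
    then show "\<exists>M. \<forall>m\<ge>M. \<forall>n\<ge>M. dist (k m) (k n) < e"
      by blast
  qed
  then obtain p where p: "k \<longlonglongrightarrow> p"
    using Cauchy_convergent_iff convergent_def by blast
  have "p \<in> K"
    using closed_sequentially[OF assms(2) _ p] kK by blast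
  moreover have "(norm (x - p))\<^sup>2 \<le> d"
  proof (rule LIMSEQ_le)
    show "(\<lambda>n. (norm (x - k n))\<^sup>2) \<longlonglongrightarrow> (norm (x - p))\<^sup>2"
      by (intro tendsto_intros p)
    show "(\<lambda>n. d + inverse (real (Suc n))) \<longlonglongrightarrow> d"
      using tendsto_add[OF tendsto_const LIMSEQ_inverse_real_of_nat, of d] by simp
  qed (use k less_imp_le in blast)
  ultimately show ?thesis
    using d_le order_trans by blast
qed

text \<open>
  Moving from the closest point \<open>p\<close> in the direction \<open>z\<close> cannot decrease the distance to \<open>x\<close>, which
  forces the real part of \<open>cinner (x - p) z\<close> to vanish; the direction \<open>\<i> *\<^sub>C z\<close> handles the imaginary part.
\<close>

lemma orthogonal_decomposition:
  fixes K :: "'a::complex_hilbert set"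
  assumes K: "complex_vector.subspace K" and "closed K"
  obtains p where "p \<in> K" and "\<And>z. z \<in> K \<Longrightarrow> cinner (x - p) z = 0"
proof -
  obtain p where "p \<in> K" and min: "\<And>z. z \<in> K \<Longrightarrow> (norm (x - p))\<^sup>2 \<le> (norm (x - z))\<^sup>2"
    using closest_point_exists[OF assms] by metis
  have Re0: "Re (cinner (x - p) z) = 0" if "z \<in> K" for z
  proof -
    define a where "a = Re (cinner (x - p) z)"
    define b where "b = (norm z)\<^sup>2"
    \<comment> \<open>The quadratic \<open>b * s\<^sup>2 - 2 * a * s\<close> is negative here unless \<open>a = 0\<close>;
       adding 1 to \<open>b\<close> avoids the case distinction \<open>b = 0\<close>.\<close>
    define s where "s = a / (b + 1)"
    have "0 \<le> b"
      by (simp add: b_def)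
    have "p + complex_of_real s *\<^sub>C z \<in> K"
      using K \<open>p \<in> K\<close> that
      by (intro complex_vector.subspace_add complex_vector.subspace_scale)
    from min[OF this] have "(norm (x - p))\<^sup>2 \<le> (norm ((x - p) - s *\<^sub>R z))\<^sup>2"
      by (simp add: scaleR_scaleC diff_diff_eq)
    also have "\<dots> = (norm (x - p))\<^sup>2 - 2 * (s * a) + s\<^sup>2 * b"
      by (subst norm_diff_sqr) (simp add: cinner.scaleR_right a_def b_def power_mult_distrib)
    finally have "2 * (s * a) \<le> s\<^sup>2 * b"
      by simp
    moreover have "s * a = s\<^sup>2 * (b + 1)"
      using \<open>0 \<le> b\<close> by (simp add: s_def power2_eq_square)
    ultimately have "s\<^sup>2 * (b + 2) \<le> 0"
      by (simp add: algebra_simps)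
    then have "s = 0"
      using \<open>0 \<le> b\<close> by (simp add: mult_le_0_iff)
    then show ?thesis
      using \<open>0 \<le> b\<close> by (simp add: s_def a_def)
  qed
  have "cinner (x - p) z = 0" if "z \<in> K" for z
  proof (rule complex_eqI)
    have "\<i> *\<^sub>C z \<in> K"
      using K that by (rule complex_vector.subspace_scale)
    then show "Im (cinner (x - p) z) = Im 0"
      using Re0[of "\<i> *\<^sub>C z"] by (simp add: cinner_scaleC_right)
  qed (simp add: Re0 that)
  with \<open>p \<in> K\<close> show thesis
    by (rule that)
qed

text \<open>
  The kernel of \<open>\<phi>\<close> has codimension at most one, so a vector orthogonal to it represents \<open>\<phi>\<close> up to a scalar.
\<close>

lemma riesz_representation:
  fixes \<phi> :: "'a::complex_hilbert \<Rightarrow> complex"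
  assumes "bounded_linear \<phi>" and hom: "\<And>c x. \<phi> (c *\<^sub>C x) = c * \<phi> x"
  shows "\<exists>a. \<forall>x. \<phi> x = cinner x a"
proof (cases "\<forall>x. \<phi> x = 0")
  case True
  then show ?thesis
    by (intro exI[of _ 0]) simp
next
  case False
  interpret bounded_linear \<phi> by fact
  define K where "K = {x. \<phi> x = 0}"
  have subK: "complex_vector.subspace K"
    by (rule complex_vector.subspaceI) (simp_all add: K_def zero add hom)
  have clK: "closed K"
    unfolding K_def by (intro closed_Collect_eq continuous_intros continuous_on)
  from False obtain x0 where x0: "\<phi> x0 \<noteq> 0"
    by blast
  obtain p where p: "p \<in> K" and orth: "\<And>z. z \<in> K \<Longrightarrow> cinner (x0 - p) z = 0"
    using orthogonal_decomposition[OF subK clK, of x0] by blast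
  define w where "w = x0 - p"
  have w: "\<phi> w \<noteq> 0"
    using x0 p by (simp add: w_def diff K_def)
  then have "w \<noteq> 0"
    using zero by auto
  have "\<phi> x = cinner x ((cnj (\<phi> w) / complex_of_real ((norm w)\<^sup>2)) *\<^sub>C w)" for x
  proof -
    have "x - (\<phi> x / \<phi> w) *\<^sub>C w \<in> K"
      using w by (simp add: K_def diff hom)
    then have "cinner (x - (\<phi> x / \<phi> w) *\<^sub>C w) w = 0"
      using orth[folded w_def] by (metis cinner_commute complex_cnj_zero)
    then have "cinner x w = \<phi> x / \<phi> w * complex_of_real ((norm w)\<^sup>2)"
      by (simp add: cinner.diff_left cinner_scaleC_left cinner_self)
    then show ?thesis
      using w \<open>w \<noteq> 0\<close> by (simp add: cinner_scaleC_right)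
  qed
  then show ?thesis
    by blast
qed

lemma adj_exists:
  fixes T :: "'a::complex_hilbert \<Rightarrow>\<^sub>L 'b::complex_hilbert"
  assumes T: "T \<in> bounded_ops"
  shows "\<exists>S. S \<in> bounded_ops \<and> (\<forall>x y. cinner (blinfun_apply T x) y = cinner x (blinfun_apply S y))"
proof -
  have "\<exists>a. \<forall>x. cinner (T x) y = cinner x a" for y
  proof (rule riesz_representation)
    show "bounded_linear (\<lambda>x. cinner (T x) y)"
      using bounded_linear_compose[OF cinner.bounded_linear_left blinfun.bounded_linear_right] .
  qed (simp add: bounded_opsD[OF T] cinner_scaleC_left)
  then obtain f where f: "\<And>x y. cinner (T x) y = cinner x (f y)"
    by metis
  have f': "cinner (f y) x = cinner y (T x)" for x y
    by (metis cinner_commute f)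
  have add: "f (x + y) = f x + f y" for x y
    by (rule cinner_eqI) (simp add: f' cinner.add_left)
  have scale: "f (c *\<^sub>C x) = c *\<^sub>C f x" for c x
    by (rule cinner_eqI) (simp add: f' cinner_scaleC_left)
  have bound: "norm (f y) \<le> norm T * norm y" for y
  proof -
    have "cmod (cinner (f y) (f y)) = cmod (cinner y (T (f y)))"
      by (simp add: f')
    also have "\<dots> \<le> norm y * (norm T * norm (f y))"
      by (rule order_trans[OF norm_cinner_le]) (simp add: mult_left_mono norm_blinfun)
    finally have "cmod (cinner (f y) (f y)) \<le> (norm T * norm y) * norm (f y)"
      by (simp add: mult_ac)
    then show ?thesis
      by (cases "f y = 0") (simp_all add: cinner_self power2_eq_square norm_mult)
  qed
  show ?thesis
    using blinfun_in_bounded_opsI[of f "norm T", OF add scale bound] f by metis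
qed

lemma adj_unique:
  assumes "S \<in> bounded_ops" and "\<And>x y. cinner (blinfun_apply T x) y = cinner x (blinfun_apply S y)"
  shows "adj T = S"
  unfolding adj_def
proof (rule the_equality)
  fix S'
  assume "S' \<in> bounded_ops \<and> (\<forall>x y. cinner (blinfun_apply T x) y = cinner x (blinfun_apply S' y))"
  then have "cinner (S' y) x = cinner (S y) x" for x y
    by (metis assms(2) cinner_commute)
  then show "S' = S"
    by (intro blinfun_eqI cinner_eqI)
qed (use assms in blast)

lemma
  assumes "T \<in> bounded_ops"
  shows adj_bounded_ops [simp, intro]: "adj T \<in> bounded_ops"
    and cinner_adj_right: "cinner x (blinfun_apply (adj T) y) = cinner (blinfun_apply T x) y"
    and cinner_adj_left: "cinner (blinfun_apply (adj T) y) x = cinner y (blinfun_apply T x)"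
proof -
  obtain S where S: "S \<in> bounded_ops" "\<And>x y. cinner (T x) y = cinner x (S y)"
    using adj_exists[OF assms] by blast
  have "adj T = S"
    using S by (rule adj_unique)
  with S show "adj T \<in> bounded_ops" "cinner x (adj T y) = cinner (T x) y"
    "cinner (adj T y) x = cinner y (T x)"
    by (auto, metis cinner_commute)
qed

lemma adj_adj [simp]: "T \<in> bounded_ops \<Longrightarrow> adj (adj T) = T"
  by (rule adj_unique) (simp_all add: cinner_adj_left)

lemma adj_id [simp]: "adj id_blinfun = id_blinfun"
  by (rule adj_unique) simp_all

lemma adj_zero [simp]: "adj 0 = 0"
  by (rule adj_unique) simp_all

lemma adj_compose:
  "S \<in> bounded_ops \<Longrightarrow> T \<in> bounded_ops \<Longrightarrow> adj (S o\<^sub>L T) = adj T o\<^sub>L adj S"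
  by (rule adj_unique) (auto simp: cinner_adj_right)

lemma adj_diff:
  "S \<in> bounded_ops \<Longrightarrow> T \<in> bounded_ops \<Longrightarrow> adj (S - T) = adj S - adj T"
  by (rule adj_unique) (auto simp: cinner_adj_right blinfun.bilinear_simps cinner.diff_left cinner.diff_right)

lemma adj_add:
  "S \<in> bounded_ops \<Longrightarrow> T \<in> bounded_ops \<Longrightarrow> adj (S + T) = adj S + adj T"
  by (rule adj_unique) (auto simp: cinner_adj_right blinfun.bilinear_simps cinner.add_left cinner.add_right)

lemma adj_scaleR: "S \<in> bounded_ops \<Longrightarrow> adj (r *\<^sub>R S) = r *\<^sub>R adj S"
  by (rule adj_unique) (auto simp: cinner_adj_right blinfun.bilinear_simps cinner.scaleR_left cinner.scaleR_right)

lemma norm_adj_le: 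
  assumes "T \<in> bounded_ops"
  shows "norm (adj T) \<le> norm T"
proof (rule norm_blinfun_bound)
  fix y
  have "cmod (cinner (adj T y) (adj T y)) = cmod (cinner y (T (adj T y)))"
    by (simp add: cinner_adj_left assms)
  also have "\<dots> \<le> norm y * (norm T * norm (adj T y))"
    by (rule order_trans[OF norm_cinner_le]) (simp add: mult_left_mono norm_blinfun)
  finally have "cmod (cinner (adj T y) (adj T y)) \<le> (norm T * norm y) * norm (adj T y)"
    by (simp add: mult_ac)
  then show "norm (adj T y) \<le> norm T * norm y"
    by (cases "adj T y = 0") (simp_all add: cinner_self power2_eq_square norm_mult)
qed simp

lemma norm_adj: "T \<in> bounded_ops \<Longrightarrow> norm (adj T) = norm T"
  using norm_adj_le[of T] norm_adj_le[of "adj T"] by auto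

section \<open>Extension of operators from a spanning family\<close>

lemma closure_add_mem:
  fixes G :: "'a::real_normed_vector set"
  assumes "\<And>p q. p \<in> G \<Longrightarrow> q \<in> G \<Longrightarrow> p + q \<in> G" and "p \<in> closure G" and "q \<in> closure G"
  shows "p + q \<in> closure G"
proof -
  obtain f g where "\<And>n. f n \<in> G" "f \<longlonglongrightarrow> p" "\<And>n. g n \<in> G" "g \<longlonglongrightarrow> q"
    using assms(2,3) unfolding closure_sequential by blast
  then show ?thesis
    unfolding closure_sequential
    by (intro exI[of _ "\<lambda>n. f n + g n"]) (auto intro: assms(1) tendsto_add)
qed

text \<open>
  The tool for constructing operators: prescribed values on a family \<open>u\<close> extend if finite linear combinations
  satisfy the norm inequality. The operator vanishes on the orthogonal complement of \<open>u\<close>. It is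
  built from its graph: the inequality survives the closure of the set of pairs of linear
  combinations, so this closure is the graph of a bounded operator on a closed subspace, which is then
  composed with the orthogonal projection.
\<close>

lemma bounded_op_extension:
  fixes u :: "'i \<Rightarrow> 'a::complex_hilbert" and v :: "'i \<Rightarrow> 'b::complex_hilbert"
  assumes M: "0 \<le> M"
    and le: "\<And>S c. finite S \<Longrightarrow> norm (\<Sum>i\<in>S. c i *\<^sub>C v i) \<le> M * norm (\<Sum>i\<in>S. c i *\<^sub>C u i)"
  shows "\<exists>R. R \<in> bounded_ops \<and> norm R \<le> M \<and> (\<forall>i. blinfun_apply R (u i) = v i) \<and>
    (\<forall>z. (\<forall>i. cinner (u i) z = 0) \<longrightarrow> blinfun_apply R z = 0)"
proof -
  define G where "G = {(\<Sum>i\<in>S. c i *\<^sub>C u i, \<Sum>i\<in>S. c i *\<^sub>C v i) | S c. finite S}"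
  have G_add: "p + q \<in> G" if "p \<in> G" "q \<in> G" for p q
  proof -
    obtain S c where S: "finite S" "p = (\<Sum>i\<in>S. c i *\<^sub>C u i, \<Sum>i\<in>S. c i *\<^sub>C v i)"
      using \<open>p \<in> G\<close> by (auto simp: G_def)
    obtain S' c' where S': "finite S'" "q = (\<Sum>i\<in>S'. c' i *\<^sub>C u i, \<Sum>i\<in>S'. c' i *\<^sub>C v i)"
      using \<open>q \<in> G\<close> by (auto simp: G_def)
    define d where "d i = (if i \<in> S then c i else 0) + (if i \<in> S' then c' i else 0)" for i
    have *: "(\<Sum>i\<in>S. c i *\<^sub>C w i) + (\<Sum>i\<in>S'. c' i *\<^sub>C w i) = (\<Sum>i\<in>S \<union> S'. d i *\<^sub>C w i)"
      for w :: "'i \<Rightarrow> 'c::complex_hilbert"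
    proof -
      have "(\<Sum>i\<in>S. c i *\<^sub>C w i) = (\<Sum>i\<in>S \<union> S'. (if i \<in> S then c i else 0) *\<^sub>C w i)"
        using S(1) S'(1) by (intro sum.mono_neutral_cong_left) auto
      moreover have "(\<Sum>i\<in>S'. c' i *\<^sub>C w i) = (\<Sum>i\<in>S \<union> S'. (if i \<in> S' then c' i else 0) *\<^sub>C w i)"
        using S(1) S'(1) by (intro sum.mono_neutral_cong_left) auto
      ultimately show ?thesis
        by (simp add: d_def scaleC_add_left sum.distrib)
    qed
    show ?thesis
      unfolding G_def using S S' *[of u] *[of v] by (intro CollectI exI[of _ "S \<union> S'"] exI[of _ d]) simp
  qed
  have G_scale: "(a *\<^sub>C x, a *\<^sub>C y) \<in> G" if "(x, y) \<in> G" for a x y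
  proof -
    obtain S c where S: "finite S" "x = (\<Sum>i\<in>S. c i *\<^sub>C u i)" "y = (\<Sum>i\<in>S. c i *\<^sub>C v i)"
      using \<open>(x, y) \<in> G\<close> by (auto simp: G_def)
    then show ?thesis
      unfolding G_def by (intro CollectI exI[of _ S] exI[of _ "\<lambda>i. a * c i"])
        (simp add: scaleC.sum_right scaleC_scaleC)
  qed
  define \<Gamma> where "\<Gamma> = closure G"
  have \<Gamma>_add: "(x + x', y + y') \<in> \<Gamma>" if "(x, y) \<in> \<Gamma>" "(x', y') \<in> \<Gamma>" for x x' y y'
    using closure_add_mem[OF G_add, of "(x, y)" "(x', y')"] that by (simp add: \<Gamma>_def)
  have \<Gamma>_scale: "(a *\<^sub>C x, a *\<^sub>C y) \<in> \<Gamma>" if "(x, y) \<in> \<Gamma>" for a x y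
  proof -
    define h where "h = (\<lambda>p :: 'a \<times> 'b. (a *\<^sub>C fst p, a *\<^sub>C snd p))"
    have "continuous_on UNIV h"
      unfolding h_def by (intro continuous_intros scaleC.continuous_on)
    then have "h ` closure G \<subseteq> closure G"
      using G_scale by (intro image_closure_subset)
        (auto simp: h_def intro!: closure_subset[THEN subsetD] elim: continuous_on_subset)
    then show ?thesis
      using that by (force simp: \<Gamma>_def h_def)
  qed
  have \<Gamma>_diff: "(x - x', y - y') \<in> \<Gamma>" if "(x, y) \<in> \<Gamma>" "(x', y') \<in> \<Gamma>" for x x' y y'
    using \<Gamma>_add[OF that(1) \<Gamma>_scale[OF that(2), of "complex_of_real (-1)"]]
    by (simp only: scaleR_scaleC[symmetric]) simp
  have \<Gamma>_bound: "norm y \<le> M * norm x" if "(x, y) \<in> \<Gamma>" for x y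
  proof -
    have "closure G \<subseteq> {p. norm (snd p) \<le> M * norm (fst p)}"
    proof (rule closure_minimal)
      show "G \<subseteq> {p. norm (snd p) \<le> M * norm (fst p)}"
        using le by (auto simp: G_def)
      show "closed {p :: 'a \<times> 'b. norm (snd p) \<le> M * norm (fst p)}"
        by (intro closed_Collect_le continuous_intros)
    qed
    then show ?thesis
      using that by (auto simp: \<Gamma>_def)
  qed
  have uv: "(u i, v i) \<in> \<Gamma>" for i
  proof -
    have "(u i, v i) \<in> G"
      unfolding G_def by (intro CollectI exI[of _ "{i}"] exI[of _ "\<lambda>_. 1"]) simp
    then show ?thesis
      using closure_subset by (auto simp: \<Gamma>_def)
  qed
  have zero: "(0, 0) \<in> \<Gamma>"
  proof -
    have "(0, 0) \<in> G"
      unfolding G_def by (intro CollectI exI[of _ "{}"]) simp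
    then show ?thesis
      using closure_subset by (auto simp: \<Gamma>_def)
  qed
  define D where "D = fst ` \<Gamma>"
  have DI: "x \<in> D" if "(x, y) \<in> \<Gamma>" for x y
    unfolding D_def using that by force
  have D_sub: "complex_vector.subspace D"
    by (rule complex_vector.subspaceI)
      (use zero \<Gamma>_add \<Gamma>_scale in \<open>auto simp: D_def image_iff, (metis fst_conv)+\<close>)
  have D_closed: "closed D"
    unfolding closed_sequential_limits
  proof (intro allI impI, elim conjE)
    fix x l
    assume "\<forall>n. x n \<in> D" and x: "x \<longlonglongrightarrow> l"
    then have "\<forall>n. \<exists>y. (x n, y) \<in> \<Gamma>"
      unfolding D_def by (metis imageE prod.collapse)
    then obtain y where xy: "\<And>n. (x n, y n) \<in> \<Gamma>"
      by metis
    have "Cauchy y"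
    proof (rule metric_CauchyI)
      fix e :: real
      assume "0 < e"
      then have "0 < e / (M + 1)"
        using M by simp
      then obtain N where N: "\<And>m n. m \<ge> N \<Longrightarrow> n \<ge> N \<Longrightarrow> dist (x m) (x n) < e / (M + 1)"
        using LIMSEQ_imp_Cauchy[OF x] metric_CauchyD by blast
      have "dist (y m) (y n) < e" if "m \<ge> N" "n \<ge> N" for m n
      proof -
        have "dist (y m) (y n) \<le> M * dist (x m) (x n)"
          using \<Gamma>_bound[OF \<Gamma>_diff[OF xy xy]] by (simp add: dist_norm)
        also have "\<dots> \<le> (M + 1) * dist (x m) (x n)"
          by (intro mult_right_mono) simp_all
        also have "\<dots> < e"
          using N[OF that] M by (simp add: pos_less_divide_eq mult.commute)
        finally show ?thesis .
      qed
      then show "\<exists>N. \<forall>m\<ge>N. \<forall>n\<ge>N. dist (y m) (y n) < e"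
        by blast
    qed
    then obtain z where "y \<longlonglongrightarrow> z"
      using Cauchy_convergent_iff convergent_def by blast
    then have "(l, z) \<in> \<Gamma>"
      using closed_sequentially[of \<Gamma> "\<lambda>n. (x n, y n)" "(l, z)"] xy tendsto_Pair[OF x, of y z]
      by (simp add: \<Gamma>_def)
    then show "l \<in> D"
      by (rule DI)
  qed
  \<comment> \<open>\<open>p\<close> is the projection of \<open>z\<close> onto the domain, and \<open>w\<close> the value at \<open>p\<close>.\<close>
  define Q where "Q z p w \<longleftrightarrow> (p, w) \<in> \<Gamma> \<and> (\<forall>q\<in>D. cinner (z - p) q = 0)" for z p w
  have "\<exists>p w. Q z p w" for z
  proof -
    obtain p where "p \<in> D" "\<And>q. q \<in> D \<Longrightarrow> cinner (z - p) q = 0"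
      using orthogonal_decomposition[OF D_sub D_closed] by blast
    then show ?thesis
      unfolding Q_def D_def by force
  qed
  then obtain P f where PQ: "\<And>z. Q z (P z) (f z)"
    by metis
  have uniq: "w = f z" if "Q z p w" for z p w
  proof -
    have "(p - P z, w - f z) \<in> \<Gamma>"
      using that PQ \<Gamma>_diff by (simp add: Q_def)
    moreover have "cinner (p - P z) (p - P z) = 0"
    proof -
      have "p - P z \<in> D"
        using calculation by (rule DI)
      then have "cinner (z - P z) (p - P z) - cinner (z - p) (p - P z) = 0"
        using that PQ by (simp add: Q_def)
      then show ?thesis
        by (simp add: cinner.diff_left)
    qed
    then have "p - P z = 0"
      by (simp add: cinner_self)
    ultimately show ?thesis
      using \<Gamma>_bound[of "p - P z" "w - f z"] by simp
  qed
  have add: "f (x + y) = f x + f y" for x y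
  proof (rule uniq[symmetric])
    show "Q (x + y) (P x + P y) (f x + f y)"
      using PQ[of x] PQ[of y] \<Gamma>_add
      by (simp add: Q_def add_diff_add cinner.add_left)
  qed
  have scale: "f (c *\<^sub>C x) = c *\<^sub>C f x" for c x
  proof (rule uniq[symmetric])
    show "Q (c *\<^sub>C x) (c *\<^sub>C P x) (c *\<^sub>C f x)"
      using PQ[of x] \<Gamma>_scale
      by (simp add: Q_def scaleC.diff_right[symmetric] cinner_scaleC_left)
  qed
  have bound: "norm (f z) \<le> M * norm z" for z
  proof -
    have "cinner (z - P z) (P z) = 0"
      using PQ[of z] DI by (auto simp: Q_def)
    then have "(norm ((z - P z) + P z))\<^sup>2 = (norm (z - P z))\<^sup>2 + (norm (P z))\<^sup>2"
      by (subst norm_add_sqr) simp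
    then have "(norm (P z))\<^sup>2 \<le> (norm z)\<^sup>2"
      by simp
    then have "norm (P z) \<le> norm z"
      by (rule power2_le_imp_le) simp
    moreover have "norm (f z) \<le> M * norm (P z)"
      using PQ[of z] \<Gamma>_bound by (simp add: Q_def)
    ultimately show ?thesis
      using M mult_left_mono order_trans by blast
  qed
  show ?thesis
  proof (intro exI[of _ "Blinfun f"] conjI allI impI)
    show "blinfun_apply (Blinfun f) (u i) = v i" for i
      unfolding blinfun_in_bounded_opsI(2)[OF add scale bound]
      by (rule uniq[symmetric, of _ "u i"]) (simp add: Q_def uv)
    fix z
    assume z: "\<forall>i. cinner (u i) z = 0"
    have "\<Gamma> \<subseteq> {p. cinner (fst p) z = 0}"
      unfolding \<Gamma>_def
    proof (rule closure_minimal)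
      show "G \<subseteq> {p. cinner (fst p) z = 0}"
        by (auto simp: G_def cinner.sum_left cinner_scaleC_left z)
      show "closed {p :: 'a \<times> 'b. cinner (fst p) z = 0}"
        by (intro closed_Collect_eq cinner.continuous_on continuous_intros)
    qed
    then have "\<forall>q\<in>D. cinner q z = 0"
      by (auto simp: D_def)
    then have "\<forall>q\<in>D. cinner z q = 0"
      by (metis cinner_commute complex_cnj_zero)
    then show "blinfun_apply (Blinfun f) z = 0"
      unfolding blinfun_in_bounded_opsI(2)[OF add scale bound]
      by (intro uniq[symmetric, of _ 0]) (simp add: Q_def zero)
  qed (use blinfun_in_bounded_opsI[OF add scale bound] M in auto)
qed

section \<open>Finite orthonormal sets\<close>

definition orthonormal :: "'a::complex_hilbert set \<Rightarrow> bool"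
  where "orthonormal B \<longleftrightarrow> (\<forall>x\<in>B. \<forall>y\<in>B. cinner x y = (if x = y then 1 else 0))"

lemma norm_eq_1_of_cinner:
  assumes "cinner e e = 1"
  shows "norm e = 1"
proof -
  have "(norm e)\<^sup>2 = 1"
    using assms Re_cinner_self[of e] by simp
  then show ?thesis
    using norm_ge_zero[of e] by (auto simp: power2_eq_1_iff)
qed

lemma orthonormal_expansion:
  assumes "finite B" and "orthonormal B" and "x \<in> complex_vector.span B"
  shows "x = (\<Sum>e\<in>B. cinner x e *\<^sub>C e)"
  using assms(3)
proof (induction rule: complex_vector.span_induct_alt)
  case (step c x y)
  have "(\<Sum>e\<in>B. cinner x e *\<^sub>C e) = x"
  proof -
    have "(\<Sum>e\<in>B. cinner x e *\<^sub>C e) = (\<Sum>e\<in>B. if x = e then e else 0)"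
      using assms(2) step(1) by (intro sum.cong) (auto simp: orthonormal_def)
    then show ?thesis
      using assms(1) step(1) by simp
  qed
  moreover have "(\<Sum>e\<in>B. cinner (c *\<^sub>C x + y) e *\<^sub>C e)
      = c *\<^sub>C (\<Sum>e\<in>B. cinner x e *\<^sub>C e) + (\<Sum>e\<in>B. cinner y e *\<^sub>C e)"
    by (simp add: cinner.add_left cinner_scaleC_left scaleC_add_left sum.distrib
        scaleC.sum_right scaleC_scaleC)
  ultimately show ?case
    using step by simp
qed simp

lemma orthonormal_insert:
  fixes x :: "'a::complex_hilbert"
  assumes "finite B" and "orthonormal B" and "x \<notin> complex_vector.span B"
  obtains e where "orthonormal (insert e B)" and "e \<notin> B" and "x \<in> complex_vector.span (insert e B)"
proof -
  define p where "p = (\<Sum>e\<in>B. cinner x e *\<^sub>C e)"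
  have p: "p \<in> complex_vector.span B"
    unfolding p_def
    by (intro complex_vector.span_sum complex_vector.span_scale complex_vector.span_base)
  define w where "w = x - p"
  have "w \<noteq> 0"
    using assms(3) p by (auto simp: w_def)
  have orth: "cinner w y = 0" if "y \<in> B" for y
  proof -
    have "cinner p y = (\<Sum>e\<in>B. if e = y then cinner x e else 0)"
      unfolding p_def cinner.sum_left using assms(2) that
      by (intro sum.cong) (auto simp: orthonormal_def cinner_scaleC_left)
    then show ?thesis
      using assms(1) that by (simp add: w_def cinner.diff_left)
  qed
  define e where "e = complex_of_real (inverse (norm w)) *\<^sub>C w"
  have "norm e = 1"
    using \<open>w \<noteq> 0\<close> unfolding e_def norm_scaleC norm_of_real by simp
  then have e1: "cinner e e = 1"
    by (simp add: cinner_self)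
  have e2: "cinner e y = 0" "cinner y e = 0" if "y \<in> B" for y
    using orth[OF that] cinner_commute[of y w]
    by (simp_all add: e_def cinner_scaleC_left cinner_scaleC_right)
  have "e \<notin> B"
    using e1 e2 by fastforce
  moreover have "orthonormal (insert e B)"
    using assms(2) e1 e2 \<open>e \<notin> B\<close> by (auto simp: orthonormal_def)
  moreover have "x = p + complex_of_real (norm w) *\<^sub>C e"
    using \<open>w \<noteq> 0\<close> by (simp add: e_def scaleC_scaleC del: of_real_inverse flip: of_real_mult) (simp add: w_def)
  then have "x \<in> complex_vector.span (insert e B)"
    using p complex_vector.span_mono[of B "insert e B"]
    by (metis complex_vector.span_add complex_vector.span_base complex_vector.span_scale
        insertI1 subsetD subset_insertI)
  ultimately show thesis
    using that by blast
qed

lemma gram_schmidt: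
  "finite S \<Longrightarrow> \<exists>B. finite B \<and> orthonormal B \<and> S \<subseteq> complex_vector.span B"
proof (induction rule: finite_induct)
  case empty
  then show ?case
    by (intro exI[of _ "{}"]) (simp add: orthonormal_def)
next
  case (insert x S)
  then obtain B where B: "finite B" "orthonormal B" "S \<subseteq> complex_vector.span B"
    by blast
  show ?case
  proof (cases "x \<in> complex_vector.span B")
    case True
    then show ?thesis
      using B by blast
  next
    case False
    then obtain e where "orthonormal (insert e B)" "x \<in> complex_vector.span (insert e B)"
      using orthonormal_insert B by blast
    then show ?thesis
      using B complex_vector.span_mono[of B "insert e B"] by (intro exI[of _ "insert e B"]) auto
  qed
qed

lemma unit_vector_orthogonal_to_finite_set:
  fixes S :: "'a::complex_hilbert set"
  assumes "infinite_dimensional TYPE('a)" and "finite S"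
  obtains e where "cinner e e = 1" and "\<And>x. x \<in> S \<Longrightarrow> cinner e x = 0"
proof -
  obtain B where B: "finite B" "orthonormal B" "S \<subseteq> complex_vector.span B"
    using gram_schmidt[OF assms(2)] by blast
  then obtain x where "x \<notin> complex_vector.span B"
    using assms(1) unfolding infinite_dimensional_def by blast
  then obtain e where e: "orthonormal (insert e B)" "e \<notin> B"
    using orthonormal_insert[OF B(1,2)] by blast
  have "cinner e x = 0" if "x \<in> S" for x
  proof -
    have "cinner e x = cinner e (\<Sum>y\<in>B. cinner x y *\<^sub>C y)"
      using orthonormal_expansion[OF B(1,2), of x] B(3) that by auto
    also have "\<dots> = 0"
      unfolding cinner.sum_right using e
      by (intro sum.neutral) (auto simp: orthonormal_def cinner_scaleC_right)
    finally show ?thesis .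
  qed
  then show thesis
    using e that by (auto simp: orthonormal_def)
qed

section \<open>Realization of positive kernels\<close>

text \<open>
  The vectors are chosen one by one, as in a Cholesky decomposition. By the Cauchy-Schwarz
  inequality for the kernel, the conditions on the inner products of the new vector with the earlier ones
  define a functional of norm at most \<open>sqrt k\<close>, where \<open>k = \<kappa> m m\<close>. It is represented by a vector \<open>a\<close>,
  and a multiple of a unit vector orthogonal to \<open>a\<close> and to all earlier vectors corrects the norm.
\<close>

lemma positive_kernel_realization:
  fixes \<kappa> :: "nat \<Rightarrow> nat \<Rightarrow> complex"
  assumes inf: "infinite_dimensional TYPE('k::complex_hilbert)"
    and herm: "\<And>i j. \<kappa> i j = cnj (\<kappa> j i)"
    and psd: "\<And>S c. finite S \<Longrightarrow> 0 \<le> Re (\<Sum>i\<in>S. \<Sum>j\<in>S. c i * cnj (c j) * \<kappa> i j)"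
  obtains v :: "nat \<Rightarrow> 'k::complex_hilbert" where "\<And>i j. cinner (v i) (v j) = \<kappa> i j"
proof -
  define P where "P f m r \<longleftrightarrow> (\<forall>j<m. cinner r (f j) = \<kappa> m j) \<and> cinner r r = \<kappa> m m"
    for f :: "nat \<Rightarrow> 'k" and m r
  have "\<exists>f. \<forall>m. P f m (f m)"
  proof (rule dependent_wellorder_choice)
    fix r :: 'k and f g :: "nat \<Rightarrow> 'k" and m
    assume "\<And>j. j < m \<Longrightarrow> f j = g j"
    then show "P f m r = P g m r"
      by (simp add: P_def)
  next
    fix m and f :: "nat \<Rightarrow> 'k"
    assume *: "\<And>j. j < m \<Longrightarrow> P f j (f j)"
    have gram: "cinner (f i) (f j) = \<kappa> i j" if "i < m" "j < m" for i j
    proof (rule linorder_cases[of i j])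
      assume "i < j"
      then show ?thesis
        using *[of j] that herm[of i j] cinner_commute[of "f i" "f j"] by (simp add: P_def)
    qed (use *[of i] that in \<open>auto simp: P_def\<close>)
    obtain e0 :: 'k where e0: "cinner e0 e0 = 1"
      using unit_vector_orthogonal_to_finite_set[OF inf, of "{}"] by blast
    then have ne0: "norm e0 = 1"
      by (rule norm_eq_1_of_cinner)
    define k where "k = Re (\<kappa> m m)"
    have kk: "\<kappa> m m = complex_of_real k"
      using herm[of m m] by (simp add: k_def complex_eq_iff)
    define u where "u i = (if i < m then f i else 0)" for i
    define v where "v i = (if i < m then \<kappa> i m *\<^sub>C e0 else 0)" for i
    have "0 \<le> k"
      using psd[of "{m}" "\<lambda>_. 1"] by (simp add: k_def)
    have "norm (\<Sum>i\<in>S. c i *\<^sub>C v i) \<le> sqrt k * norm (\<Sum>i\<in>S. c i *\<^sub>C u i)" if "finite S" for S c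
    proof -
      define S' where "S' = S \<inter> {..<m}"
      have fin: "finite S'" and m: "m \<notin> S'"
        using that by (auto simp: S'_def)
      define s where "s = (\<Sum>i\<in>S'. c i * \<kappa> i m)"
      define x where "x = (\<Sum>i\<in>S'. c i *\<^sub>C f i)"
      have "(\<Sum>i\<in>S. c i *\<^sub>C u i) = x"
        unfolding x_def S'_def using that by (intro sum.mono_neutral_cong_right) (auto simp: u_def)
      moreover have "(\<Sum>i\<in>S. c i *\<^sub>C v i) = s *\<^sub>C e0"
        unfolding s_def S'_def scaleC.sum_left using that
        by (intro sum.mono_neutral_cong_right) (auto simp: v_def scaleC_scaleC)
      moreover have "cmod s \<le> sqrt k * norm x"
      proof -
        \<comment> \<open>Positivity of the kernel for the coefficients \<open>c\<close> and the coefficient \<open>- \<tau> * s\<close> at the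
           index \<open>m\<close>.\<close>
        have quad: "0 \<le> (norm x)\<^sup>2 - 2 * \<tau> * (cmod s)\<^sup>2 + \<tau>\<^sup>2 * (cmod s)\<^sup>2 * k" for \<tau> :: real
        proof -
          define l where "l = - complex_of_real \<tau> * s"
          define d where "d = c(m := l)"
          have 1: "(\<Sum>i\<in>S'. \<Sum>j\<in>S'. c i * cnj (c j) * \<kappa> i j) = cinner x x"
            unfolding x_def cinner.sum_left unfolding cinner.sum_right
            by (intro sum.cong refl)
              (simp add: cinner_scaleC_left cinner_scaleC_right gram S'_def mult_ac)
          have 2: "(\<Sum>j\<in>S'. l * cnj (c j) * \<kappa> m j) = l * cnj s"
            unfolding s_def sum_distrib_left cnj_sum
            by (intro sum.cong refl) (simp add: herm[of m])
          have 3: "(\<Sum>i\<in>S'. c i * cnj l * \<kappa> i m) = cnj l * s"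
            unfolding s_def sum_distrib_left by (intro sum.cong refl) (simp add: mult_ac)
          have dc: "d i = c i" if "i \<in> S'" for i
            using that m by (auto simp: d_def)
          have "(\<Sum>i\<in>insert m S'. \<Sum>j\<in>insert m S'. d i * cnj (d j) * \<kappa> i j)
            = l * cnj l * \<kappa> m m + (\<Sum>j\<in>S'. l * cnj (c j) * \<kappa> m j)
             + ((\<Sum>i\<in>S'. c i * cnj l * \<kappa> i m) + (\<Sum>i\<in>S'. \<Sum>j\<in>S'. c i * cnj (c j) * \<kappa> i j))"
            using fin m by (simp add: sum.distrib dc cong: sum.cong) (simp add: d_def)
          also have "\<dots> = l * cnj l * \<kappa> m m + l * cnj s + (cnj l * s + cinner x x)"
            by (simp only: 1 2 3)
          also have "\<dots> = complex_of_real (\<tau>\<^sup>2 * k - 2 * \<tau>) * (s * cnj s) + complex_of_real ((norm x)\<^sup>2)"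
            by (simp add: l_def kk cinner_self algebra_simps power2_eq_square)
          also have "\<dots> = complex_of_real ((norm x)\<^sup>2 - 2 * \<tau> * (cmod s)\<^sup>2 + \<tau>\<^sup>2 * (cmod s)\<^sup>2 * k)"
            unfolding complex_norm_square[symmetric] by (simp add: algebra_simps)
          finally show ?thesis
            using psd[of "insert m S'" d] fin by simp
        qed
        have "(cmod s)\<^sup>2 \<le> k * (norm x)\<^sup>2"
        proof (cases "k = 0")
          case True
          have "cmod s = 0"
          proof (rule ccontr)
            assume "cmod s \<noteq> 0"
            then show False
              using quad[of "((norm x)\<^sup>2 + 1) / (cmod s)\<^sup>2"] True by (simp add: add_nonneg_eq_0_iff)
                (smt (verit) zero_le_power2)
          qed
          then show ?thesis
            using True by simp
        next
          case False
          then have "0 < k"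
            using \<open>0 \<le> k\<close> by simp
          then show ?thesis
            using quad[of "1 / k"] by (simp add: field_simps power2_eq_square)
        qed
        then have "sqrt ((cmod s)\<^sup>2) \<le> sqrt (k * (norm x)\<^sup>2)"
          by (rule real_sqrt_le_mono)
        then show ?thesis
          by (simp add: real_sqrt_mult)
      qed
      ultimately show ?thesis
        by (simp add: norm_scaleC ne0)
    qed
    then obtain R where R: "R \<in> bounded_ops" "norm R \<le> sqrt k" "\<And>i. blinfun_apply R (u i) = v i"
      using bounded_op_extension[of "sqrt k" v u] \<open>0 \<le> k\<close> by auto
    \<comment> \<open>\<open>R\<close> is the functional with values in the line spanned by \<open>e0\<close>, so its adjoint gives the
       representing vector without a projection.\<close>
    define a where "a = adj R e0"
    have "norm a \<le> sqrt k"
      using R norm_blinfun[of "adj R" e0] by (simp add: a_def ne0 norm_adj)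
    then have "(norm a)\<^sup>2 \<le> k"
      using power_mono[of "norm a" "sqrt k" 2] \<open>0 \<le> k\<close> by simp
    have a_f: "cinner a (f j) = \<kappa> m j" if "j < m" for j
    proof -
      have "cinner a (f j) = cinner e0 (R (u j))"
        using that R by (simp add: a_def cinner_adj_left u_def)
      then show ?thesis
        using that R herm[of m j] by (simp add: v_def cinner_scaleC_right e0)
    qed
    obtain e where e: "cinner e e = 1" "\<And>x. x \<in> insert a (f ` {..<m}) \<Longrightarrow> cinner e x = 0"
      using unit_vector_orthogonal_to_finite_set[OF inf, of "insert a (f ` {..<m})"] by blast
    define b where "b = complex_of_real (sqrt (k - (norm a)\<^sup>2))"
    have "cinner a e = 0"
      using e(2)[of a] cinner_commute[of a e] by simp
    then have "cinner (a + b *\<^sub>C e) (a + b *\<^sub>C e) = complex_of_real ((norm a)\<^sup>2) + b * cnj b"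
      using e by (simp add: cinner.add_left cinner.add_right cinner_scaleC_left
          cinner_scaleC_right cinner_self[of a])
    also have "b * cnj b = complex_of_real (k - (norm a)\<^sup>2)"
      using \<open>(norm a)\<^sup>2 \<le> k\<close> by (simp add: b_def flip: of_real_mult)
    finally have "cinner (a + b *\<^sub>C e) (a + b *\<^sub>C e) = \<kappa> m m"
      by (simp add: kk)
    then have "P f m (a + b *\<^sub>C e)"
      using e a_f by (simp add: P_def cinner.add_left cinner_scaleC_left)
    then show "\<exists>r. P f m r"
      by blast
  qed
  then obtain f where f: "\<And>m. P f m (f m)"
    by blast
  have "cinner (f i) (f j) = \<kappa> i j" for i j
  proof (rule linorder_cases[of i j])
    assume "i < j"
    then show ?thesis
      using f[of j] herm[of i j] cinner_commute[of "f i" "f j"] by (simp add: P_def)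
  qed (use f[of i] in \<open>auto simp: P_def\<close>)
  then show thesis
    by (rule that)
qed

section \<open>Inverses and the Neumann series\<close>

lemma op_inv_eq:
  assumes "S \<in> bounded_ops" and "S o\<^sub>L T = id_blinfun" and "T o\<^sub>L S = id_blinfun"
  shows "op_inv T = S"
  unfolding op_inv_def
proof (rule the_equality)
  fix S'
  assume S': "S' \<in> bounded_ops \<and> S' o\<^sub>L T = id_blinfun \<and> T o\<^sub>L S' = id_blinfun"
  have "S' x = S x" for x
  proof -
    have "S' x = S' ((T o\<^sub>L S) x)"
      by (simp only: assms id_blinfun.rep_eq)
    also have "\<dots> = (S' o\<^sub>L T) (S x)"
      by simp
    also have "\<dots> = S x"
      by (simp only: S' id_blinfun.rep_eq)
    finally show ?thesis .
  qed
  then show "S' = S"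
    by (intro blinfun_eqI)
qed (use assms in blast)

lemma blinfun_compose_assoc: "(R o\<^sub>L S) o\<^sub>L T = R o\<^sub>L (S o\<^sub>L T)"
  by (rule blinfun_eqI) simp

lemma blinfun_compose_id [simp]: "R o\<^sub>L id_blinfun = R" "id_blinfun o\<^sub>L R = R"
  by (simp_all add: blinfun_eqI)

definition op_power :: "('a::real_normed_vector \<Rightarrow>\<^sub>L 'a) \<Rightarrow> nat \<Rightarrow> ('a \<Rightarrow>\<^sub>L 'a)"
  where "op_power T k = ((\<lambda>S. T o\<^sub>L S) ^^ k) id_blinfun"

lemma op_power_0 [simp]: "op_power T 0 = id_blinfun"
  and op_power_Suc: "op_power T (Suc k) = T o\<^sub>L op_power T k"
  by (simp_all add: op_power_def)

lemma op_power_Suc_right: "op_power T (Suc k) = op_power T k o\<^sub>L T"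
proof (induction k)
  case (Suc k)
  have "op_power T (Suc (Suc k)) = T o\<^sub>L (op_power T k o\<^sub>L T)"
    by (simp only: op_power_Suc[of T "Suc k"] Suc)
  then show ?case
    by (simp only: blinfun_compose_assoc op_power_Suc)
qed (simp add: op_power_Suc)

lemma op_power_bounded_ops: "T \<in> bounded_ops \<Longrightarrow> op_power T k \<in> bounded_ops"
  by (induction k) (auto simp: op_power_Suc)

lemma norm_op_power_le: "norm (op_power T k) \<le> norm T ^ k"
proof (induction k)
  case 0
  show ?case
    by simp (rule norm_blinfun_bound, simp_all)
next
  case (Suc k)
  have "norm (op_power T (Suc k)) \<le> norm T * norm (op_power T k)"
    unfolding op_power_Suc by (rule norm_blinfun_compose)
  also have "\<dots> \<le> norm T * norm T ^ k"
    by (intro mult_left_mono Suc.IH) simp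
  finally show ?case
    by simp
qed

lemma neumann_series:
  fixes T :: "'a::complex_hilbert \<Rightarrow>\<^sub>L 'a"
  assumes T: "T \<in> bounded_ops" and "norm T < 1"
  obtains N where "N \<in> bounded_ops" and "op_power T sums N"
    and "N o\<^sub>L (id_blinfun - T) = id_blinfun" and "(id_blinfun - T) o\<^sub>L N = id_blinfun"
proof -
  have "summable (\<lambda>k. norm (op_power T k))"
    by (rule summable_comparison_test'[of "\<lambda>k. norm T ^ k"])
      (use assms(2) norm_op_power_le in \<open>auto intro: summable_geometric\<close>)
  then have "summable (op_power T)"
    by (rule summable_norm_cancel)
  then obtain N where N: "op_power T sums N"
    by (auto simp: summable_def)
  have shift: "(\<lambda>k. op_power T (Suc k)) sums (N - id_blinfun)"
    using sums_split_initial_segment[OF N, of 1] by simp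
  have "(\<lambda>k. T o\<^sub>L op_power T k) sums (T o\<^sub>L N)"
    using N by (intro bounded_linear.sums[OF bounded_bilinear.bounded_linear_right
        [OF bounded_bilinear_blinfun_compose]])
  then have TN: "T o\<^sub>L N = N - id_blinfun"
    using shift sums_unique2 by (simp only: op_power_Suc)
  have "(\<lambda>k. op_power T k o\<^sub>L T) sums (N o\<^sub>L T)"
    using N by (intro bounded_linear.sums[OF bounded_bilinear.bounded_linear_left
        [OF bounded_bilinear_blinfun_compose]])
  then have NT: "N o\<^sub>L T = N - id_blinfun"
    using shift sums_unique2 by (simp only: op_power_Suc_right)
  have "N \<in> bounded_ops"
    using N unfolding sums_def
    by (rule bounded_ops_limit) (auto intro!: bounded_ops_sum op_power_bounded_ops T)
  moreover have "N o\<^sub>L (id_blinfun - T) = id_blinfun"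
    using arg_cong[OF NT, of "\<lambda>S. blinfun_apply S _"]
    by (intro blinfun_eqI) (simp add: blinfun.bilinear_simps)
  moreover have "(id_blinfun - T) o\<^sub>L N = id_blinfun"
    using arg_cong[OF TN, of "\<lambda>S. blinfun_apply S _"]
    by (intro blinfun_eqI) (simp add: blinfun.bilinear_simps)
  ultimately show thesis
    using N that by blast
qed

section \<open>Square roots and defect operators\<close>

text \<open>
  The square root of \<open>id_blinfun - B\<close> is sought in the form \<open>id_blinfun - R\<close>, which turns it into the fixed point
  equation \<open>R = (B + R\<^sup>2) / 2\<close>. The right-hand side is a contraction of the ball of radius
  \<open>\<rho> < 1\<close>, where \<open>\<rho>\<close> solves the scalar equation for \<open>norm B\<close>. By uniqueness the fixed point is
  self-adjoint together with \<open>B\<close>.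
\<close>

lemma square_root_equation:
  fixes B :: "'a::complex_hilbert \<Rightarrow>\<^sub>L 'a"
  assumes B: "B \<in> bounded_ops" and "adj B = B" and "norm B < 1"
  obtains R where "R \<in> bounded_ops" and "adj R = R" and "norm R < 1"
    and "2 *\<^sub>R R = B + (R o\<^sub>L R)"
proof -
  define \<rho> where "\<rho> = 1 - sqrt (1 - norm B)"
  have \<rho>: "0 \<le> \<rho>" "\<rho> < 1"
    using assms(3) by (simp_all add: \<rho>_def)
  have \<rho>2: "norm B + \<rho>\<^sup>2 = 2 * \<rho>"
    using assms(3) by (simp add: \<rho>_def power2_diff)
  define s where "s = {R :: 'a \<Rightarrow>\<^sub>L 'a. R \<in> bounded_ops \<and> norm R \<le> \<rho>}"
  define f where "f R = (1/2) *\<^sub>R (B + (R o\<^sub>L R))" for R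
  have "closed s"
    unfolding s_def
    by (intro closed_Collect_conj closed_Collect_le continuous_intros)
      (simp_all add: closed_bounded_ops)
  have "\<exists>!R\<in>s. f R = R"
  proof (rule Banach_fix)
    show "complete s"
      using \<open>closed s\<close> by (simp add: complete_eq_closed)
    show "s \<noteq> {}"
      using \<rho> by (auto simp: s_def intro!: exI[of _ 0])
    show "f ` s \<subseteq> s"
    proof clarify
      fix R
      assume R: "R \<in> s"
      have "norm (B + (R o\<^sub>L R)) \<le> norm B + norm R * norm R"
        using norm_triangle_ineq[of B "R o\<^sub>L R"] norm_blinfun_compose[of R R] by linarith
      then have "norm (f R) \<le> (1/2) * (norm B + norm R * norm R)"
        by (simp add: f_def)
      also have "\<dots> \<le> (1/2) * (norm B + \<rho>\<^sup>2)"
        using R \<rho> mult_mono[of "norm R" \<rho> "norm R" \<rho>] by (simp add: s_def power2_eq_square)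
      finally have "norm (f R) \<le> \<rho>"
        by (simp add: \<rho>2)
      then show "f R \<in> s"
        using R B by (auto simp: s_def f_def)
    qed
    show "dist (f R) (f R') \<le> \<rho> * dist R R'" if "R \<in> s" "R' \<in> s" for R R'
    proof -
      have "f R - f R' = (1/2) *\<^sub>R ((R o\<^sub>L (R - R')) + ((R - R') o\<^sub>L R'))"
        by (intro blinfun_eqI) (simp add: f_def blinfun.bilinear_simps algebra_simps)
      moreover have "norm ((R o\<^sub>L (R - R')) + ((R - R') o\<^sub>L R'))
          \<le> norm R * norm (R - R') + norm (R - R') * norm R'"
        using norm_triangle_ineq[of "R o\<^sub>L (R - R')" "(R - R') o\<^sub>L R'"]
          norm_blinfun_compose[of R "R - R'"] norm_blinfun_compose[of "R - R'" R'] by linarith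
      ultimately have "norm (f R - f R') \<le> (1/2) * (norm R * norm (R - R') + norm (R - R') * norm R')"
        by simp
      also have "\<dots> \<le> (1/2) * (\<rho> * norm (R - R') + norm (R - R') * \<rho>)"
        using that by (intro mult_left_mono add_mono mult_mono) (auto simp: s_def \<rho>)
      finally show ?thesis
        by (simp add: dist_norm)
    qed
  qed (use \<rho> in auto)
  then obtain R where R: "R \<in> s" "f R = R" and uniq: "\<And>R'. R' \<in> s \<Longrightarrow> f R' = R' \<Longrightarrow> R' = R"
    by blast
  have Rb: "R \<in> bounded_ops"
    using R by (simp add: s_def)
  have "f (adj R) = adj (f R)"
    unfolding f_def using Rb B assms(2)
    by (simp add: adj_scaleR adj_add adj_compose bounded_ops_add bounded_ops_compose)
  then have "adj R = R"
    using R Rb by (intro uniq) (auto simp: s_def norm_adj)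
  moreover have "2 *\<^sub>R R = B + (R o\<^sub>L R)"
    using arg_cong[OF R(2), of "\<lambda>S. 2 *\<^sub>R S"] by (simp add: f_def)
  ultimately show thesis
    using that R \<rho> by (auto simp: s_def)
qed

text \<open>
  The error \<open>E = C R - R' C\<close> satisfies \<open>2 E = E R + R' E\<close>, which is only possible for \<open>E = 0\<close>.
  With \<open>B = B'\<close> this says that the square root commutes with everything that commutes with \<open>B\<close>.
\<close>

lemma square_root_intertwines:
  assumes R: "2 *\<^sub>R R = B + (R o\<^sub>L R)" "norm R < 1"
    and R': "2 *\<^sub>R R' = B' + (R' o\<^sub>L R')" "norm R' < 1"
    and C: "C o\<^sub>L B = B' o\<^sub>L C"
  shows "C o\<^sub>L R = R' o\<^sub>L C"
proof -
  define E where "E = (C o\<^sub>L R) - (R' o\<^sub>L C)"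
  have "2 *\<^sub>R E = (E o\<^sub>L R) + (R' o\<^sub>L E)"
  proof (rule blinfun_eqI)
    fix x
    have 1: "2 *\<^sub>R R y = B y + R (R y)" for y
      using arg_cong[OF R(1), of "\<lambda>S. blinfun_apply S y"] by (simp add: blinfun.bilinear_simps)
    have 2: "2 *\<^sub>R R' y = B' y + R' (R' y)" for y
      using arg_cong[OF R'(1), of "\<lambda>S. blinfun_apply S y"] by (simp add: blinfun.bilinear_simps)
    have 3: "C (B y) = B' (C y)" for y
      using arg_cong[OF C, of "\<lambda>S. blinfun_apply S y"] by simp
    have "2 *\<^sub>R E x = C (2 *\<^sub>R R x) - 2 *\<^sub>R R' (C x)"
      by (simp add: E_def blinfun.bilinear_simps scaleR_diff_right)
    also have "\<dots> = C (R (R x)) - R' (R' (C x))"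
      by (simp add: 1 2 3 blinfun.bilinear_simps)
    also have "\<dots> = E (R x) + R' (E x)"
      by (simp add: E_def blinfun.bilinear_simps)
    finally show "(2 *\<^sub>R E) x = ((E o\<^sub>L R) + (R' o\<^sub>L E)) x"
      by (simp add: blinfun.bilinear_simps)
  qed
  then have "2 * norm E = norm ((E o\<^sub>L R) + (R' o\<^sub>L E))"
    by (metis abs_numeral norm_scaleR)
  also have "\<dots> \<le> norm E * norm R + norm R' * norm E"
    by (rule order_trans[OF norm_triangle_ineq add_mono[OF norm_blinfun_compose norm_blinfun_compose]])
  finally have "0 \<le> norm E * ((norm R - 1) + (norm R' - 1))"
    by (simp add: algebra_simps)
  then have "norm E = 0"
    using R(2) R'(2) by (simp add: zero_le_mult_iff)
  then show ?thesis
    by (simp add: E_def)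
qed

lemma self_adjoint_cinner_real:
  assumes "T \<in> bounded_ops" and "adj T = T"
  shows "cinner (blinfun_apply T x) x \<in> \<real>"
proof -
  have "cinner (T x) x = cnj (cinner (T x) x)"
    using cinner_adj_right[OF assms(1), of x x] cinner_commute[of x "T x"] assms(2) by simp
  then show ?thesis
    by (simp add: complex_is_Real_iff complex_eq_iff)
qed

text \<open>
  Any positive square root \<open>P\<close> commutes with \<open>B\<close> and therefore with \<open>S = id_blinfun - R\<close>. Then
  \<open>(S + P) (S - P) = 0\<close>, and \<open>S + P\<close> is injective because \<open>S\<close> is bounded below.
\<close>

lemma op_sqrt_one_minus:
  fixes B :: "'a::complex_hilbert \<Rightarrow>\<^sub>L 'a"
  assumes R: "R \<in> bounded_ops" "adj R = R" "norm R < 1" "2 *\<^sub>R R = B + (R o\<^sub>L R)"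
  shows "(id_blinfun - R) o\<^sub>L (id_blinfun - R) = id_blinfun - B"
    and "op_sqrt (id_blinfun - B) = id_blinfun - R"
proof -
  define S where "S = id_blinfun - R"
  have Re_le: "Re (cinner (R x) x) \<le> norm R * (norm x)\<^sup>2" for x
  proof -
    have "Re (cinner (R x) x) \<le> norm (R x) * norm x"
      by (rule order_trans[OF complex_Re_le_cmod norm_cinner_le])
    also have "\<dots> \<le> norm R * norm x * norm x"
      by (intro mult_right_mono norm_blinfun) simp
    finally show ?thesis
      by (simp add: power2_eq_square)
  qed
  have lower: "(1 - norm R) * (norm x)\<^sup>2 \<le> Re (cinner (S x) x)" for x
    using Re_le[of x] by (simp add: S_def blinfun.bilinear_simps cinner.diff_left algebra_simps)
  have SS: "S o\<^sub>L S = id_blinfun - B"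
  proof -
    have "S o\<^sub>L S = id_blinfun - 2 *\<^sub>R R + (R o\<^sub>L R)"
      by (intro blinfun_eqI) (simp add: S_def blinfun.bilinear_simps scaleR_2 algebra_simps)
    then show ?thesis
      by (simp add: R(4))
  qed
  have pos: "positive_op S"
    unfolding positive_op_def
  proof (intro conjI allI)
    show "S \<in> bounded_ops"
      using R(1) by (auto simp: S_def)
    fix x
    have "cinner (S x) x \<in> \<real>"
      using R \<open>S \<in> bounded_ops\<close> by (intro self_adjoint_cinner_real) (simp_all add: S_def adj_diff)
    moreover have "0 \<le> (1 - norm R) * (norm x)\<^sup>2"
      using R(3) by simp
    then have "0 \<le> Re (cinner (S x) x)"
      using lower[of x] by linarith
    ultimately show "cinner (S x) x \<in> \<real>\<^sub>\<ge>\<^sub>0"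
      by (simp add: complex_nonneg_Reals_iff complex_is_Real_iff)
  qed
  have uniq: "P = S" if P: "positive_op P" "P o\<^sub>L P = id_blinfun - B" for P
  proof -
    have PP: "P (P x) = x - B x" for x
      using arg_cong[OF P(2), of "\<lambda>S. blinfun_apply S x"] by (simp add: blinfun.bilinear_simps)
    have "P (B x) = B (P x)" for x
      using PP[of "P x"] arg_cong[OF PP[of x], of "blinfun_apply P"] by (simp add: blinfun.bilinear_simps)
    then have "P o\<^sub>L B = B o\<^sub>L P"
      by (intro blinfun_eqI) simp
    then have "P o\<^sub>L R = R o\<^sub>L P"
      by (rule square_root_intertwines[OF R(4,3) R(4,3)])
    from arg_cong[OF this, of "\<lambda>S. blinfun_apply S _"] have PR: "P (R x) = R (P x)" for x
      by simp
    have SSx: "S (S x) = x - B x" for x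
      using arg_cong[OF SS, of "\<lambda>S. blinfun_apply S x"] by (simp add: blinfun.bilinear_simps)
    have "P x = S x" for x
    proof -
      define z where "z = S x - P x"
      have "S z + P z = S (S x) - P (P x) + (P (S x) - S (P x))"
        by (simp add: z_def blinfun.bilinear_simps)
      also have "\<dots> = 0"
        by (simp add: SSx PP) (simp add: S_def blinfun.bilinear_simps PR)
      finally have "Re (cinner (S z + P z) z) = 0"
        by simp
      then have "Re (cinner (S z) z) + Re (cinner (P z) z) = 0"
        by (simp add: cinner.add_left)
      moreover have "0 \<le> Re (cinner (P z) z)"
        using P(1) by (auto simp: positive_op_def complex_nonneg_Reals_iff)
      ultimately have "(1 - norm R) * (norm z)\<^sup>2 \<le> 0"
        using lower[of z] by linarith
      then have "z = 0"
        using R(3) by (simp add: mult_le_0_iff)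
      then show ?thesis
        by (simp add: z_def)
    qed
    then show ?thesis
      by (intro blinfun_eqI)
  qed
  show "(id_blinfun - R) o\<^sub>L (id_blinfun - R) = id_blinfun - B"
    using SS unfolding S_def .
  show "op_sqrt (id_blinfun - B) = id_blinfun - R"
    unfolding op_sqrt_def S_def[symmetric]
    by (rule the_equality) (use pos SS in simp, rule uniq, simp_all)
qed

lemma defect_op_cases:
  fixes A :: "'a::complex_hilbert \<Rightarrow>\<^sub>L 'a"
  assumes A: "A \<in> bounded_ops" and "norm A < 1"
  obtains R where "R \<in> bounded_ops" "adj R = R" "norm R < 1"
    and "2 *\<^sub>R R = (adj A o\<^sub>L A) + (R o\<^sub>L R)" and "defect_op A = id_blinfun - R"
proof -
  have "norm (adj A o\<^sub>L A) \<le> norm (adj A) * norm A"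
    by (rule norm_blinfun_compose)
  also have "\<dots> < 1"
    using assms mult_strict_mono[of "norm A" 1 "norm A" 1] by (simp add: norm_adj)
  finally obtain R where R: "R \<in> bounded_ops" "adj R = R" "norm R < 1"
    "2 *\<^sub>R R = (adj A o\<^sub>L A) + (R o\<^sub>L R)"
    using square_root_equation[of "adj A o\<^sub>L A"] A by (auto simp: adj_compose bounded_ops_compose)
  then show thesis
    using that op_sqrt_one_minus(2)[OF R] by (simp add: defect_op_def)
qed

lemma defect_op_bounded_ops [intro]:
  "A \<in> bounded_ops \<Longrightarrow> norm A < 1 \<Longrightarrow> defect_op A \<in> bounded_ops"
  by (erule defect_op_cases) auto

lemma adj_defect_op:
  "A \<in> bounded_ops \<Longrightarrow> norm A < 1 \<Longrightarrow> adj (defect_op A) = defect_op A"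
  by (erule defect_op_cases) (auto simp: adj_diff)

lemma defect_op_squared:
  assumes "A \<in> bounded_ops" and "norm A < 1"
  shows "defect_op A o\<^sub>L defect_op A = id_blinfun - (adj A o\<^sub>L A)"
  by (rule defect_op_cases[OF assms]) (simp add: op_sqrt_one_minus(1))

lemma defect_op_invertible:
  assumes "A \<in> bounded_ops" and "norm A < 1"
  obtains E where "E \<in> bounded_ops" and "E o\<^sub>L defect_op A = id_blinfun"
    and "defect_op A o\<^sub>L E = id_blinfun"
proof (rule defect_op_cases[OF assms])
  fix R
  assume R: "R \<in> bounded_ops" "norm R < 1" "defect_op A = id_blinfun - R"
  show thesis
    by (rule neumann_series[OF R(1,2)]) (use that R(3) in simp)
qed

lemma defect_op_intertwines:
  assumes A: "A \<in> bounded_ops" and A1: "norm A < 1"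
  shows "A o\<^sub>L defect_op A = defect_op (adj A) o\<^sub>L A"
proof -
  obtain R where R: "norm R < 1"
    "2 *\<^sub>R R = (adj A o\<^sub>L A) + (R o\<^sub>L R)" "defect_op A = id_blinfun - R"
    by (rule defect_op_cases[OF assms])
  obtain R' where R': "norm R' < 1"
    "2 *\<^sub>R R' = (A o\<^sub>L adj A) + (R' o\<^sub>L R')" "defect_op (adj A) = id_blinfun - R'"
    by (rule defect_op_cases[of "adj A"]) (use assms in \<open>simp_all add: norm_adj\<close>)
  have "A o\<^sub>L R = R' o\<^sub>L A"
    by (rule square_root_intertwines[OF R(2,1) R'(2,1)]) (simp add: blinfun_eqI)
  from arg_cong[OF this, of "\<lambda>S. blinfun_apply S _"] have "A (R x) = R' (A x)" for x
    by simp
  then show ?thesis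
    using R R' by (intro blinfun_eqI) (simp add: blinfun.bilinear_simps)
qed

text \<open>
  The Julia operator with the rows \<open>A, - defect_op (adj A)\<close> and \<open>defect_op A, adj A\<close> is isometric: the
  diagonal terms cancel by the definition of the defect operators and the cross terms by the intertwining
  relation.
\<close>

lemma julia_identity:
  assumes A: "A \<in> bounded_ops" and A1: "norm A < 1"
  shows "(norm (blinfun_apply A u - blinfun_apply (defect_op (adj A)) s))\<^sup>2
      + (norm (blinfun_apply (defect_op A) u + blinfun_apply (adj A) s))\<^sup>2
    = (norm u)\<^sup>2 + (norm s)\<^sup>2"
proof -
  have *: "(norm (defect_op A u))\<^sup>2 = (norm u)\<^sup>2 - (norm (A u))\<^sup>2"
    if A: "A \<in> bounded_ops" and A1: "norm A < 1" for A :: "'a \<Rightarrow>\<^sub>L 'a" and u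
  proof -
    have "cinner (defect_op A u) (defect_op A u) = cinner ((defect_op A o\<^sub>L defect_op A) u) u"
      using cinner_adj_left[of "defect_op A" "defect_op A u" u] that
      by (simp add: adj_defect_op defect_op_bounded_ops)
    also have "\<dots> = cinner u u - cinner (A u) (A u)"
      using A by (simp add: defect_op_squared that blinfun.bilinear_simps cinner.diff_left cinner_adj_left)
    finally show ?thesis
      by (metis Re_cinner_self minus_complex.simps(1))
  qed
  have A': "adj A \<in> bounded_ops" "norm (adj A) < 1"
    using assms by (auto simp: norm_adj)
  have "cinner (defect_op A u) (adj A s) = cinner ((A o\<^sub>L defect_op A) u) s"
    using A by (simp add: cinner_adj_right)
  also have "\<dots> = cinner (A u) (defect_op (adj A) s)"
    using cinner_adj_left[OF defect_op_bounded_ops[OF A'], of "A u" s]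
    by (simp add: defect_op_intertwines assms adj_defect_op A')
  finally have cross: "cinner (defect_op A u) (adj A s) = cinner (A u) (defect_op (adj A) s)" .
  show ?thesis
    unfolding norm_add_sqr norm_diff_sqr using *[OF assms, of u] *[OF A', of s] A
    by (simp add: cross)
qed

section \<open>Tensor products of operators\<close>

context hilbert_tensor
begin

lemma cinner_tensor_eqI:
  assumes "\<And>x y. cinner z (t x y) = cinner z' (t x y)"
  shows "z = z'"
proof (rule cinner_eqI)
  fix w
  have "closure (complex_vector.span {t x y | x y. True}) \<subseteq> {w. cinner z w = cinner z' w}"
  proof (rule closure_minimal)
    show "complex_vector.span {t x y | x y. True} \<subseteq> {w. cinner z w = cinner z' w}"
      by (rule complex_vector.span_minimal)
        (auto simp: assms cinner_add_right cinner_scaleC_right intro!: complex_vector.subspaceI)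
    show "closed {w. cinner z w = cinner z' w}"
      by (intro closed_Collect_eq cinner.continuous_on continuous_intros)
  qed
  then show "cinner z w = cinner z' w"
    using tensor_dense by auto
qed

lemma op_eqI:
  assumes "R \<in> bounded_ops" and "R' \<in> bounded_ops"
    and eq: "\<And>x y. blinfun_apply R (t x y) = blinfun_apply R' (t x y)"
  shows "R = R'"
proof (rule blinfun_eqI)
  fix w
  have "closure (complex_vector.span {t x y | x y. True}) \<subseteq> {w. R w = R' w}"
  proof (rule closure_minimal)
    show "complex_vector.span {t x y | x y. True} \<subseteq> {w. R w = R' w}"
      by (rule complex_vector.span_minimal)
        (auto simp: eq assms bounded_opsD blinfun.bilinear_simps intro!: complex_vector.subspaceI)
    show "closed {w. R w = R' w}"
      by (intro closed_Collect_eq blinfun.continuous_on continuous_intros)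
  qed
  then show "R w = R' w"
    using tensor_dense by auto
qed

lemma swap: "hilbert_tensor (\<lambda>y x. t x y)"
proof
  have "{t x y | y x. True} = {t x y | x y. True}"
    by auto
  then show "closure (complex_vector.span {t x y | y x. True}) = UNIV"
    using tensor_dense by simp
qed (simp_all add: tensor_add_left tensor_add_right tensor_scaleC_left tensor_scaleC_right
    cinner_tensor mult.commute)

lemma norm_tensor: "norm (t x y) = norm x * norm y"
proof -
  have "cinner (t x y) (t x y) = cinner x x * cinner y y"
    by (rule cinner_tensor)
  then have "complex_of_real ((norm (t x y))\<^sup>2) = complex_of_real ((norm x * norm y)\<^sup>2)"
    by (simp only: cinner_self of_real_mult power_mult_distrib)
  then show ?thesis
    by (simp only: of_real_eq_iff) (simp add: power2_eq_iff_nonneg)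
qed

lemma tensor_zero_left: "t 0 y = 0" and tensor_zero_right: "t x 0 = 0"
  using norm_tensor[of 0 y] norm_tensor[of x 0] by simp_all

lemma tensor_sum_left: "t (\<Sum>i\<in>I. f i) y = (\<Sum>i\<in>I. t (f i) y)"
  by (induction I rule: infinite_finite_induct) (simp_all add: tensor_zero_left tensor_add_left)

lemma tensor_sum_right: "t x (\<Sum>i\<in>I. f i) = (\<Sum>i\<in>I. t x (f i))"
  by (induction I rule: infinite_finite_induct) (simp_all add: tensor_zero_right tensor_add_right)

lemma norm_sum_tensor_orthonormal:
  assumes "finite I" and "\<And>i j. i \<in> I \<Longrightarrow> j \<in> I \<Longrightarrow> cinner (e i) (e j) = (if i = j then 1 else 0)"
  shows "(norm (\<Sum>i\<in>I. t (e i) (f i)))\<^sup>2 = (\<Sum>i\<in>I. (norm (f i))\<^sup>2)"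
proof -
  have "cinner (\<Sum>i\<in>I. t (e i) (f i)) (\<Sum>i\<in>I. t (e i) (f i))
      = (\<Sum>i\<in>I. \<Sum>j\<in>I. cinner (e i) (e j) * cinner (f i) (f j))"
    unfolding cinner.sum_left unfolding cinner.sum_right by (simp add: cinner_tensor)
  also have "\<dots> = (\<Sum>i\<in>I. \<Sum>j\<in>I. if i = j then cinner (f i) (f j) else 0)"
    using assms(2) by (intro sum.cong refl) simp
  also have "\<dots> = (\<Sum>i\<in>I. cinner (f i) (f i))"
    using assms(1) by simp
  finally have "Re (cinner (\<Sum>i\<in>I. t (e i) (f i)) (\<Sum>i\<in>I. t (e i) (f i)))
      = Re (\<Sum>i\<in>I. cinner (f i) (f i))"
    by (rule arg_cong)
  then show ?thesis
    by simp
qed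

lemma span_tensor_form:
  assumes "z \<in> complex_vector.span {t x y | x y. True}"
  obtains S :: "'c set" and x y where "finite S" and "z = (\<Sum>k\<in>S. t (x k) (y k))"
proof -
  obtain S r where S: "finite S" "S \<subseteq> {t x y | x y. True}" "z = (\<Sum>a\<in>S. r a *\<^sub>C a)"
    using assms unfolding complex_vector.span_explicit by blast
  then have "\<forall>a\<in>S. \<exists>x y. a = t x y"
    by blast
  then obtain x y where xy: "\<And>a. a \<in> S \<Longrightarrow> a = t (x a) (y a)"
    by metis
  have "z = (\<Sum>k\<in>S. t (r k *\<^sub>C x k) (y k))"
    unfolding S(3) using xy by (intro sum.cong refl) (simp add: tensor_scaleC_left)
  with S(1) show thesis
    by (rule that)
qed

end

text \<open>
  With orthonormal first factors the norm of a sum of elementary tensors is the Hilbert sum of the norms of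
  the second factors, and an operator on the second factor acts on each of them separately. Every finite sum
  of elementary tensors can be brought to this form.
\<close>

lemma orthonormal_coordinates:
  fixes x :: "'i \<Rightarrow> 'a::complex_hilbert"
  assumes "finite S"
  obtains B b where "finite B" and "orthonormal B" and "\<And>k. k \<in> S \<Longrightarrow> x k = (\<Sum>e\<in>B. b k e *\<^sub>C e)"
proof -
  obtain B where B: "finite B" "orthonormal B" "x ` S \<subseteq> complex_vector.span B"
    using gram_schmidt[of "x ` S"] assms by blast
  show thesis
    by (rule that[OF B(1,2), of "\<lambda>k e. cinner (x k) e"])
      (use B in \<open>auto intro!: orthonormal_expansion\<close>)
qed

text \<open>
  Column bounds pass to the tensor product with the same constant. For a single operator this is the estimate behind the
  existence of \<open>tensor_op\<close>.
\<close>

lemma tensor_column_bound_sum: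
  fixes t :: "'a::complex_hilbert \<Rightarrow> 'b::complex_hilbert \<Rightarrow> 'c::complex_hilbert"
    and t' :: "'a \<Rightarrow> 'd::complex_hilbert \<Rightarrow> 'f::complex_hilbert"
  assumes t: "hilbert_tensor t" and t': "hilbert_tensor t'"
    and R: "\<And>i. i \<in> F \<Longrightarrow> R i \<in> bounded_ops"
    and le: "\<And>y. (\<Sum>i\<in>F. (norm (blinfun_apply (R i) y))\<^sup>2) \<le> c * (norm y)\<^sup>2"
    and S: "finite S"
  shows "(\<Sum>i\<in>F. (norm (\<Sum>k\<in>S. t' (x k) (blinfun_apply (R i) (y k))))\<^sup>2)
    \<le> c * (norm (\<Sum>k\<in>S. t (x k) (y k)))\<^sup>2"
proof -
  interpret t: hilbert_tensor t by fact
  interpret t': hilbert_tensor t' by fact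
  obtain B b where B: "finite B" "orthonormal B" and x: "\<And>k. k \<in> S \<Longrightarrow> x k = (\<Sum>e\<in>B. b k e *\<^sub>C e)"
    using orthonormal_coordinates[OF S] by blast
  define f where "f e = (\<Sum>k\<in>S. b k e *\<^sub>C y k)" for e
  have on: "\<And>i j. i \<in> B \<Longrightarrow> j \<in> B \<Longrightarrow> cinner i j = (if i = j then 1 else 0)"
    using B(2) by (simp add: orthonormal_def)
  have 1: "(\<Sum>k\<in>S. t (x k) (y k)) = (\<Sum>e\<in>B. t e (f e))"
  proof -
    have "(\<Sum>k\<in>S. t (x k) (y k)) = (\<Sum>k\<in>S. \<Sum>e\<in>B. t e (b k e *\<^sub>C y k))"
      by (intro sum.cong refl)
        (simp add: x t.tensor_sum_left t.tensor_scaleC_left t.tensor_scaleC_right)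
    also have "\<dots> = (\<Sum>e\<in>B. t e (f e))"
      unfolding f_def t.tensor_sum_right by (rule sum.swap)
    finally show ?thesis .
  qed
  have 2: "(\<Sum>k\<in>S. t' (x k) (R i (y k))) = (\<Sum>e\<in>B. t' e (R i (f e)))" if "i \<in> F" for i
  proof -
    have "(\<Sum>k\<in>S. t' (x k) (R i (y k))) = (\<Sum>k\<in>S. \<Sum>e\<in>B. t' e (R i (b k e *\<^sub>C y k)))"
      by (intro sum.cong refl) (simp add: x t'.tensor_sum_left t'.tensor_scaleC_left
          t'.tensor_scaleC_right bounded_opsD[OF R[OF that]])
    also have "\<dots> = (\<Sum>e\<in>B. t' e (R i (f e)))"
      unfolding f_def blinfun.sum_right t'.tensor_sum_right by (rule sum.swap)
    finally show ?thesis .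
  qed
  have "(\<Sum>i\<in>F. (norm (\<Sum>k\<in>S. t' (x k) (R i (y k))))\<^sup>2) = (\<Sum>i\<in>F. \<Sum>e\<in>B. (norm (R i (f e)))\<^sup>2)"
    by (intro sum.cong refl) (simp add: 2 t'.norm_sum_tensor_orthonormal[OF B(1) on])
  also have "\<dots> = (\<Sum>e\<in>B. \<Sum>i\<in>F. (norm (R i (f e)))\<^sup>2)"
    by (rule sum.swap)
  also have "\<dots> \<le> (\<Sum>e\<in>B. c * (norm (f e))\<^sup>2)"
    by (intro sum_mono le)
  also have "\<dots> = c * (norm (\<Sum>k\<in>S. t (x k) (y k)))\<^sup>2"
    by (simp add: 1 t.norm_sum_tensor_orthonormal[OF B(1) on] sum_distrib_left)
  finally show ?thesis .
qed

lemma tensor_right_exists: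
  fixes t :: "'a::complex_hilbert \<Rightarrow> 'b::complex_hilbert \<Rightarrow> 'c::complex_hilbert"
    and t' :: "'a \<Rightarrow> 'd::complex_hilbert \<Rightarrow> 'f::complex_hilbert"
  assumes t: "hilbert_tensor t" and t': "hilbert_tensor t'" and T: "T \<in> bounded_ops"
  obtains R where "R \<in> bounded_ops" and "norm R \<le> norm T"
    and "\<And>x y. blinfun_apply R (t x y) = t' x (blinfun_apply T y)"
proof -
  interpret t: hilbert_tensor t by fact
  interpret t': hilbert_tensor t' by fact
  define u where "u p = t (fst p) (snd p)" for p
  define v where "v p = t' (fst p) (T (snd p))" for p
  have "norm (\<Sum>p\<in>S. c p *\<^sub>C v p) \<le> norm T * norm (\<Sum>p\<in>S. c p *\<^sub>C u p)" if "finite S" for S c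
  proof -
    have "(norm (T y))\<^sup>2 \<le> (norm T)\<^sup>2 * (norm y)\<^sup>2" for y
      using power_mono[OF norm_blinfun[of T y], of 2] by (simp add: power_mult_distrib)
    then have "(\<Sum>i\<in>{()}. (norm (\<Sum>p\<in>S. t' (c p *\<^sub>C fst p) (T (snd p))))\<^sup>2)
        \<le> (norm T)\<^sup>2 * (norm (\<Sum>p\<in>S. t (c p *\<^sub>C fst p) (snd p)))\<^sup>2"
      by (intro tensor_column_bound_sum[OF t t' _ _ that]) (simp_all add: T)
    then have "(norm (\<Sum>p\<in>S. c p *\<^sub>C v p))\<^sup>2 \<le> (norm T * norm (\<Sum>p\<in>S. c p *\<^sub>C u p))\<^sup>2"
      by (simp add: u_def v_def t.tensor_scaleC_left t'.tensor_scaleC_left power_mult_distrib)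
    then show ?thesis
      by (rule power2_le_imp_le) simp
  qed
  from bounded_op_extension[OF norm_ge_zero this] obtain R where
    R: "R \<in> bounded_ops" "norm R \<le> norm T" "\<And>p. blinfun_apply R (u p) = v p"
    by blast
  have "R (t x y) = t' x (T y)" for x y
    using R(3)[of "(x, y)"] by (simp add: u_def v_def)
  with R(1,2) show thesis
    by (rule that)
qed

lemma tensor_op_unique:
  assumes "hilbert_tensor t" and "R \<in> bounded_ops"
    and "\<And>x y. blinfun_apply R (t x y) = t' (blinfun_apply S x) (blinfun_apply T y)"
  shows "tensor_op t t' S T = R"
  unfolding tensor_op_def
  by (rule the_equality) (use assms in \<open>auto intro!: hilbert_tensor.op_eqI[OF assms(1)]\<close>)

lemma tensor_op:
  fixes t :: "'a::complex_hilbert \<Rightarrow> 'b::complex_hilbert \<Rightarrow> 'c::complex_hilbert"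
    and t' :: "'a \<Rightarrow> 'd::complex_hilbert \<Rightarrow> 'f::complex_hilbert"
  assumes t: "hilbert_tensor t" and t': "hilbert_tensor t'"
    and S: "S \<in> bounded_ops" and T: "T \<in> bounded_ops"
  shows tensor_op_bounded_ops: "tensor_op t t' S T \<in> bounded_ops"
    and tensor_op_apply: "\<And>x y. blinfun_apply (tensor_op t t' S T) (t x y)
        = t' (blinfun_apply S x) (blinfun_apply T y)"
    and norm_tensor_op_le: "norm (tensor_op t t' S T) \<le> norm S * norm T"
proof -
  obtain R where R: "R \<in> bounded_ops" "norm R \<le> norm T" "\<And>x y. R (t x y) = t' x (T y)"
    using tensor_right_exists[OF t t' T] by blast
  obtain Q where Q: "Q \<in> bounded_ops" "norm Q \<le> norm S" "\<And>y x. Q (t x y) = t (S x) y"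
    using tensor_right_exists[OF hilbert_tensor.swap[OF t] hilbert_tensor.swap[OF t] S] by blast
  have RQ: "R o\<^sub>L Q \<in> bounded_ops" "\<And>x y. (R o\<^sub>L Q) (t x y) = t' (S x) (T y)"
    using R Q by auto
  then have eq: "tensor_op t t' S T = R o\<^sub>L Q"
    by (intro tensor_op_unique[OF t])
  show "tensor_op t t' S T \<in> bounded_ops" and "\<And>x y. tensor_op t t' S T (t x y) = t' (S x) (T y)"
    using RQ by (simp_all add: eq)
  have "norm (R o\<^sub>L Q) \<le> norm R * norm Q"
    by (rule norm_blinfun_compose)
  also have "\<dots> \<le> norm T * norm S"
    using R Q by (intro mult_mono) auto
  finally show "norm (tensor_op t t' S T) \<le> norm S * norm T"
    by (simp add: eq mult.commute)
qed

lemma norm_tensor_op_id_le: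
  fixes t :: "'a::complex_hilbert \<Rightarrow> 'b::complex_hilbert \<Rightarrow> 'c::complex_hilbert"
    and t' :: "'a \<Rightarrow> 'd::complex_hilbert \<Rightarrow> 'f::complex_hilbert"
  assumes "hilbert_tensor t" "hilbert_tensor t'" "T \<in> bounded_ops"
  shows "norm (tensor_op t t' id_blinfun T) \<le> norm T"
proof -
  have "norm (tensor_op t t' id_blinfun T) \<le> norm (id_blinfun :: 'a \<Rightarrow>\<^sub>L 'a) * norm T"
    by (rule norm_tensor_op_le) (simp_all add: assms)
  also have "\<dots> \<le> 1 * norm T"
    by (intro mult_right_mono norm_blinfun_bound) simp_all
  finally show ?thesis
    by simp
qed

lemma tensor_op_compose:
  fixes t :: "'a::complex_hilbert \<Rightarrow> 'b::complex_hilbert \<Rightarrow> 'c::complex_hilbert"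
    and t' :: "'a \<Rightarrow> 'd::complex_hilbert \<Rightarrow> 'f::complex_hilbert"
    and t'' :: "'a \<Rightarrow> 'g::complex_hilbert \<Rightarrow> 'i::complex_hilbert"
  assumes "hilbert_tensor t" "hilbert_tensor t'" "hilbert_tensor t''"
    and "S \<in> bounded_ops" "T \<in> bounded_ops" "S' \<in> bounded_ops" "T' \<in> bounded_ops"
  shows "tensor_op t' t'' S' T' o\<^sub>L tensor_op t t' S T = tensor_op t t'' (S' o\<^sub>L S) (T' o\<^sub>L T)"
  by (rule tensor_op_unique[symmetric])
    (use assms in \<open>auto simp: tensor_op_apply tensor_op_bounded_ops\<close>)

lemma tensor_op_id:
  assumes "hilbert_tensor t"
  shows "tensor_op t t id_blinfun id_blinfun = id_blinfun"
  by (rule tensor_op_unique[OF assms]) simp_all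

lemma tensor_op_zero_left:
  assumes "hilbert_tensor t" "hilbert_tensor t'"
  shows "tensor_op t t' 0 T = 0"
  by (rule tensor_op_unique[OF assms(1)]) (simp_all add: hilbert_tensor.tensor_zero_left[OF assms(2)])

lemma tensor_op_add_right:
  fixes t :: "'a::complex_hilbert \<Rightarrow> 'b::complex_hilbert \<Rightarrow> 'c::complex_hilbert"
    and t' :: "'a \<Rightarrow> 'd::complex_hilbert \<Rightarrow> 'f::complex_hilbert"
  assumes t: "hilbert_tensor t" "hilbert_tensor t'"
    and "S \<in> bounded_ops" "T \<in> bounded_ops" "T' \<in> bounded_ops"
  shows "tensor_op t t' S (T + T') = tensor_op t t' S T + tensor_op t t' S T'"
  by (rule tensor_op_unique)
    (use assms in \<open>auto simp: tensor_op_apply tensor_op_bounded_ops blinfun.bilinear_simps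
      hilbert_tensor.tensor_add_right[OF t(2)]\<close>)

lemma tensor_op_minus_right:
  fixes t :: "'a::complex_hilbert \<Rightarrow> 'b::complex_hilbert \<Rightarrow> 'c::complex_hilbert"
    and t' :: "'a \<Rightarrow> 'd::complex_hilbert \<Rightarrow> 'f::complex_hilbert"
  assumes t: "hilbert_tensor t" "hilbert_tensor t'" and "S \<in> bounded_ops" "T \<in> bounded_ops"
  shows "tensor_op t t' S (- T) = - tensor_op t t' S T"
proof (rule tensor_op_unique[OF t(1)])
  interpret hilbert_tensor t' by (rule t(2))
  have "t' x (- y) = - t' x y" for x y
    using tensor_add_right[of x y "- y"] by (simp add: tensor_zero_right eq_neg_iff_add_eq_0 add.commute)
  then show "(- tensor_op t t' S T) (t x y) = t' (S x) ((- T) y)" for x y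
    using assms by (simp add: tensor_op_apply blinfun.bilinear_simps)
qed (use assms in \<open>auto simp: tensor_op_bounded_ops\<close>)

lemma tensor_op_diff_right:
  fixes t :: "'a::complex_hilbert \<Rightarrow> 'b::complex_hilbert \<Rightarrow> 'c::complex_hilbert"
    and t' :: "'a \<Rightarrow> 'd::complex_hilbert \<Rightarrow> 'f::complex_hilbert"
  assumes t: "hilbert_tensor t" "hilbert_tensor t'"
    and "S \<in> bounded_ops" "T \<in> bounded_ops" "T' \<in> bounded_ops"
  shows "tensor_op t t' S (T - T') = tensor_op t t' S T - tensor_op t t' S T'"
  using tensor_op_add_right[OF t assms(3,4) bounded_ops_minus[OF assms(5)]]
    tensor_op_minus_right[OF t assms(3,5)] by simp

lemma tensor_op_scaleR_right:
  fixes t :: "'a::complex_hilbert \<Rightarrow> 'b::complex_hilbert \<Rightarrow> 'c::complex_hilbert"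
    and t' :: "'a \<Rightarrow> 'd::complex_hilbert \<Rightarrow> 'f::complex_hilbert"
  assumes t: "hilbert_tensor t" "hilbert_tensor t'"
    and "S \<in> bounded_ops" "T \<in> bounded_ops"
  shows "tensor_op t t' S (r *\<^sub>R T) = r *\<^sub>R tensor_op t t' S T"
  by (rule tensor_op_unique)
    (use assms in \<open>auto simp: tensor_op_apply tensor_op_bounded_ops blinfun.bilinear_simps
      scaleR_scaleC hilbert_tensor.tensor_scaleC_right[OF t(2)]\<close>)

lemma tensor_op_adj:
  fixes t :: "'a::complex_hilbert \<Rightarrow> 'b::complex_hilbert \<Rightarrow> 'c::complex_hilbert"
    and t' :: "'a \<Rightarrow> 'd::complex_hilbert \<Rightarrow> 'f::complex_hilbert"
  assumes t: "hilbert_tensor t" and t': "hilbert_tensor t'"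
    and ST: "S \<in> bounded_ops" "T \<in> bounded_ops"
  shows "adj (tensor_op t t' S T) = tensor_op t' t (adj S) (adj T)"
proof (rule tensor_op_unique[symmetric, OF t'])
  interpret t: hilbert_tensor t by fact
  interpret t': hilbert_tensor t' by fact
  show "adj (tensor_op t t' S T) \<in> bounded_ops"
    using assms by (simp add: tensor_op_bounded_ops)
  show "adj (tensor_op t t' S T) (t' x y) = t (adj S x) (adj T y)" for x y
    by (rule t.cinner_tensor_eqI)
      (simp add: assms tensor_op_bounded_ops cinner_adj_left tensor_op_apply t'.cinner_tensor
        t.cinner_tensor)
qed

lemma tensor_column_bound:
  fixes t :: "'a::complex_hilbert \<Rightarrow> 'b::complex_hilbert \<Rightarrow> 'c::complex_hilbert"
    and t' :: "'a \<Rightarrow> 'd::complex_hilbert \<Rightarrow> 'f::complex_hilbert"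
  assumes t: "hilbert_tensor t" and t': "hilbert_tensor t'"
    and R: "\<And>i. i \<in> F \<Longrightarrow> R i \<in> bounded_ops"
    and le: "\<And>y. (\<Sum>i\<in>F. (norm (blinfun_apply (R i) y))\<^sup>2) \<le> c * (norm y)\<^sup>2"
  shows "(\<Sum>i\<in>F. (norm (blinfun_apply (tensor_op t t' id_blinfun (R i)) z))\<^sup>2) \<le> c * (norm z)\<^sup>2"
proof -
  interpret t: hilbert_tensor t by fact
  define Q where "Q = {z. (\<Sum>i\<in>F. (norm (tensor_op t t' id_blinfun (R i) z))\<^sup>2) \<le> c * (norm z)\<^sup>2}"
  have "closure (complex_vector.span {t x y | x y. True}) \<subseteq> Q"
  proof (rule closure_minimal)
    show "complex_vector.span {t x y | x y. True} \<subseteq> Q"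
    proof
      fix z
      assume "z \<in> complex_vector.span {t x y | x y. True}"
      then obtain S :: "'c set" and x y where S: "finite S" "z = (\<Sum>k\<in>S. t (x k) (y k))"
        by (rule t.span_tensor_form)
      have "tensor_op t t' id_blinfun (R i) z = (\<Sum>k\<in>S. t' (x k) (R i (y k)))" if "i \<in> F" for i
        unfolding S(2) blinfun.sum_right
        by (intro sum.cong refl) (simp add: tensor_op_apply[OF t t'] R that)
      then show "z \<in> Q"
        using tensor_column_bound_sum[OF t t' R le S(1), of x y] unfolding Q_def S(2) by simp
    qed
    show "closed Q"
      unfolding Q_def by (intro closed_Collect_le continuous_intros blinfun.continuous_on)
  qed
  then show ?thesis
    using t.tensor_dense by (auto simp: Q_def)
qed

text \<open>
  The tensor product with the identity preserves the fixed point equation that determines the square root.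
\<close>

lemma defect_op_tensor:
  fixes t :: "'a::complex_hilbert \<Rightarrow> 'b::complex_hilbert \<Rightarrow> 'c::complex_hilbert"
  assumes t: "hilbert_tensor t" and A: "A \<in> bounded_ops" "norm A < 1"
  shows "defect_op (tensor_op t t id_blinfun A) = tensor_op t t id_blinfun (defect_op A)"
proof (rule defect_op_cases[OF A])
  fix R
  assume R: "R \<in> bounded_ops" "adj R = R" "norm R < 1" "2 *\<^sub>R R = (adj A o\<^sub>L A) + (R o\<^sub>L R)"
    and D: "defect_op A = id_blinfun - R"
  let ?t = "tensor_op t t id_blinfun"
  have "2 *\<^sub>R ?t R = ?t ((adj A o\<^sub>L A) + (R o\<^sub>L R))"
    using t R(1) by (simp add: tensor_op_scaleR_right flip: R(4))
  also have "\<dots> = (adj (?t A) o\<^sub>L ?t A) + (?t R o\<^sub>L ?t R)"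
    using t R(1) A by (simp add: tensor_op_add_right bounded_ops_compose tensor_op_compose tensor_op_adj)
  finally have "op_sqrt (id_blinfun - (adj (?t A) o\<^sub>L ?t A)) = id_blinfun - ?t R"
    using t R norm_tensor_op_id_le[OF t t R(1)]
    by (intro op_sqrt_one_minus(2)) (simp_all add: tensor_op_bounded_ops tensor_op_adj)
  then show ?thesis
    using t R(1) by (simp add: D tensor_op_diff_right tensor_op_id) (simp add: defect_op_def)
qed

section \<open>Strong sums of row-column products\<close>

lemma strong_has_sum_unique: "strong_has_sum f I T \<Longrightarrow> strong_has_sum f I T' \<Longrightarrow> T = T'"
  unfolding strong_has_sum_def by (intro blinfun_eqI) (blast intro: has_sum_unique)

lemma strong_has_sum_cong:
  assumes "\<And>i. i \<in> I \<Longrightarrow> f i = g i"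
  shows "strong_has_sum f I T \<longleftrightarrow> strong_has_sum g I T"
  unfolding strong_has_sum_def by (intro all_cong1 has_sum_cong) (simp add: assms)

lemma strong_sum_eq: "strong_has_sum f I T \<Longrightarrow> strong_sum f I = T"
  unfolding strong_sum_def by (rule the_equality) (auto intro: strong_has_sum_unique)

lemma strong_has_sum_compose:
  assumes "strong_has_sum f I T"
  shows "strong_has_sum (\<lambda>i. P o\<^sub>L f i o\<^sub>L Q) I (P o\<^sub>L T o\<^sub>L Q)"
  unfolding strong_has_sum_def
proof
  fix x
  have "((\<lambda>i. f i (Q x)) has_sum T (Q x)) I"
    using assms by (simp add: strong_has_sum_def)
  from has_sum_bounded_linear[OF blinfun.bounded_linear_right this, of P]
  show "((\<lambda>i. (P o\<^sub>L f i o\<^sub>L Q) x) has_sum (P o\<^sub>L T o\<^sub>L Q) x) I"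
    by (simp add: o_def)
qed

text \<open>
  A bound \<open>c\<close> for the squared norm of the column with the entries \<open>R i\<close>. Finite partial sums express it without
  forming the column, which would act into an infinite direct sum.
\<close>

definition column_bound :: "real \<Rightarrow> 'i set \<Rightarrow> ('i \<Rightarrow> 'a::complex_hilbert \<Rightarrow>\<^sub>L 'b::complex_hilbert) \<Rightarrow> bool"
  where "column_bound c I R \<longleftrightarrow>
    (\<forall>F z. finite F \<longrightarrow> F \<subseteq> I \<longrightarrow> (\<Sum>i\<in>F. (norm (blinfun_apply (R i) z))\<^sup>2) \<le> c * (norm z)\<^sup>2)"

lemma column_boundD:
  "column_bound c I R \<Longrightarrow> finite F \<Longrightarrow> F \<subseteq> I \<Longrightarrow>
    (\<Sum>i\<in>F. (norm (blinfun_apply (R i) z))\<^sup>2) \<le> c * (norm z)\<^sup>2"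
  by (simp add: column_bound_def)

lemma column_bound_cong:
  assumes "\<And>i. i \<in> I \<Longrightarrow> R i = R' i"
  shows "column_bound c I R \<longleftrightarrow> column_bound c I R'"
proof -
  have "(\<Sum>i\<in>F. (norm (R i z))\<^sup>2) = (\<Sum>i\<in>F. (norm (R' i z))\<^sup>2)" if "F \<subseteq> I" for F z
    using that assms by (intro sum.cong) auto
  then show ?thesis
    by (auto simp: column_bound_def)
qed

lemma column_bound_compose_left:
  assumes "column_bound c I R" and "norm M \<le> 1"
  shows "column_bound c I (\<lambda>i. M o\<^sub>L R i)"
  unfolding column_bound_def
proof (intro allI impI)
  fix F z
  assume "finite F" "F \<subseteq> I"
  have "norm (M x) \<le> norm x" for x
    using norm_blinfun[of M x] mult_right_mono[OF assms(2) norm_ge_zero[of x]] by simp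
  then have "(\<Sum>i\<in>F. (norm ((M o\<^sub>L R i) z))\<^sup>2) \<le> (\<Sum>i\<in>F. (norm (R i z))\<^sup>2)"
    by (intro sum_mono power_mono) simp_all
  also have "\<dots> \<le> c * (norm z)\<^sup>2"
    by (rule column_boundD) fact+
  finally show "(\<Sum>i\<in>F. (norm ((M o\<^sub>L R i) z))\<^sup>2) \<le> c * (norm z)\<^sup>2" .
qed

text \<open>
  The Cauchy criterion: the tails of \<open>g\<close> control the tails of \<open>f\<close>.
\<close>

lemma summable_on_if_dominated:
  fixes f :: "'i \<Rightarrow> 'a::banach" and g :: "'i \<Rightarrow> real"
  assumes g: "g summable_on I" and nonneg: "\<And>i. i \<in> I \<Longrightarrow> 0 \<le> g i" and "0 < C"
    and le: "\<And>F. finite F \<Longrightarrow> F \<subseteq> I \<Longrightarrow> (norm (sum f F))\<^sup>2 \<le> C * sum g F"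
  shows "f summable_on I"
proof -
  have tail: "\<exists>F0. finite F0 \<and> F0 \<subseteq> I \<and> (\<forall>F. finite F \<longrightarrow> F0 \<subseteq> F \<longrightarrow> F \<subseteq> I \<longrightarrow> dist (sum f F) (sum f F0) < e / 2)"
    if "0 < e" for e
  proof -
    define d where "d = e\<^sup>2 / (8 * C)"
    have "0 < d"
      using that \<open>0 < C\<close> by (simp add: d_def)
    have hs: "(g has_sum infsum g I) I"
      using g by (rule has_sum_infsum)
    then obtain F0 where F0: "finite F0" "F0 \<subseteq> I" "dist (sum g F0) (infsum g I) \<le> d"
      using has_sum_finite_approximation[OF hs \<open>0 < d\<close>] by blast
    have "dist (sum f F) (sum f F0) < e / 2" if F: "finite F" "F0 \<subseteq> F" "F \<subseteq> I" for F
    proof -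
      have "sum g F \<le> infsum g I"
        by (rule finite_sum_le_infsum[OF g F(1,3)]) (simp add: nonneg)
      moreover have "sum g F = sum g F0 + sum g (F - F0)"
        using sum.subset_diff[OF F(2,1), of g] by simp
      ultimately have "sum g (F - F0) \<le> d"
        using F0(3) by (simp add: dist_real_def)
      have "sum f F - sum f F0 = sum f (F - F0)"
        using F by (simp add: sum_diff)
      then have "(dist (sum f F) (sum f F0))\<^sup>2 = (norm (sum f (F - F0)))\<^sup>2"
        by (simp add: dist_norm)
      also have "\<dots> \<le> C * sum g (F - F0)"
        using F by (intro le) auto
      also have "\<dots> \<le> C * d"
        using \<open>0 < C\<close> \<open>sum g (F - F0) \<le> d\<close> by simp
      also have "\<dots> < (e / 2)\<^sup>2"
        using \<open>0 < C\<close> \<open>0 < e\<close> by (simp add: d_def power_divide)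
      finally show ?thesis
        by (rule power_less_imp_less_base) (use \<open>0 < e\<close> in simp)
    qed
    with F0(1,2) show ?thesis
      by (intro exI[of _ F0] conjI allI impI)
  qed
  have "cauchy_filter (filtermap (sum f) (finite_subsets_at_top I))"
    unfolding cauchy_filter_metric_filtermap
  proof (intro allI impI)
    fix e :: real
    assume "0 < e"
    from tail[OF this] obtain F0 where F0: "finite F0" "F0 \<subseteq> I"
      and near: "\<forall>F. finite F \<longrightarrow> F0 \<subseteq> F \<longrightarrow> F \<subseteq> I \<longrightarrow> dist (sum f F) (sum f F0) < e / 2"
      by (elim exE conjE)
    have "dist (sum f F) (sum f G) < e"
      if "finite F \<and> F0 \<subseteq> F \<and> F \<subseteq> I" "finite G \<and> F0 \<subseteq> G \<and> G \<subseteq> I" for F G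
      by (rule dist_triangle_half_l[of _ "sum f F0"]) (use that near in auto)
    moreover have "\<forall>\<^sub>F F in finite_subsets_at_top I. finite F \<and> F0 \<subseteq> F \<and> F \<subseteq> I"
      unfolding eventually_finite_subsets_at_top using F0 by (intro exI[of _ F0]) simp
    ultimately show "\<exists>P. eventually P (finite_subsets_at_top I) \<and>
        (\<forall>x y. P x \<and> P y \<longrightarrow> dist (sum f x) (sum f y) < e)"
      by (intro exI[of _ "\<lambda>F. finite F \<and> F0 \<subseteq> F \<and> F \<subseteq> I"]) simp
  qed
  then have "\<exists>L. filtermap (sum f) (finite_subsets_at_top I) \<le> nhds L"
    by (rule cauchy_filter_complete_converges[OF _ complete_UNIV])
      (simp_all add: filtermap_bot_iff)
  then obtain L where "filtermap (sum f) (finite_subsets_at_top I) \<le> nhds L"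
    by (rule exE)
  then have "(f has_sum L) I"
    unfolding has_sum_def filterlim_def .
  then show ?thesis
    by (rule has_sum_imp_summable)
qed

lemma norm_row_column_sum_le:
  assumes S: "\<And>i. i \<in> I \<Longrightarrow> S i \<in> bounded_ops"
    and col: "column_bound c I (\<lambda>i. adj (S i))" and F: "finite F" "F \<subseteq> I"
    and "0 \<le> c"
  shows "(norm (\<Sum>i\<in>F. blinfun_apply (S i) (y i)))\<^sup>2 \<le> c * (\<Sum>i\<in>F. (norm (y i))\<^sup>2)"
proof -
  define x where "x = (\<Sum>i\<in>F. S i (y i))"
  define p where "p = (\<Sum>i\<in>F. (norm (y i))\<^sup>2)"
  have "p \<ge> 0"
    by (simp add: p_def sum_nonneg)
  have "(norm x)\<^sup>2 = Re (cinner x x)"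
    by simp
  also have "\<dots> = (\<Sum>i\<in>F. Re (cinner (y i) (adj (S i) x)))"
    using F by (subst x_def) (auto simp: cinner.sum_left cinner_adj_right[OF S] intro!: sum.cong)
  also have "\<dots> \<le> (\<Sum>i\<in>F. norm (y i) * norm (adj (S i) x))"
    by (intro sum_mono order_trans[OF complex_Re_le_cmod norm_cinner_le])
  also have "\<dots> \<le> sqrt p * sqrt (\<Sum>i\<in>F. (norm (adj (S i) x))\<^sup>2)"
    using L2_set_mult_ineq[of "\<lambda>i. norm (y i)" "\<lambda>i. norm (adj (S i) x)" F]
    by (simp add: L2_set_def p_def)
  also have "\<dots> \<le> sqrt p * sqrt (c * (norm x)\<^sup>2)"
    using column_boundD[OF col F] \<open>0 \<le> p\<close> by (intro mult_left_mono real_sqrt_le_mono) auto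
  finally have *: "(norm x)\<^sup>2 \<le> sqrt (c * p) * norm x"
    by (simp add: real_sqrt_mult mult_ac)
  show ?thesis
  proof (cases "x = 0")
    case True
    then show ?thesis
      using \<open>0 \<le> c\<close> \<open>0 \<le> p\<close> by (simp flip: x_def p_def)
  next
    case False
    then have "norm x \<le> sqrt (c * p)"
      using * by (simp add: power2_eq_square)
    then have "(norm x)\<^sup>2 \<le> (sqrt (c * p))\<^sup>2"
      by (intro power_mono) simp_all
    moreover have "0 < sqrt (c * p)"
      using False \<open>norm x \<le> sqrt (c * p)\<close> by (meson less_le_trans zero_less_norm_iff)
    ultimately show ?thesis
      by (simp add: x_def p_def)
  qed
qed

text \<open>
  A bounded row times a bounded column: by the Cauchy-Schwarz inequality the partial sums at \<open>x\<close> are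
  dominated by those of the summable family \<open>(norm (R i x))\<^sup>2\<close>.
\<close>

lemma strong_has_sum_row_column:
  fixes S :: "'i \<Rightarrow> 'b::complex_hilbert \<Rightarrow>\<^sub>L 'c::complex_hilbert"
    and R :: "'i \<Rightarrow> 'a::complex_hilbert \<Rightarrow>\<^sub>L 'b"
  assumes S: "\<And>i. i \<in> I \<Longrightarrow> S i \<in> bounded_ops" and R: "\<And>i. i \<in> I \<Longrightarrow> R i \<in> bounded_ops"
    and S_bound: "column_bound c I (\<lambda>i. adj (S i))" and R_bound: "column_bound d I R"
    and "0 \<le> c" "0 \<le> d"
  obtains P where "P \<in> bounded_ops" and "norm P \<le> sqrt (c * d)"
    and "strong_has_sum (\<lambda>i. S i o\<^sub>L R i) I P"
proof -
  have le: "(norm (\<Sum>i\<in>F. S i (R i x)))\<^sup>2 \<le> c * (\<Sum>i\<in>F. (norm (R i x))\<^sup>2)"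
    if "finite F" "F \<subseteq> I" for F x
    by (rule norm_row_column_sum_le[OF S S_bound that \<open>0 \<le> c\<close>])
  have le2: "norm (\<Sum>i\<in>F. S i (R i x)) \<le> sqrt (c * d) * norm x" if "finite F" "F \<subseteq> I" for F x
  proof -
    have "(norm (\<Sum>i\<in>F. S i (R i x)))\<^sup>2 \<le> c * (d * (norm x)\<^sup>2)"
      using le[OF that] mult_left_mono[OF column_boundD[OF R_bound that] \<open>0 \<le> c\<close>]
      by (rule order_trans)
    also have "\<dots> = (sqrt (c * d) * norm x)\<^sup>2"
      using \<open>0 \<le> c\<close> \<open>0 \<le> d\<close> by (simp add: power_mult_distrib)
    finally show ?thesis
      by (rule power2_le_imp_le) (simp add: \<open>0 \<le> c\<close> \<open>0 \<le> d\<close>)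
  qed
  have summable: "(\<lambda>i. S i (R i x)) summable_on I" for x
  proof (rule summable_on_if_dominated)
    show "(\<lambda>i. (norm (R i x))\<^sup>2) summable_on I"
      by (rule nonneg_bounded_partial_sums_imp_summable_on[where C = "d * (norm x)\<^sup>2"])
        (use column_boundD[OF R_bound] in \<open>auto intro!: eventually_finite_subsets_at_top_weakI\<close>)
    show "0 < c + 1"
      using \<open>0 \<le> c\<close> by simp
    show "(norm (\<Sum>i\<in>F. S i (R i x)))\<^sup>2 \<le> (c + 1) * (\<Sum>i\<in>F. (norm (R i x))\<^sup>2)"
      if "finite F" "F \<subseteq> I" for F
      using le[OF that, of x] sum_nonneg[of F "\<lambda>i. (norm (R i x))\<^sup>2"]
      by (simp add: distrib_right)
  qed simp
  define f where "f x = infsum (\<lambda>i. S i (R i x)) I" for x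
  have hs: "((\<lambda>i. S i (R i x)) has_sum f x) I" for x
    unfolding f_def by (rule has_sum_infsum[OF summable])
  have add: "f (x + y) = f x + f y" for x y
    using has_sum_add[OF hs hs, of x y] hs[of "x + y"]
    by (intro has_sum_unique[OF hs]) (simp add: blinfun.bilinear_simps)
  have scale: "f (a *\<^sub>C x) = a *\<^sub>C f x" for a x
  proof (rule has_sum_unique[OF hs])
    have "((\<lambda>i. a *\<^sub>C S i (R i x)) has_sum a *\<^sub>C f x) I"
      using has_sum_bounded_linear[OF scaleC.bounded_linear_right hs] by (simp add: o_def)
    then show "((\<lambda>i. S i (R i (a *\<^sub>C x))) has_sum a *\<^sub>C f x) I"
      by (rule has_sum_cong[THEN iffD1, rotated]) (simp add: bounded_opsD S R)
  qed
  have bound: "norm (f x) \<le> sqrt (c * d) * norm x" for x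
  proof (rule field_le_epsilon)
    fix e :: real
    assume "0 < e"
    then obtain F where "finite F" "F \<subseteq> I" "dist (\<Sum>i\<in>F. S i (R i x)) (f x) \<le> e"
      using has_sum_finite_approximation[OF hs] by blast
    then show "norm (f x) \<le> sqrt (c * d) * norm x + e"
      using le2[of F x] norm_triangle_ineq2[of "f x" "\<Sum>i\<in>F. S i (R i x)"]
      by (simp add: dist_norm norm_minus_commute)
  qed
  show thesis
  proof (rule that[of "Blinfun f"])
    show "strong_has_sum (\<lambda>i. S i o\<^sub>L R i) I (Blinfun f)"
      using hs by (simp add: strong_has_sum_def blinfun_in_bounded_opsI(2)[OF add scale bound])
  qed (use blinfun_in_bounded_opsI[OF add scale bound] \<open>0 \<le> c\<close> \<open>0 \<le> d\<close> in auto)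
qed

section \<open>Words\<close>

lemma word_op_Nil [simp]: "word_op X [] = id_blinfun"
  and word_op_Cons [simp]: "word_op X (i # \<alpha>) = X i o\<^sub>L word_op X \<alpha>"
  by (simp_all add: word_op_def)

lemma word_op_bounded_ops: "(\<And>i. X i \<in> bounded_ops) \<Longrightarrow> word_op X \<alpha> \<in> bounded_ops"
  by (induction \<alpha>) auto

lemma words_Suc: "{\<alpha> :: 'n list. length \<alpha> = Suc k} = (\<lambda>(i, \<alpha>). i # \<alpha>) ` (UNIV \<times> {\<alpha>. length \<alpha> = k})"
  by (auto simp: length_Suc_conv image_iff)

lemma finite_words_subset:
  fixes F :: "'n list set"
  assumes "finite F" and "F \<subseteq> {\<alpha>. length \<alpha> = Suc k}"
    and "\<And>i \<alpha>. 0 \<le> (f i \<alpha> :: real)"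
  shows "(\<Sum>\<alpha>\<in>F. f (hd \<alpha>) (tl \<alpha>)) \<le> (\<Sum>i\<in>hd ` F. \<Sum>\<alpha>\<in>tl ` F. f i \<alpha>)"
proof -
  have "(\<Sum>\<alpha>\<in>F. f (hd \<alpha>) (tl \<alpha>)) = (\<Sum>p\<in>(\<lambda>\<alpha>. (hd \<alpha>, tl \<alpha>)) ` F. f (fst p) (snd p))"
  proof (subst sum.reindex)
    show "inj_on (\<lambda>\<alpha>. (hd \<alpha>, tl \<alpha>)) F"
    proof (rule inj_onI)
      fix \<alpha> \<beta>
      assume "\<alpha> \<in> F" "\<beta> \<in> F" "(hd \<alpha>, tl \<alpha>) = (hd \<beta>, tl \<beta>)"
      moreover have "\<alpha> \<noteq> []" "\<beta> \<noteq> []"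
        using assms(2) \<open>\<alpha> \<in> F\<close> \<open>\<beta> \<in> F\<close> by auto
      ultimately show "\<alpha> = \<beta>"
        by (simp add: list.expand)
    qed
  qed simp
  also have "\<dots> \<le> (\<Sum>p\<in>hd ` F \<times> tl ` F. f (fst p) (snd p))"
    using assms by (intro sum_mono2) auto
  also have "\<dots> = (\<Sum>i\<in>hd ` F. \<Sum>\<alpha>\<in>tl ` F. f i \<alpha>)"
    by (simp add: sum.cartesian_product split_def)
  finally show ?thesis .
qed

lemma tl_words: "F \<subseteq> {\<alpha>. length \<alpha> = Suc k} \<Longrightarrow> tl ` F \<subseteq> {\<alpha>. length \<alpha> = k}"
  by auto

text \<open>
  A product of columns is a column with index set the words; the estimate is applied to one letter after the
  other.
\<close>

lemma column_bound_words_outer: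
  fixes P :: "'n \<Rightarrow> 'b::complex_hilbert \<Rightarrow>\<^sub>L 'c::complex_hilbert"
    and Q :: "'n list \<Rightarrow> 'a::complex_hilbert \<Rightarrow>\<^sub>L 'b"
  assumes P: "column_bound 1 UNIV P" and Q: "column_bound 1 {\<alpha>. length \<alpha> = k} Q"
  shows "column_bound 1 {\<alpha>. length \<alpha> = Suc k} (\<lambda>\<alpha>. P (hd \<alpha>) o\<^sub>L Q (tl \<alpha>))"
  unfolding column_bound_def
proof (intro allI impI)
  fix F :: "'n list set" and z
  assume F: "finite F" "F \<subseteq> {\<alpha>. length \<alpha> = Suc k}"
  have "(\<Sum>\<alpha>\<in>F. (norm ((P (hd \<alpha>) o\<^sub>L Q (tl \<alpha>)) z))\<^sup>2)
      \<le> (\<Sum>i\<in>hd ` F. \<Sum>\<alpha>\<in>tl ` F. (norm (P i (Q \<alpha> z)))\<^sup>2)"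
    using finite_words_subset[OF F, of "\<lambda>i \<alpha>. (norm (P i (Q \<alpha> z)))\<^sup>2"] by simp
  also have "\<dots> = (\<Sum>\<alpha>\<in>tl ` F. \<Sum>i\<in>hd ` F. (norm (P i (Q \<alpha> z)))\<^sup>2)"
    by (rule sum.swap)
  also have "\<dots> \<le> (\<Sum>\<alpha>\<in>tl ` F. (norm (Q \<alpha> z))\<^sup>2)"
    using column_boundD[OF P, of "hd ` F"] F(1) by (intro sum_mono) simp
  also have "\<dots> \<le> 1 * (norm z)\<^sup>2"
    by (rule column_boundD[OF Q]) (use F tl_words in auto)
  finally show "(\<Sum>\<alpha>\<in>F. (norm ((P (hd \<alpha>) o\<^sub>L Q (tl \<alpha>)) z))\<^sup>2) \<le> 1 * (norm z)\<^sup>2" .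
qed

text \<open>
  The counterpart for adjoints, which reverse the order of the factors.
\<close>

lemma column_bound_words_inner:
  fixes P :: "'n \<Rightarrow> 'a::complex_hilbert \<Rightarrow>\<^sub>L 'b::complex_hilbert"
    and Q :: "'n list \<Rightarrow> 'b \<Rightarrow>\<^sub>L 'c::complex_hilbert"
  assumes P: "column_bound 1 UNIV P" and Q: "column_bound 1 {\<alpha>. length \<alpha> = k} Q"
  shows "column_bound 1 {\<alpha>. length \<alpha> = Suc k} (\<lambda>\<alpha>. Q (tl \<alpha>) o\<^sub>L P (hd \<alpha>))"
  unfolding column_bound_def
proof (intro allI impI)
  fix F :: "'n list set" and z
  assume F: "finite F" "F \<subseteq> {\<alpha>. length \<alpha> = Suc k}"
  have "(\<Sum>\<alpha>\<in>F. (norm ((Q (tl \<alpha>) o\<^sub>L P (hd \<alpha>)) z))\<^sup>2)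
      \<le> (\<Sum>i\<in>hd ` F. \<Sum>\<alpha>\<in>tl ` F. (norm (Q \<alpha> (P i z)))\<^sup>2)"
    using finite_words_subset[OF F, of "\<lambda>i \<alpha>. (norm (Q \<alpha> (P i z)))\<^sup>2"] by simp
  also have "\<dots> \<le> (\<Sum>i\<in>hd ` F. (norm (P i z))\<^sup>2)"
    using column_boundD[OF Q, of "tl ` F"] F tl_words[OF F(2)] by (intro sum_mono) simp
  also have "\<dots> \<le> 1 * (norm z)\<^sup>2"
    by (rule column_boundD[OF P]) (use F in auto)
  finally show "(\<Sum>\<alpha>\<in>F. (norm ((Q (tl \<alpha>) o\<^sub>L P (hd \<alpha>)) z))\<^sup>2) \<le> 1 * (norm z)\<^sup>2" .
qed

lemma column_bound_words:
  fixes P :: "'n \<Rightarrow> 'a::complex_hilbert \<Rightarrow>\<^sub>L 'a"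
  assumes P: "column_bound 1 UNIV P"
  shows "column_bound 1 {\<alpha>. length \<alpha> = k} (word_op P)"
proof (induction k)
  case 0
  show ?case
    unfolding column_bound_def
  proof (intro allI impI)
    fix F :: "'n list set" and z
    assume F: "finite F" "F \<subseteq> {\<alpha>. length \<alpha> = 0}"
    then have "F = {} \<or> F = {[]}"
      by auto
    then show "(\<Sum>\<alpha>\<in>F. (norm (word_op P \<alpha> z))\<^sup>2) \<le> 1 * (norm z)\<^sup>2"
      by auto
  qed
next
  case (Suc k)
  show ?case
    using column_bound_words_outer[OF P Suc]
    by (rule column_bound_cong[THEN iffD1, rotated]) (auto simp: length_Suc_conv)
qed

lemma column_bound_adj_words:
  fixes P :: "'n \<Rightarrow> 'a::complex_hilbert \<Rightarrow>\<^sub>L 'a"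
  assumes P: "column_bound 1 UNIV (\<lambda>i. adj (P i))" and P_ops: "\<And>i. P i \<in> bounded_ops"
  shows "column_bound 1 {\<alpha>. length \<alpha> = k} (\<lambda>\<alpha>. adj (word_op P \<alpha>))"
proof (induction k)
  case 0
  have "column_bound 1 {\<alpha>. length \<alpha> = 0} (word_op P)"
    unfolding column_bound_def
  proof (intro allI impI)
    fix F :: "'n list set" and z
    assume F: "finite F" "F \<subseteq> {\<alpha>. length \<alpha> = 0}"
    then have "F = {} \<or> F = {[]}"
      by auto
    then show "(\<Sum>\<alpha>\<in>F. (norm (word_op P \<alpha> z))\<^sup>2) \<le> 1 * (norm z)\<^sup>2"
      by auto
  qed
  then show ?case
    by (rule column_bound_cong[THEN iffD1, rotated]) simp
next
  case (Suc k)
  show ?case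
    using column_bound_words_inner[OF P Suc]
    by (rule column_bound_cong[THEN iffD1, rotated])
      (auto simp: length_Suc_conv adj_compose P_ops word_op_bounded_ops)
qed

text \<open>
  Strong convergence of the two factors does not make the doubly indexed sum unconditionally convergent. This is
  why \<open>joint\<close> is assumed; given it, the sum over words may be taken in two stages.
\<close>

lemma strong_has_sum_words:
  fixes G :: "'n \<Rightarrow> 'b::complex_hilbert \<Rightarrow>\<^sub>L 'c::complex_hilbert"
    and Q :: "'n list \<Rightarrow> 'a::complex_hilbert \<Rightarrow>\<^sub>L 'b"
  assumes G: "strong_has_sum G UNIV G'" and Q: "strong_has_sum Q {\<alpha>. length \<alpha> = k} Q'"
    and joint: "strong_has_sum (\<lambda>\<alpha>. G (hd \<alpha>) o\<^sub>L Q (tl \<alpha>)) {\<alpha>. length \<alpha> = Suc k} J"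
  shows "J = G' o\<^sub>L Q'"
proof (rule blinfun_eqI)
  fix x
  have "((\<lambda>\<alpha>. G (hd \<alpha>) (Q (tl \<alpha>) x)) has_sum J x) ((\<lambda>(i, \<alpha>). i # \<alpha>) ` (UNIV \<times> {\<alpha>. length \<alpha> = k}))"
    using joint unfolding strong_has_sum_def words_Suc by simp
  then have "((\<lambda>(i, \<alpha>). G i (Q \<alpha> x)) has_sum J x) (UNIV \<times> {\<alpha>. length \<alpha> = k})"
    by (subst (asm) has_sum_reindex) (auto simp: inj_on_def o_def split_def)
  moreover have "((\<lambda>\<alpha>. (case (i, \<alpha>) of (i, \<alpha>) \<Rightarrow> G i (Q \<alpha> x))) has_sum G i (Q' x)) {\<alpha>. length \<alpha> = k}" for i
  proof -
    have "((\<lambda>\<alpha>. Q \<alpha> x) has_sum Q' x) {\<alpha>. length \<alpha> = k}"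
      using Q by (simp add: strong_has_sum_def)
    from has_sum_bounded_linear[OF blinfun.bounded_linear_right this, of "G i"] show ?thesis
      by (simp add: o_def)
  qed
  ultimately have "((\<lambda>i. G i (Q' x)) has_sum J x) UNIV"
    by (rule has_sum_Sigma[OF isUCont_plus])
  moreover have "((\<lambda>i. G i (Q' x)) has_sum G' (Q' x)) UNIV"
    using G by (simp add: strong_has_sum_def)
  ultimately show "J x = (G' o\<^sub>L Q') x"
    by (simp add: has_sum_unique)
qed

section \<open>Row contractions\<close>

lemma row_ball_bounded_ops: "X \<in> row_ball \<Longrightarrow> X i \<in> bounded_ops"
  by (simp add: row_ball_def)

text \<open>
  The partial sums of \<open>(norm (adj (X i) z))\<^sup>2\<close> are bounded by \<open>cinner (T z) z\<close> for the sum \<open>T\<close> of the series that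
  defines the row norm.
\<close>

lemma row_ball_column_bound:
  assumes "X \<in> row_ball"
  obtains c where "0 \<le> c" and "c < 1"
    and "column_bound c UNIV (\<lambda>i. adj (X i))"
proof -
  from assms obtain T where X: "\<And>i. X i \<in> bounded_ops"
    and T: "strong_has_sum (\<lambda>i. X i o\<^sub>L adj (X i)) UNIV T" and "row_norm X < 1"
    by (auto simp: row_ball_def)
  then have "norm T < 1"
    by (simp add: row_norm_def strong_sum_eq)
  have "column_bound (norm T) UNIV (\<lambda>i. adj (X i))"
    unfolding column_bound_def
  proof (intro allI impI)
    fix F :: "'a set" and z
    assume F: "finite F"
    have "((\<lambda>i. (X i o\<^sub>L adj (X i)) z) has_sum T z) UNIV"
      using T by (simp add: strong_has_sum_def)
    from has_sum_bounded_linear[OF bounded_linear_compose[OF bounded_linear_Re cinner.bounded_linear_left] this, of z]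
    have "((\<lambda>i. (norm (adj (X i) z))\<^sup>2) has_sum Re (cinner (T z) z)) UNIV"
      by (simp add: o_def cinner_adj_right[OF X, symmetric])
    then have "(\<Sum>i\<in>F. (norm (adj (X i) z))\<^sup>2) \<le> Re (cinner (T z) z)"
      by (rule finite_sum_le_has_sum) (use F in auto)
    also have "\<dots> \<le> norm (T z) * norm z"
      by (rule order_trans[OF complex_Re_le_cmod norm_cinner_le])
    also have "\<dots> \<le> norm T * norm z * norm z"
      by (intro mult_right_mono norm_blinfun) simp
    finally show "(\<Sum>i\<in>F. (norm (adj (X i) z))\<^sup>2) \<le> norm T * (norm z)\<^sup>2"
      by (simp add: power2_eq_square mult.assoc)
  qed
  with \<open>norm T < 1\<close> show thesis
    by (intro that) auto
qed

lemma zero_in_row_ball: "(\<lambda>i. 0) \<in> (row_ball :: ('n::countable \<Rightarrow> 'h::complex_hilbert \<Rightarrow>\<^sub>L 'h) set)"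
proof -
  have "strong_has_sum (\<lambda>i :: 'n. (0 :: 'h \<Rightarrow>\<^sub>L 'h) o\<^sub>L adj (0 :: 'h \<Rightarrow>\<^sub>L 'h)) UNIV 0"
    by (simp add: strong_has_sum_def has_sum_0)
  moreover from strong_sum_eq[OF this] have "row_norm (\<lambda>i :: 'n. (0 :: 'h \<Rightarrow>\<^sub>L 'h)) < 1"
    by (simp add: row_norm_def)
  ultimately show ?thesis
    by (auto simp: row_ball_def)
qed

lemma tensor_op_swap: "tensor_op t t' S T = tensor_op (\<lambda>y x. t x y) (\<lambda>y x. t' x y) T S"
  unfolding tensor_op_def by (rule arg_cong[of _ _ The]) auto

lemma tensor_op_factor:
  fixes t :: "'a::complex_hilbert \<Rightarrow> 'b::complex_hilbert \<Rightarrow> 'c::complex_hilbert"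
  assumes "hilbert_tensor t" "S \<in> bounded_ops" "T \<in> bounded_ops"
  shows "tensor_op t t S T = tensor_op t t S id_blinfun o\<^sub>L tensor_op t t id_blinfun T"
  using assms by (simp add: tensor_op_compose)

lemma column_bound_tensor_right:
  fixes t :: "'a::complex_hilbert \<Rightarrow> 'b::complex_hilbert \<Rightarrow> 'c::complex_hilbert"
  assumes "hilbert_tensor t" and "\<And>i. i \<in> I \<Longrightarrow> R i \<in> bounded_ops" and "column_bound c I R"
  shows "column_bound c I (\<lambda>i. tensor_op t t id_blinfun (R i))"
  unfolding column_bound_def
proof (intro allI impI)
  fix F z
  assume "finite F" "F \<subseteq> I"
  then show "(\<Sum>i\<in>F. (norm (tensor_op t t id_blinfun (R i) z))\<^sup>2) \<le> c * (norm z)\<^sup>2"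
    using assms by (intro tensor_column_bound) (auto intro: column_boundD)
qed

lemma column_bound_tensor_left:
  fixes t :: "'a::complex_hilbert \<Rightarrow> 'b::complex_hilbert \<Rightarrow> 'c::complex_hilbert"
  assumes "hilbert_tensor t" and "\<And>i. i \<in> I \<Longrightarrow> R i \<in> bounded_ops" and "column_bound c I R"
  shows "column_bound c I (\<lambda>i. tensor_op t t (R i) id_blinfun)"
proof -
  have "column_bound c I (\<lambda>i. tensor_op (\<lambda>y x. t x y) (\<lambda>y x. t x y) id_blinfun (R i))"
    by (rule column_bound_tensor_right[OF hilbert_tensor.swap]) fact+
  then show ?thesis
    by (rule column_bound_cong[THEN iffD1, rotated]) (rule tensor_op_swap[of t t, symmetric])
qed

text \<open>
  The summand is the row entry \<open>X i \<otimes> I\<close> times the column entry \<open>I \<otimes> B i\<close>.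
\<close>

lemma strong_has_sum_tensor:
  fixes t :: "'a::complex_hilbert \<Rightarrow> 'b::complex_hilbert \<Rightarrow> 'c::complex_hilbert"
  assumes t: "hilbert_tensor t"
    and X: "\<And>i. i \<in> I \<Longrightarrow> X i \<in> bounded_ops" and B: "\<And>i. i \<in> I \<Longrightarrow> B i \<in> bounded_ops"
    and X_bound: "column_bound c I (\<lambda>i. adj (X i))" and B_bound: "column_bound 1 I B" and "0 \<le> c"
  obtains P where "P \<in> bounded_ops" and "norm P \<le> sqrt c"
    and "strong_has_sum (\<lambda>i. tensor_op t t (X i) (B i)) I P"
proof -
  have "column_bound c I (\<lambda>i. tensor_op t t (adj (X i)) id_blinfun)"
    by (rule column_bound_tensor_left[OF t]) (use X X_bound in auto)
  then have S_bound: "column_bound c I (\<lambda>i. adj (tensor_op t t (X i) id_blinfun))"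
    by (rule column_bound_cong[THEN iffD1, rotated]) (simp add: tensor_op_adj t X)
  have R_bound: "column_bound 1 I (\<lambda>i. tensor_op t t id_blinfun (B i))"
    by (rule column_bound_tensor_right[OF t]) (use B B_bound in auto)
  obtain P where P: "P \<in> bounded_ops" "norm P \<le> sqrt (c * 1)"
    "strong_has_sum (\<lambda>i. tensor_op t t (X i) id_blinfun o\<^sub>L tensor_op t t id_blinfun (B i)) I P"
    by (rule strong_has_sum_row_column[OF _ _ S_bound R_bound])
      (use t X B \<open>0 \<le> c\<close> in \<open>simp_all add: tensor_op_bounded_ops\<close>)
  have "strong_has_sum (\<lambda>i. tensor_op t t (X i) (B i)) I P"
    by (rule strong_has_sum_cong[THEN iffD1, rotated, OF P(3)])
      (rule tensor_op_factor[OF t X B, symmetric])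
  with P show thesis
    by (intro that) simp_all
qed

lemma strong_has_sum_tensor_words:
  fixes t :: "'h::complex_hilbert \<Rightarrow> 'k::complex_hilbert \<Rightarrow> 'c::complex_hilbert"
    and X :: "'n::countable \<Rightarrow> 'h \<Rightarrow>\<^sub>L 'h"
  assumes t: "hilbert_tensor t" and X: "X \<in> row_ball"
    and P: "\<And>i. P i \<in> bounded_ops" "column_bound 1 UNIV P"
    and Q: "\<And>\<alpha>. Q \<alpha> \<in> bounded_ops" "column_bound 1 {\<alpha>. length \<alpha> = k} Q"
    and sum_P: "strong_has_sum (\<lambda>i. tensor_op t t (X i) (P i)) UNIV P'"
    and sum_Q: "strong_has_sum (\<lambda>\<alpha>. tensor_op t t (word_op X \<alpha>) (Q \<alpha>)) {\<alpha>. length \<alpha> = k} Q'"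
  shows "strong_has_sum (\<lambda>\<alpha>. tensor_op t t (word_op X \<alpha>) (P (hd \<alpha>) o\<^sub>L Q (tl \<alpha>)))
    {\<alpha>. length \<alpha> = Suc k} (P' o\<^sub>L Q')"
proof -
  have X_ops: "X i \<in> bounded_ops" for i
    using X by (rule row_ball_bounded_ops)
  from X obtain c where c: "0 \<le> c" "c < 1"
    and X_bound: "column_bound c UNIV (\<lambda>i. adj (X i))"
    by (rule row_ball_column_bound)
  have "column_bound 1 UNIV (\<lambda>i. adj (X i))"
    unfolding column_bound_def
  proof (intro allI impI)
    fix F :: "'n set" and z
    assume "finite F" "F \<subseteq> UNIV"
    then have "(\<Sum>i\<in>F. (norm (adj (X i) z))\<^sup>2) \<le> c * (norm z)\<^sup>2"
      by (rule column_boundD[OF X_bound])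
    also have "\<dots> \<le> 1 * (norm z)\<^sup>2"
      using c by (intro mult_right_mono) simp_all
    finally show "(\<Sum>i\<in>F. (norm (adj (X i) z))\<^sup>2) \<le> 1 * (norm z)\<^sup>2" .
  qed
  then have "column_bound 1 {\<alpha>. length \<alpha> = Suc k} (\<lambda>\<alpha>. adj (word_op X \<alpha>))"
    using X_ops by (rule column_bound_adj_words)
  moreover have "column_bound 1 {\<alpha>. length \<alpha> = Suc k} (\<lambda>\<alpha>. P (hd \<alpha>) o\<^sub>L Q (tl \<alpha>))"
    by (rule column_bound_words_outer[OF P(2) Q(2)])
  ultimately obtain J where
    J: "strong_has_sum (\<lambda>\<alpha>. tensor_op t t (word_op X \<alpha>) (P (hd \<alpha>) o\<^sub>L Q (tl \<alpha>))) {\<alpha>. length \<alpha> = Suc k} J"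
    by (rule strong_has_sum_tensor[OF t, rotated 2])
      (auto simp: X_ops P Q word_op_bounded_ops bounded_ops_compose)
  have "strong_has_sum (\<lambda>\<alpha>. tensor_op t t (X (hd \<alpha>)) (P (hd \<alpha>)) o\<^sub>L
      tensor_op t t (word_op X (tl \<alpha>)) (Q (tl \<alpha>))) {\<alpha>. length \<alpha> = Suc k} J"
    by (rule strong_has_sum_cong[THEN iffD1, rotated, OF J])
      (auto simp: length_Suc_conv tensor_op_compose t X_ops P Q word_op_bounded_ops)
  from strong_has_sum_words[OF sum_P sum_Q this] J show ?thesis
    by simp
qed

text \<open>
  The powers of \<open>\<Sum>i. X i \<otimes> P i\<close> are the homogeneous sums over words.
\<close>

lemma strong_has_sum_tensor_power:
  fixes t :: "'h::complex_hilbert \<Rightarrow> 'k::complex_hilbert \<Rightarrow> 'c::complex_hilbert"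
    and X :: "'n::countable \<Rightarrow> 'h \<Rightarrow>\<^sub>L 'h"
  assumes t: "hilbert_tensor t" and X: "X \<in> row_ball"
    and P: "\<And>i. P i \<in> bounded_ops" "column_bound 1 UNIV P"
    and sum_P: "strong_has_sum (\<lambda>i. tensor_op t t (X i) (P i)) UNIV P'"
  shows "strong_has_sum (\<lambda>\<alpha>. tensor_op t t (word_op X \<alpha>) (word_op P \<alpha>)) {\<alpha>. length \<alpha> = k} (op_power P' k)"
proof (induction k)
  case 0
  have "((\<lambda>\<alpha>. tensor_op t t (word_op X \<alpha>) (word_op P \<alpha>) x) has_sum x) {[]}" for x
    by (rule has_sum_finiteI) (simp_all add: tensor_op_id t)
  then show ?case
    by (simp add: strong_has_sum_def)
next
  case (Suc k)
  have "strong_has_sum (\<lambda>\<alpha>. tensor_op t t (word_op X \<alpha>) (P (hd \<alpha>) o\<^sub>L word_op P (tl \<alpha>)))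
    {\<alpha>. length \<alpha> = Suc k} (P' o\<^sub>L op_power P' k)"
    by (rule strong_has_sum_tensor_words[OF t X P _ _ sum_P Suc])
      (simp_all add: word_op_bounded_ops P column_bound_words)
  then show ?case
    unfolding op_power_Suc
    by (rule strong_has_sum_cong[THEN iffD1, rotated]) (auto simp: length_Suc_conv)
qed

section \<open>The state space formula\<close>

text \<open>
  The main operator of the state space formula: the identity off the range of \<open>W\<close>, and \<open>adj A\<close>
  transplanted to the range of \<open>W\<close>.
\<close>

definition feedback :: "('c::complex_hilbert \<Rightarrow>\<^sub>L 'd::complex_hilbert) \<Rightarrow> ('c \<Rightarrow>\<^sub>L 'c) \<Rightarrow> ('d \<Rightarrow>\<^sub>L 'd)"
  where "feedback W A = id_blinfun - (W o\<^sub>L adj W) + (W o\<^sub>L adj A o\<^sub>L adj W)"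

lemma feedback_bounded_ops:
  "W \<in> bounded_ops \<Longrightarrow> A \<in> bounded_ops \<Longrightarrow> feedback W A \<in> bounded_ops"
  unfolding feedback_def by (intro bounded_ops_add bounded_ops_diff bounded_ops_compose) auto

text \<open>
  A norm preserving operator preserves inner products by polarization.
\<close>

lemma isometry_adj_compose:
  fixes W :: "'a::complex_hilbert \<Rightarrow>\<^sub>L 'b::complex_hilbert"
  assumes W: "W \<in> bounded_ops" and iso: "\<And>x. norm (blinfun_apply W x) = norm x"
  shows "adj W o\<^sub>L W = id_blinfun"
proof -
  have *: "Re (cinner (W x) (W y)) = Re (cinner x y)" for x y
    using norm_add_sqr[of "W x" "W y"] norm_add_sqr[of x y] iso[of "x + y"] iso[of x] iso[of y]
    by (simp add: blinfun.bilinear_simps)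
  have "cinner (W x) (W y) = cinner x y" for x y
    using *[of x y] *[of x "\<i> *\<^sub>C y"]
    by (intro complex_eqI) (simp_all add: bounded_opsD[OF W] cinner_scaleC_right)
  then show ?thesis
    by (intro blinfun_eqI cinner_eqI) (simp add: cinner_adj_left[OF W])
qed

text \<open>
  The setting of the formula for one fixed point \<open>X\<close>. In the application \<open>T\<close> is \<open>\<Sum>i. X i \<otimes> adj (V i)\<close>, and
  \<open>W\<close>, \<open>A\<close> are tensored with the identity.
\<close>

locale isometric_colligation =
  fixes W :: "'c::complex_hilbert \<Rightarrow>\<^sub>L 'd::complex_hilbert" and T :: "'d \<Rightarrow>\<^sub>L 'd" and A :: "'c \<Rightarrow>\<^sub>L 'c"
  assumes W: "W \<in> bounded_ops" and WW: "adj W o\<^sub>L W = id_blinfun"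
    and T: "T \<in> bounded_ops" and T1: "norm T < 1"
    and A: "A \<in> bounded_ops" and A1: "norm A < 1"
begin

lemma adj_W_W [simp]: "blinfun_apply (adj W) (blinfun_apply W x) = x"
  using arg_cong[OF WW, of "\<lambda>S. blinfun_apply S x"] by simp

lemma norm_W_plus_complement:
  "(norm (blinfun_apply W a + (z - blinfun_apply W (blinfun_apply (adj W) z))))\<^sup>2
    = (norm a)\<^sup>2 + (norm z)\<^sup>2 - (norm (blinfun_apply (adj W) z))\<^sup>2"
proof -
  have iso: "cinner (W x) (W y) = cinner x y" for x y
    by (simp add: cinner_adj_right[OF W, symmetric])
  have "cinner (W a) (z - W (adj W z)) = 0"
    by (simp add: cinner.diff_right iso cinner_adj_right[OF W])
  moreover have "cinner z (W (adj W z)) = cinner (adj W z) (adj W z)"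
    by (simp add: cinner_adj_left[OF W])
  moreover have "(norm (W x))\<^sup>2 = (norm x)\<^sup>2" for x
    using arg_cong[OF iso[of x x], of Re] by simp
  ultimately show ?thesis
    by (simp add: norm_add_sqr norm_diff_sqr)
qed

lemma feedback_apply:
  assumes "B \<in> bounded_ops"
  shows "blinfun_apply (feedback W B) z = blinfun_apply W (blinfun_apply (adj B) (blinfun_apply (adj W) z))
    + (z - blinfun_apply W (blinfun_apply (adj W) z))"
  by (simp add: feedback_def blinfun.bilinear_simps)

lemma norm_feedback_le:
  assumes B: "B \<in> bounded_ops" and "norm B \<le> 1"
  shows "norm (feedback W B) \<le> 1"
proof (rule norm_blinfun_bound)
  fix z
  have "norm (adj B y) \<le> norm y" for y
    using norm_blinfun[of "adj B" y] mult_right_mono[OF assms(2) norm_ge_zero[of y]]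
    by (simp add: norm_adj[OF B])
  then have "(norm (adj B (adj W z)))\<^sup>2 \<le> (norm (adj W z))\<^sup>2"
    by (intro power_mono) simp_all
  then have "(norm (feedback W B z))\<^sup>2 \<le> (norm z)\<^sup>2"
    by (simp add: feedback_apply[OF B] norm_W_plus_complement)
  then have "norm (feedback W B z) \<le> norm z"
    by (rule power2_le_imp_le) simp
  then show "norm (feedback W B z) \<le> 1 * norm z"
    by simp
qed simp

text \<open>
  The resolvent is characterized pointwise: \<open>N x\<close> is the only solution \<open>y\<close> of \<open>y = x + M T y\<close> for
  \<open>M = feedback W B\<close>. Operator identities below are obtained by recognizing solutions of this equation.
\<close>

lemma feedback_resolvent:
  assumes B: "B \<in> bounded_ops" and "norm B \<le> 1"
  shows "\<exists>N. N \<in> bounded_ops \<and> op_power (feedback W B o\<^sub>L T) sums N \<and>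
    (\<forall>x. blinfun_apply N x = x + blinfun_apply (feedback W B) (blinfun_apply T (blinfun_apply N x))) \<and>
    (\<forall>x y. y - blinfun_apply (feedback W B) (blinfun_apply T y) = x \<longrightarrow> y = blinfun_apply N x)"
proof -
  have "norm (feedback W B o\<^sub>L T) \<le> norm (feedback W B) * norm T"
    by (rule norm_blinfun_compose)
  also have "\<dots> \<le> 1 * norm T"
    by (intro mult_right_mono norm_feedback_le assms) simp
  finally have "norm (feedback W B o\<^sub>L T) < 1"
    using T1 by simp
  have "feedback W B o\<^sub>L T \<in> bounded_ops"
    using W T B by (intro bounded_ops_compose feedback_bounded_ops)
  then obtain N where N: "N \<in> bounded_ops" "op_power (feedback W B o\<^sub>L T) sums N"
    "N o\<^sub>L (id_blinfun - (feedback W B o\<^sub>L T)) = id_blinfun"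
    "(id_blinfun - (feedback W B o\<^sub>L T)) o\<^sub>L N = id_blinfun"
    using \<open>norm (feedback W B o\<^sub>L T) < 1\<close> by (rule neumann_series)
  show ?thesis
  proof (intro exI[of _ N] conjI N(1,2) allI impI)
    show "N x = x + feedback W B (T (N x))" for x
      using arg_cong[OF N(4), of "\<lambda>S. blinfun_apply S x"] by (simp add: blinfun.bilinear_simps algebra_simps)
    show "y = N x" if "y - feedback W B (T y) = x" for x y
      using arg_cong[OF N(3), of "\<lambda>S. blinfun_apply S y"] that by (simp add: blinfun.bilinear_simps)
  qed
qed

text \<open>
  Let \<open>L\<close>, \<open>N0\<close>, \<open>N\<close> be the resolvents of \<open>T\<close>, \<open>feedback W 0 o\<^sub>L T\<close> and \<open>feedback W A o\<^sub>L T\<close>. The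
  compression of \<open>L\<close> to the range of \<open>W\<close> is inverse to \<open>id_blinfun - H\<close>, where \<open>H = adj W T N0 W\<close>; so the Cayley
  transform is \<open>H\<close>. Closing the loop of \<open>H\<close> with \<open>adj A\<close> replaces \<open>N0\<close> by \<open>N\<close>. For the norm bound put
  \<open>y = N W D u\<close>, \<open>s = adj W T y\<close>: the Julia identity for \<open>(u, s)\<close> and the orthogonality of \<open>W a\<close> and the
  complement of the range of \<open>W\<close> say that \<open>u\<close> and \<open>T y\<close> have the same energy as the value at \<open>u\<close> and \<open>y\<close>, and
  \<open>T\<close> is a contraction.
\<close>

lemma fractional_cayley_resolvent:
  fixes g :: "'x \<Rightarrow> 'c \<Rightarrow>\<^sub>L 'c"
  assumes g: "g X = adj W o\<^sub>L (2 *\<^sub>R op_inv (id_blinfun - T) - id_blinfun) o\<^sub>L W"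
  obtains N where "N \<in> bounded_ops" and "op_power (feedback W A o\<^sub>L T) sums N"
    and "(fractional_transform A \<circ> cayley_transform) g X
      = A - (defect_op (adj A) o\<^sub>L adj W o\<^sub>L T o\<^sub>L N o\<^sub>L W o\<^sub>L defect_op A)"
    and "norm ((fractional_transform A \<circ> cayley_transform) g X) \<le> 1"
proof -
  obtain L where L: "L \<in> bounded_ops" "op_power T sums L" "L o\<^sub>L (id_blinfun - T) = id_blinfun" "(id_blinfun - T) o\<^sub>L L = id_blinfun"
    by (rule neumann_series[OF T T1])
  have inv_T: "op_inv (id_blinfun - T) = L"
    by (rule op_inv_eq) fact+
  have L1: "L x = x + T (L x)" for x
    using arg_cong[OF L(4), of "\<lambda>S. blinfun_apply S x"] by (simp add: blinfun.bilinear_simps algebra_simps)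
  have L2: "y = L x" if "y - T y = x" for x y
    using arg_cong[OF L(3), of "\<lambda>S. blinfun_apply S y"] that by (simp add: blinfun.bilinear_simps)
  have z: "(0 :: 'c \<Rightarrow>\<^sub>L 'c) \<in> bounded_ops" "norm (0 :: 'c \<Rightarrow>\<^sub>L 'c) \<le> 1"
    by auto
  obtain N0 where N0: "N0 \<in> bounded_ops" "\<And>x. N0 x = x + feedback W 0 (T (N0 x))"
    "\<And>x y. y - feedback W 0 (T y) = x \<Longrightarrow> y = N0 x"
    using feedback_resolvent[OF z] by blast
  obtain N where N: "N \<in> bounded_ops" "op_power (feedback W A o\<^sub>L T) sums N"
    "\<And>x. N x = x + feedback W A (T (N x))" "\<And>x y. y - feedback W A (T y) = x \<Longrightarrow> y = N x"
    using feedback_resolvent[OF A less_imp_le[OF A1]] by blast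
  define H where "H = adj W o\<^sub>L T o\<^sub>L N0 o\<^sub>L W"
  define \<Phi> where "\<Phi> = adj W o\<^sub>L T o\<^sub>L N o\<^sub>L W"
  have H_ops: "H \<in> bounded_ops" and \<Phi>_ops: "\<Phi> \<in> bounded_ops"
    using W T N0(1) N(1) by (auto simp: H_def \<Phi>_def)
  have gx: "g X x = 2 *\<^sub>R adj W (L (W x)) - x" for x
    by (simp add: g inv_T blinfun.bilinear_simps)
  have LH: "adj W (L (W (u - H u))) = u" for u
  proof -
    define n where "n = N0 (W u)"
    have n: "n = W u + (T n - W (adj W (T n)))"
      using N0(2)[of "W u"] by (simp add: n_def feedback_apply)
    have "n - T n = W (u - H u)"
      by (subst n) (simp add: H_def n_def[symmetric] blinfun.bilinear_simps)
    then have "L (W (u - H u)) = n"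
      using L2 by metis
    moreover have "adj W n = u"
      by (subst n) (simp add: blinfun.bilinear_simps)
    ultimately show ?thesis
      by simp
  qed
  have HL: "adj W (L (W v)) - H (adj W (L (W v))) = v" for v
  proof -
    define l where "l = L (W v)"
    have l: "l = W v + T l"
      using L1[of "W v"] by (simp add: l_def)
    have "adj W l = v + adj W (T l)"
      by (subst l) (simp add: blinfun.bilinear_simps)
    then have "l - feedback W 0 (T l) = W (adj W l)"
      using l by (simp add: feedback_apply blinfun.bilinear_simps algebra_simps)
    then have "l = N0 (W (adj W l))"
      by (rule N0(3))
    then have "H (adj W l) = adj W (T l)"
      by (simp add: H_def)
    then show ?thesis
      using \<open>adj W l = v + adj W (T l)\<close> by (simp add: l_def)
  qed
  have inv_G: "op_inv (id_blinfun + g X) = (1/2) *\<^sub>R (id_blinfun - H)"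
  proof (rule op_inv_eq)
    show "((1/2) *\<^sub>R (id_blinfun - H)) o\<^sub>L (id_blinfun + g X) = id_blinfun"
      using HL by (intro blinfun_eqI) (simp add: blinfun.bilinear_simps gx scaleR_diff_right[symmetric])
    show "(id_blinfun + g X) o\<^sub>L ((1/2) *\<^sub>R (id_blinfun - H)) = id_blinfun"
      using LH by (intro blinfun_eqI) (simp add: blinfun.bilinear_simps gx scaleR_diff_right[symmetric])
  qed (use H_ops in auto)
  have "cayley_transform g X = H"
    unfolding cayley_transform_def inv_G
  proof (rule blinfun_eqI)
    fix u
    have "((g X - id_blinfun) o\<^sub>L ((1/2) *\<^sub>R (id_blinfun - H))) u
        = (1/2) *\<^sub>R (g X (u - H u) - (u - H u))"
      by (simp add: blinfun.bilinear_simps algebra_simps)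
    also have "\<dots> = (1/2) *\<^sub>R (2 *\<^sub>R (u - (u - H u)))"
      unfolding gx LH by (simp add: scaleR_2)
    finally show "((g X - id_blinfun) o\<^sub>L ((1/2) *\<^sub>R (id_blinfun - H))) u = H u"
      by simp
  qed
  have \<Phi>1: "\<Phi> u = H (u + adj A (\<Phi> u))" for u
  proof -
    define n where "n = N (W u)"
    have \<Phi>n: "\<Phi> u = adj W (T n)"
      by (simp add: \<Phi>_def n_def)
    have "n = W u + feedback W A (T n)"
      using N(3)[of "W u"] by (simp add: n_def)
    then have "n - feedback W 0 (T n) = W (u + adj A (\<Phi> u))"
      by (simp add: feedback_apply A \<Phi>n blinfun.bilinear_simps algebra_simps)
    then have "n = N0 (W (u + adj A (\<Phi> u)))"
      by (rule N0(3))
    then show ?thesis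
      by (simp add: H_def \<Phi>n)
  qed
  have \<Phi>2: "H u = \<Phi> (u - adj A (H u))" for u
  proof -
    define n where "n = N0 (W u)"
    have Hn: "H u = adj W (T n)"
      by (simp add: H_def n_def)
    have "n = W u + feedback W 0 (T n)"
      using N0(2)[of "W u"] by (simp add: n_def)
    then have "n - feedback W A (T n) = W (u - adj A (H u))"
      by (simp add: feedback_apply A Hn blinfun.bilinear_simps algebra_simps)
    then have "n = N (W (u - adj A (H u)))"
      by (rule N(4))
    then show ?thesis
      by (simp add: \<Phi>_def Hn)
  qed
  have \<Phi>H: "\<Phi> u = H u + \<Phi> (adj A (H u))" for u
    using \<Phi>2[of u] by (simp add: blinfun.bilinear_simps eq_diff_eq)
  have H\<Phi>: "\<Phi> u = H u + H (adj A (\<Phi> u))" for u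
    using \<Phi>1[of u] by (simp add: blinfun.bilinear_simps)
  have inv_H: "op_inv (id_blinfun - (H o\<^sub>L adj A)) = id_blinfun + (\<Phi> o\<^sub>L adj A)"
  proof (rule op_inv_eq)
    show "(id_blinfun + (\<Phi> o\<^sub>L adj A)) o\<^sub>L (id_blinfun - (H o\<^sub>L adj A)) = id_blinfun"
    proof (rule blinfun_eqI)
      fix x
      have "((id_blinfun + (\<Phi> o\<^sub>L adj A)) o\<^sub>L (id_blinfun - (H o\<^sub>L adj A))) x
          = x + (\<Phi> (adj A x) - (H (adj A x) + \<Phi> (adj A (H (adj A x)))))"
        by (simp add: blinfun.bilinear_simps)
      then show "((id_blinfun + (\<Phi> o\<^sub>L adj A)) o\<^sub>L (id_blinfun - (H o\<^sub>L adj A))) x = id_blinfun x"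
        by (simp only: \<Phi>H[symmetric]) simp
    qed
    show "(id_blinfun - (H o\<^sub>L adj A)) o\<^sub>L (id_blinfun + (\<Phi> o\<^sub>L adj A)) = id_blinfun"
    proof (rule blinfun_eqI)
      fix x
      have "((id_blinfun - (H o\<^sub>L adj A)) o\<^sub>L (id_blinfun + (\<Phi> o\<^sub>L adj A))) x
          = x + (\<Phi> (adj A x) - (H (adj A x) + H (adj A (\<Phi> (adj A x)))))"
        by (simp add: blinfun.bilinear_simps)
      then show "((id_blinfun - (H o\<^sub>L adj A)) o\<^sub>L (id_blinfun + (\<Phi> o\<^sub>L adj A))) x = id_blinfun x"
        by (simp only: H\<Phi>[symmetric]) simp
    qed
  qed (use A \<Phi>_ops in auto)
  have "(id_blinfun + (\<Phi> o\<^sub>L adj A)) o\<^sub>L H = \<Phi>"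
    by (rule blinfun_eqI) (simp add: blinfun.bilinear_simps \<Phi>H[symmetric])
  then have "defect_op (adj A) o\<^sub>L op_inv (id_blinfun - (H o\<^sub>L adj A)) o\<^sub>L H o\<^sub>L defect_op A
      = defect_op (adj A) o\<^sub>L \<Phi> o\<^sub>L defect_op A"
    unfolding inv_H by (simp add: blinfun_compose_assoc)
  then have formula: "(fractional_transform A \<circ> cayley_transform) g X
      = A - (defect_op (adj A) o\<^sub>L adj W o\<^sub>L T o\<^sub>L N o\<^sub>L W o\<^sub>L defect_op A)"
    by (simp add: fractional_transform_def \<open>cayley_transform g X = H\<close>)
      (simp add: \<Phi>_def blinfun_compose_assoc)
  have "norm ((fractional_transform A \<circ> cayley_transform) g X u) \<le> norm u" for u
  proof -
    define y where "y = N (W (defect_op A u))"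
    define s where "s = adj W (T y)"
    have "y = W (defect_op A u) + feedback W A (T y)"
      using N(3)[of "W (defect_op A u)"] by (simp add: y_def)
    then have "y = W (defect_op A u + adj A s) + (T y - W (adj W (T y)))"
      by (rule trans) (simp add: feedback_apply A s_def blinfun.bilinear_simps)
    then have y: "(norm y)\<^sup>2 = (norm (defect_op A u + adj A s))\<^sup>2 + (norm (T y))\<^sup>2 - (norm s)\<^sup>2"
      by (rule arg_cong[of _ _ "\<lambda>y. (norm y)\<^sup>2", THEN trans]) (simp only: norm_W_plus_complement s_def)
    have "norm (T y) \<le> norm y"
      using norm_blinfun[of T y] mult_right_mono[of "norm T" 1 "norm y"] T1 by simp
    then have "(norm (T y))\<^sup>2 \<le> (norm y)\<^sup>2"
      by (intro power_mono) simp_all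
    then have "(norm (A u - defect_op (adj A) s))\<^sup>2 \<le> (norm u)\<^sup>2"
      using julia_identity[OF A A1, of u s] y by linarith
    moreover have "(fractional_transform A \<circ> cayley_transform) g X u = A u - defect_op (adj A) s"
      unfolding formula by (simp add: blinfun.bilinear_simps s_def y_def)
    ultimately have "(norm ((fractional_transform A \<circ> cayley_transform) g X u))\<^sup>2 \<le> (norm u)\<^sup>2"
      by simp
    then show ?thesis
      by (rule power2_le_imp_le) simp
  qed
  then have "norm ((fractional_transform A \<circ> cayley_transform) g X) \<le> 1"
    by (intro norm_blinfun_bound) simp_all
  with N(1,2) formula show thesis
    by (rule that)
qed

end

section \<open>Transfer functions of isometric representations\<close>

text \<open>
  The coefficients of the Neumann series of the state space formula: between consecutive operators \<open>adj (V i)\<close>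
  stands one factor \<open>feedback W A\<close>.
\<close>

definition transfer_coeff ::
    "('e::complex_hilbert \<Rightarrow>\<^sub>L 'e) \<Rightarrow> ('n \<Rightarrow> ('k::complex_hilbert \<Rightarrow>\<^sub>L 'k)) \<Rightarrow> ('e \<Rightarrow>\<^sub>L 'k) \<Rightarrow> 'n list \<Rightarrow> ('e \<Rightarrow>\<^sub>L 'e)"
  where "transfer_coeff A V W \<alpha> = (if \<alpha> = [] then A
    else - (defect_op (adj A) o\<^sub>L adj W) o\<^sub>L
      (adj (V (hd \<alpha>)) o\<^sub>L word_op (\<lambda>i. feedback W A o\<^sub>L adj (V i)) (tl \<alpha>)) o\<^sub>L (W o\<^sub>L defect_op A))"

text \<open>
  For \<open>a i = adj (V i) z\<close> the vectors \<open>V i (a i)\<close> are orthogonal, so that \<open>w = \<Sum>i. V i (a i)\<close> has squared norm at most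
  \<open>s = \<Sum>i. (norm (a i))\<^sup>2\<close>; on the other hand \<open>s = cinner w z\<close>.
\<close>

lemma column_bound_orthogonal_ranges:
  fixes V :: "'n \<Rightarrow> ('k::complex_hilbert \<Rightarrow>\<^sub>L 'k)"
  assumes V: "\<And>i. V i \<in> bounded_ops" and contr: "\<And>i x. norm (blinfun_apply (V i) x) \<le> norm x"
    and orth: "\<And>i j x y. i \<noteq> j \<Longrightarrow> cinner (blinfun_apply (V i) x) (blinfun_apply (V j) y) = 0"
  shows "column_bound 1 UNIV (\<lambda>i. adj (V i))"
  unfolding column_bound_def
proof (intro allI impI)
  fix F :: "'n set" and z
  assume "finite F"
  define a where "a i = adj (V i) z" for i
  define s where "s = (\<Sum>i\<in>F. (norm (a i))\<^sup>2)"
  define w where "w = (\<Sum>i\<in>F. V i (a i))"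
  have "cinner w w = (\<Sum>i\<in>F. \<Sum>j\<in>F. if i = j then cinner (V i (a i)) (V i (a i)) else 0)"
    unfolding w_def cinner.sum_left unfolding cinner.sum_right
    by (intro sum.cong refl) (simp add: orth)
  also have "\<dots> = (\<Sum>i\<in>F. cinner (V i (a i)) (V i (a i)))"
    using \<open>finite F\<close> by simp
  finally have "Re (cinner w w) = Re (\<Sum>i\<in>F. cinner (V i (a i)) (V i (a i)))"
    by (rule arg_cong)
  then have "(norm w)\<^sup>2 = (\<Sum>i\<in>F. (norm (V i (a i)))\<^sup>2)"
    by simp
  also have "\<dots> \<le> s"
    unfolding s_def by (intro sum_mono power_mono contr) simp
  finally have "(norm w)\<^sup>2 \<le> s" .
  have "s = Re (cinner w z)"
    unfolding s_def w_def cinner.sum_left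
    by (simp add: a_def cinner_adj_right[OF V, symmetric])
  also have "\<dots> \<le> norm w * norm z"
    by (rule order_trans[OF complex_Re_le_cmod norm_cinner_le])
  finally have "s \<le> norm w * norm z" .
  have "s \<le> (norm z)\<^sup>2"
  proof -
    have "0 \<le> (norm w - norm z)\<^sup>2"
      by simp
    then have "2 * (norm w * norm z) \<le> (norm w)\<^sup>2 + (norm z)\<^sup>2"
      by (simp add: power2_diff)
    then show ?thesis
      using \<open>s \<le> norm w * norm z\<close> \<open>(norm w)\<^sup>2 \<le> s\<close> by linarith
  qed
  then show "(\<Sum>i\<in>F. (norm (adj (V i) z))\<^sup>2) \<le> 1 * (norm z)\<^sup>2"
    by (simp add: s_def a_def)
qed

lemma transfer_expansion:
  fixes tE :: "'h::complex_hilbert \<Rightarrow> 'e::complex_hilbert \<Rightarrow> 'he::complex_hilbert"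
    and tK :: "'h \<Rightarrow> 'k::complex_hilbert \<Rightarrow> 'hk::complex_hilbert"
    and V :: "'n::countable \<Rightarrow> ('k \<Rightarrow>\<^sub>L 'k)"
  assumes tE: "hilbert_tensor tE" and tK: "hilbert_tensor tK"
    and A: "A \<in> bounded_ops" "norm A < 1"
    and W: "W \<in> bounded_ops" "\<And>x. norm (blinfun_apply W x) = norm x"
    and V: "\<And>i. V i \<in> bounded_ops" and V_bound: "column_bound 1 UNIV (\<lambda>i. adj (V i))"
    and X: "X \<in> row_ball"
  defines "\<Psi> \<equiv> (fractional_transform (tensor_op tE tE id_blinfun A) \<circ> cayley_transform)
    (isometric_transfer tE tK V W) X"
  shows "\<exists>Y. (\<forall>k. strong_has_sum (\<lambda>\<alpha>. tensor_op tE tE (word_op X \<alpha>) (transfer_coeff A V W \<alpha>))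
      {\<alpha>. length \<alpha> = k} (Y k)) \<and> Y sums \<Psi>"
    and "norm \<Psi> \<le> 1"
proof -
  let ?EE = "tensor_op tE tE id_blinfun" and ?EK = "tensor_op tE tK id_blinfun"
    and ?KE = "tensor_op tK tE id_blinfun" and ?KK = "tensor_op tK tK id_blinfun"
  note ops = tensor_op_bounded_ops[OF tE tE] tensor_op_bounded_ops[OF tE tK]
    tensor_op_bounded_ops[OF tK tE] tensor_op_bounded_ops[OF tK tK]
  have X_ops: "X i \<in> bounded_ops" for i
    using X by (rule row_ball_bounded_ops)
  obtain c where c: "0 \<le> c" "c < 1" and X_bound: "column_bound c UNIV (\<lambda>i. adj (X i))"
    using X by (rule row_ball_column_bound)
  obtain T where T: "T \<in> bounded_ops" "norm T \<le> sqrt c"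
    and sum_T: "strong_has_sum (\<lambda>i. tensor_op tK tK (X i) (adj (V i))) UNIV T"
    by (rule strong_has_sum_tensor[OF tK _ _ X_bound V_bound c(1)]) (auto simp: X_ops V)
  have T1: "norm T < 1"
    using T(2) c by (meson le_less_trans real_sqrt_lt_1_iff)
  have A': "adj A \<in> bounded_ops" "norm (adj A) < 1"
    using A by (simp_all add: norm_adj)
  note D = defect_op_bounded_ops[OF A] defect_op_bounded_ops[OF A']
  have M: "feedback W A \<in> bounded_ops"
    by (rule feedback_bounded_ops[OF W(1) A(1)])
  have WW: "adj W o\<^sub>L W = id_blinfun"
    by (rule isometry_adj_compose[OF W])
  interpret small: isometric_colligation W 0 A
    by unfold_locales (use W WW A in auto)
  interpret big: isometric_colligation "?EK W" T "?EE A"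
  proof
    show "adj (?EK W) o\<^sub>L ?EK W = id_blinfun"
      using W WW by (simp add: tensor_op_adj tE tK tensor_op_compose tensor_op_id)
    show "norm (?EE A) < 1"
      using norm_tensor_op_id_le[OF tE tE A(1)] A(2) by simp
  qed (use T T1 A W ops in auto)
  have g: "isometric_transfer tE tK V W X
      = adj (?EK W) o\<^sub>L (2 *\<^sub>R op_inv (id_blinfun - T) - id_blinfun) o\<^sub>L ?EK W"
    using W by (simp add: isometric_transfer_def strong_sum_eq[OF sum_T] tensor_op_adj tE tK)
  obtain N where N: "N \<in> bounded_ops" "op_power (feedback (?EK W) (?EE A) o\<^sub>L T) sums N"
    and \<Psi>: "\<Psi> = ?EE A - (defect_op (adj (?EE A)) o\<^sub>L adj (?EK W) o\<^sub>L T o\<^sub>L N o\<^sub>L ?EK W o\<^sub>L defect_op (?EE A))"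
    and contr: "norm \<Psi> \<le> 1"
    unfolding \<Psi>_def by (rule big.fractional_cayley_resolvent[of "isometric_transfer tE tK V W" X, OF g])
  show "norm \<Psi> \<le> 1"
    by (rule contr)
  define B where "B i = feedback W A o\<^sub>L adj (V i)" for i
  have B: "B i \<in> bounded_ops" for i
    using M V by (auto simp: B_def)
  have B_bound: "column_bound 1 UNIV B"
    unfolding B_def using A
    by (intro column_bound_compose_left V_bound small.norm_feedback_le) simp_all
  have feedback_EK: "feedback (?EK W) (?EE A) = ?KK (feedback W A)"
    unfolding feedback_def using A W
    by (simp add: tensor_op_adj tE tK tensor_op_compose tensor_op_add_right tensor_op_diff_right
        tensor_op_id bounded_ops_compose bounded_ops_diff)
  have "strong_has_sum (\<lambda>i. ?KK (feedback W A) o\<^sub>L tensor_op tK tK (X i) (adj (V i)) o\<^sub>L id_blinfun)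
      UNIV (?KK (feedback W A) o\<^sub>L T o\<^sub>L id_blinfun)"
    by (rule strong_has_sum_compose[OF sum_T])
  then have sum_B: "strong_has_sum (\<lambda>i. tensor_op tK tK (X i) (B i)) UNIV (feedback (?EK W) (?EE A) o\<^sub>L T)"
    unfolding feedback_EK B_def using M V X_ops by (simp add: tensor_op_compose tK)
  define P where "P = - (defect_op (adj A) o\<^sub>L adj W)"
  define Q where "Q = W o\<^sub>L defect_op A"
  have PQ: "P \<in> bounded_ops" "Q \<in> bounded_ops"
    using D W by (auto simp: P_def Q_def)
  define Y where "Y k = (case k of 0 \<Rightarrow> ?EE A
    | Suc j \<Rightarrow> ?KE P o\<^sub>L (T o\<^sub>L op_power (feedback (?EK W) (?EE A) o\<^sub>L T) j) o\<^sub>L ?EK Q)" for k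
  have "strong_has_sum (\<lambda>\<alpha>. tensor_op tE tE (word_op X \<alpha>) (transfer_coeff A V W \<alpha>)) {\<alpha>. length \<alpha> = k} (Y k)"
    for k
  proof (cases k)
    case 0
    have "((\<lambda>\<alpha>. tensor_op tE tE (word_op X \<alpha>) (transfer_coeff A V W \<alpha>) x) has_sum ?EE A x) {[]}" for x
      by (rule has_sum_finiteI) (simp_all add: transfer_coeff_def)
    then show ?thesis
      using 0 by (simp add: strong_has_sum_def Y_def)
  next
    case (Suc j)
    have "strong_has_sum (\<lambda>\<alpha>. tensor_op tK tK (word_op X \<alpha>) (adj (V (hd \<alpha>)) o\<^sub>L word_op B (tl \<alpha>)))
        {\<alpha>. length \<alpha> = Suc j} (T o\<^sub>L op_power (feedback (?EK W) (?EE A) o\<^sub>L T) j)"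
      by (rule strong_has_sum_tensor_words[OF tK X _ V_bound _ _ sum_T])
        (auto simp: V B word_op_bounded_ops column_bound_words[OF B_bound]
          intro!: strong_has_sum_tensor_power[OF tK X B B_bound sum_B])
    from strong_has_sum_compose[OF this, of "?KE P" "?EK Q"]
    have "strong_has_sum (\<lambda>\<alpha>. ?KE P o\<^sub>L tensor_op tK tK (word_op X \<alpha>) (adj (V (hd \<alpha>)) o\<^sub>L word_op B (tl \<alpha>)) o\<^sub>L ?EK Q)
        {\<alpha>. length \<alpha> = k} (Y k)"
      by (simp add: Suc Y_def)
    then show ?thesis
    proof (rule strong_has_sum_cong[THEN iffD1, rotated])
      fix \<alpha> :: "'n list"
      assume "\<alpha> \<in> {\<alpha>. length \<alpha> = k}"
      then have "\<alpha> \<noteq> []"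
        using Suc by auto
      then show "?KE P o\<^sub>L tensor_op tK tK (word_op X \<alpha>) (adj (V (hd \<alpha>)) o\<^sub>L word_op B (tl \<alpha>)) o\<^sub>L ?EK Q
          = tensor_op tE tE (word_op X \<alpha>) (transfer_coeff A V W \<alpha>)"
        by (simp add: transfer_coeff_def P_def[symmetric] Q_def[symmetric] B_def[abs_def, symmetric]
            tensor_op_compose tE tK PQ V B X_ops word_op_bounded_ops bounded_ops_compose)
    qed
  qed
  moreover have "Y sums \<Psi>"
  proof -
    have "(\<lambda>j. ?KE P o\<^sub>L (T o\<^sub>L op_power (feedback (?EK W) (?EE A) o\<^sub>L T) j) o\<^sub>L ?EK Q) sums (?KE P o\<^sub>L (T o\<^sub>L N) o\<^sub>L ?EK Q)"
      by (intro bounded_linear.sums[OF bounded_bilinear.bounded_linear_left[OF bounded_bilinear_blinfun_compose]]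
          bounded_linear.sums[OF bounded_bilinear.bounded_linear_right[OF bounded_bilinear_blinfun_compose]] N(2))
    then have "(\<lambda>j. Y (Suc j)) sums (?KE P o\<^sub>L (T o\<^sub>L N) o\<^sub>L ?EK Q)"
      by (simp add: Y_def)
    from sums_Suc[of Y, OF this] have "Y sums ((?KE P o\<^sub>L (T o\<^sub>L N) o\<^sub>L ?EK Q) + ?EE A)"
      by (simp add: Y_def)
    moreover have "(?KE P o\<^sub>L (T o\<^sub>L N) o\<^sub>L ?EK Q) + ?EE A = \<Psi>"
    proof -
      have "?KE P = - (defect_op (adj (?EE A)) o\<^sub>L adj (?EK W))"
        using A A' W D
        by (simp add: P_def tensor_op_minus_right tE tK bounded_ops_compose tensor_op_adj defect_op_tensor tensor_op_compose)
      moreover have "?EK Q = ?EK W o\<^sub>L defect_op (?EE A)"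
        using A W D by (simp add: Q_def tE tK defect_op_tensor tensor_op_compose)
      ultimately show ?thesis
        unfolding \<Psi> by (intro blinfun_eqI) (simp add: blinfun.bilinear_simps)
    qed
    ultimately show ?thesis
      by simp
  qed
  ultimately show "\<exists>Y. (\<forall>k. strong_has_sum (\<lambda>\<alpha>. tensor_op tE tE (word_op X \<alpha>) (transfer_coeff A V W \<alpha>))
      {\<alpha>. length \<alpha> = k} (Y k)) \<and> Y sums \<Psi>"
    by blast
qed

section \<open>Convolution over the free semigroup\<close>

text \<open>
  Multiplication of formal power series in noncommuting variables: the value at \<open>\<gamma>\<close> is the sum of
  \<open>K \<alpha> (f \<beta>)\<close> over all factorizations \<open>\<gamma> = \<alpha> @ \<beta>\<close>. The coefficients \<open>K \<alpha>\<close> are arbitrary maps, so that series of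
  operators can act on series of vectors as well as on series of operators.
\<close>

fun conv :: "('n list \<Rightarrow> 'v \<Rightarrow> 'u::comm_monoid_add) \<Rightarrow> ('n list \<Rightarrow> 'v) \<Rightarrow> 'n list \<Rightarrow> 'u"
  where "conv K f [] = K [] (f [])"
  | "conv K f (i # \<gamma>) = K [] (f (i # \<gamma>)) + conv (\<lambda>\<alpha>. K (i # \<alpha>)) f \<gamma>"

lemma conv_eq_sum: "conv K f \<gamma> = (\<Sum>k\<le>length \<gamma>. K (take k \<gamma>) (f (drop k \<gamma>)))"
proof (induction \<gamma> arbitrary: K)
  case (Cons i \<gamma>)
  then show ?case
    by (simp add: sum.atMost_Suc_shift del: sum.atMost_Suc)
qed simp

lemma conv_cong_suffix:
  assumes "\<And>\<alpha> \<beta>. \<gamma> = \<alpha> @ \<beta> \<Longrightarrow> f \<beta> = g \<beta>"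
  shows "conv K f \<gamma> = conv K g \<gamma>"
proof -
  have "f (drop k \<gamma>) = g (drop k \<gamma>)" for k
    by (rule assms[of "take k \<gamma>"]) simp
  then show ?thesis
    by (simp add: conv_eq_sum)
qed

lemma conv_cong_prefix:
  assumes "\<And>\<alpha>. length \<alpha> < length \<gamma> \<Longrightarrow> K \<alpha> = K' \<alpha>" and "f [] = 0" and "\<And>\<alpha>. K \<alpha> 0 = 0" "\<And>\<alpha>. K' \<alpha> 0 = 0"
  shows "conv K f \<gamma> = conv K' f \<gamma>"
  unfolding conv_eq_sum
proof (intro sum.cong refl)
  fix k
  assume "k \<in> {..length \<gamma>}"
  then show "K (take k \<gamma>) (f (drop k \<gamma>)) = K' (take k \<gamma>) (f (drop k \<gamma>))"
    using assms by (cases "k = length \<gamma>") simp_all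
qed

lemma conv_closed:
  assumes "\<And>\<beta>. f \<beta> \<in> B" and "\<And>\<alpha> x. x \<in> B \<Longrightarrow> K \<alpha> x \<in> B'" and "\<And>x y. x \<in> B' \<Longrightarrow> y \<in> B' \<Longrightarrow> x + y \<in> B'"
  shows "conv K f \<gamma> \<in> B'"
  using assms(2) by (induction \<gamma> arbitrary: K) (simp_all add: assms)

lemma conv_add_right:
  assumes "\<And>\<alpha> x y. K \<alpha> (x + y) = K \<alpha> x + K \<alpha> y"
  shows "conv K (\<lambda>\<beta>. f \<beta> + g \<beta>) \<gamma> = conv K f \<gamma> + conv K g \<gamma>"
  by (simp add: conv_eq_sum assms sum.distrib)

lemma conv_add_left: "conv (\<lambda>\<alpha> x. K \<alpha> x + K' \<alpha> x) f \<gamma> = conv K f \<gamma> + conv K' f \<gamma>"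
  by (simp add: conv_eq_sum sum.distrib)

lemma conv_map:
  assumes "\<And>x y. L (x + y) = L x + L y"
  shows "conv (\<lambda>\<alpha> x. L (K \<alpha> x)) f \<gamma> = L (conv K f \<gamma>)"
  by (induction \<gamma> arbitrary: K) (simp_all add: assms)

lemma conv_precompose: "conv (\<lambda>\<alpha> x. K \<alpha> (L x)) f \<gamma> = conv K (\<lambda>\<beta>. L (f \<beta>)) \<gamma>"
  by (simp add: conv_eq_sum)

lemma conv_assoc:
  assumes "\<And>\<alpha> x y. C \<alpha> (x + y) = C \<alpha> x + C \<alpha> y"
  shows "conv C (conv B h) \<gamma> = conv (\<lambda>\<alpha> x. conv C (\<lambda>\<beta>. B \<beta> x) \<alpha>) h \<gamma>"
  using assms
proof (induction \<gamma> arbitrary: C)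
  case (Cons i \<gamma>)
  have "conv C (conv B h) (i # \<gamma>) = C [] (B [] (h (i # \<gamma>)) + conv (\<lambda>\<alpha>. B (i # \<alpha>)) h \<gamma>)
      + conv (\<lambda>\<alpha>. C (i # \<alpha>)) (conv B h) \<gamma>"
    by simp
  also have "\<dots> = C [] (B [] (h (i # \<gamma>))) + C [] (conv (\<lambda>\<alpha>. B (i # \<alpha>)) h \<gamma>)
      + conv (\<lambda>\<alpha> x. conv (\<lambda>\<alpha>. C (i # \<alpha>)) (\<lambda>\<beta>. B \<beta> x) \<alpha>) h \<gamma>"
    using Cons.IH[of "\<lambda>\<alpha>. C (i # \<alpha>)"] Cons.prems by simp
  also have "C [] (conv (\<lambda>\<alpha>. B (i # \<alpha>)) h \<gamma>) = conv (\<lambda>\<alpha> x. C [] (B (i # \<alpha>) x)) h \<gamma>"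
    using Cons.prems by (rule conv_map[symmetric])
  finally show ?case
    by (simp add: add.assoc conv_add_left)
qed simp

lemma conv_snoc: "conv K f (\<alpha> @ [i]) = conv K (\<lambda>\<beta>. f (\<beta> @ [i])) \<alpha> + K (\<alpha> @ [i]) (f [])"
  by (induction \<alpha> arbitrary: K) (simp_all add: add.assoc)

text \<open>
  As \<open>K\<close> has no constant term, the equation determines \<open>C \<gamma>\<close> from the values of \<open>C\<close> at proper suffixes of \<open>\<gamma>\<close>. The set
  \<open>B\<close> carries along an invariant of the solution.
\<close>

lemma conv_equation_solvable:
  fixes K :: "'n list \<Rightarrow> 'v \<Rightarrow> 'v::ab_group_add"
  assumes K0: "\<And>x. K [] x = 0" and Z: "\<And>\<gamma>. Z \<gamma> \<in> B" and K: "\<And>\<alpha> x. x \<in> B \<Longrightarrow> K \<alpha> x \<in> B"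
    and B: "\<And>x y. x \<in> B \<Longrightarrow> y \<in> B \<Longrightarrow> x + y \<in> B" "\<And>x y. x \<in> B \<Longrightarrow> y \<in> B \<Longrightarrow> x - y \<in> B"
  obtains C where "\<And>\<gamma>. C \<gamma> \<in> B" and "\<And>\<gamma>. C \<gamma> + conv K C \<gamma> = Z \<gamma>"
proof -
  \<comment> \<open>\<open>hist \<gamma>\<close> is a table that is correct at all suffixes of \<open>\<gamma>\<close>; this makes the recursion primitive.\<close>
  define hist :: "'n list \<Rightarrow> 'n list \<Rightarrow> 'v" where
    "hist = rec_list (\<lambda>_. Z []) (\<lambda>i \<gamma> h. h (i # \<gamma> := Z (i # \<gamma>) - conv (\<lambda>\<alpha>. K (i # \<alpha>)) h \<gamma>))"
  have Nil: "hist [] = (\<lambda>_. Z [])"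
    and Cons: "\<And>i \<gamma>. hist (i # \<gamma>) = (hist \<gamma>) (i # \<gamma> := Z (i # \<gamma>) - conv (\<lambda>\<alpha>. K (i # \<alpha>)) (hist \<gamma>) \<gamma>)"
    by (simp_all add: hist_def)
  have hist_B: "hist \<gamma> \<beta> \<in> B" for \<gamma> \<beta>
  proof (induction \<gamma> arbitrary: \<beta>)
    case (Cons i \<gamma>)
    then have "conv (\<lambda>\<alpha>. K (i # \<alpha>)) (hist \<gamma>) \<gamma> \<in> B"
      by (intro conv_closed[where B = B]) (simp_all add: K B)
    then show ?case
      using Cons by (simp add: \<open>\<And>i \<gamma>. hist (i # \<gamma>) = _ i \<gamma>\<close> Z B)
  qed (simp add: Nil Z)
  have hist_suffix: "hist (\<alpha> @ \<beta>) \<beta> = hist \<beta> \<beta>" for \<alpha> \<beta>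
  proof (induction \<alpha>)
    case (Cons i \<alpha>)
    have "i # \<alpha> @ \<beta> \<noteq> \<beta>"
      by (metis append_Cons append_self_conv2 list.distinct(1))
    with Cons show ?case
      using \<open>\<And>i \<gamma>. hist (i # \<gamma>) = _ i \<gamma>\<close> by simp
  qed simp
  show thesis
  proof (rule that)
    show "hist \<gamma> \<gamma> \<in> B" for \<gamma>
      by (rule hist_B)
    show "hist \<gamma> \<gamma> + conv K (\<lambda>\<gamma>. hist \<gamma> \<gamma>) \<gamma> = Z \<gamma>" for \<gamma>
    proof (cases \<gamma>)
      case Nil
      then show ?thesis
        by (simp add: \<open>hist [] = (\<lambda>_. Z [])\<close> K0)
    next
      case (Cons i \<delta>)
      have "conv (\<lambda>\<alpha>. K (i # \<alpha>)) (hist \<delta>) \<delta> = conv (\<lambda>\<alpha>. K (i # \<alpha>)) (\<lambda>\<gamma>. hist \<gamma> \<gamma>) \<delta>"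
        by (rule conv_cong_suffix) (simp add: hist_suffix)
      then show ?thesis
        using Cons \<open>\<And>i \<gamma>. hist (i # \<gamma>) = _ i \<gamma>\<close> by (simp add: K0)
    qed
  qed
qed

definition delta :: "'n list \<Rightarrow> 'v::zero \<Rightarrow> 'n list \<Rightarrow> 'v"
  where "delta \<beta> y = (\<lambda>\<gamma>. if \<gamma> = \<beta> then y else 0)"

lemma conv_zero:
  assumes "\<And>\<alpha>. K \<alpha> 0 = 0"
  shows "conv K (\<lambda>_. 0) \<gamma> = 0"
  by (simp add: conv_eq_sum assms)

lemma conv_delta_Nil:
  assumes "\<And>\<alpha>. K \<alpha> 0 = 0"
  shows "conv K (delta [] y) \<gamma> = K \<gamma> y"
proof (cases \<gamma> rule: rev_cases)
  case (snoc \<delta> i)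
  have "(\<lambda>\<beta>. delta [] y (\<beta> @ [i])) = (\<lambda>_. 0)"
    by (simp add: delta_def)
  then show ?thesis
    unfolding snoc conv_snoc by (simp add: conv_zero assms) (simp add: delta_def)
qed (simp add: delta_def)

lemma conv_delta_snoc:
  assumes "\<And>\<alpha>. K \<alpha> 0 = 0"
  shows "conv K (delta (\<beta> @ [j]) y) (\<gamma> @ [i]) = (if i = j then conv K (delta \<beta> y) \<gamma> else 0)"
proof -
  have "(\<lambda>\<delta>. delta (\<beta> @ [j]) y (\<delta> @ [i])) = (if i = j then delta \<beta> y else (\<lambda>_. 0))"
    by (auto simp: delta_def)
  moreover have "delta (\<beta> @ [j]) y [] = 0"
    by (simp add: delta_def)
  ultimately show ?thesis
    by (simp add: conv_snoc assms conv_zero)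
qed

section \<open>Coefficients of contractive free holomorphic functions\<close>

text \<open>
  The value of a convolution at \<open>\<gamma>\<close> depends only on the suffixes of \<open>\<gamma>\<close>, so convolutions can be restricted to such
  sets of words. Finite sets of this kind replace a truncation by length, which would leave infinitely many words
  over an infinite alphabet.
\<close>

definition suffix_closed :: "'n list set \<Rightarrow> bool"
  where "suffix_closed \<Gamma> \<longleftrightarrow> (\<forall>\<alpha> \<beta>. \<alpha> @ \<beta> \<in> \<Gamma> \<longrightarrow> \<beta> \<in> \<Gamma>)"

lemma suffix_closure:
  assumes "finite S"
  obtains \<Gamma> :: "'n list set" where "finite \<Gamma>" and "suffix_closed \<Gamma>" and "S \<subseteq> \<Gamma>"
proof
  let ?\<Gamma> = "\<Union>\<alpha>\<in>S. (\<lambda>k. drop k \<alpha>) ` {..length \<alpha>}"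
  show "finite ?\<Gamma>"
    using assms by auto
  show "suffix_closed ?\<Gamma>"
    unfolding suffix_closed_def
  proof (intro allI impI)
    fix \<alpha> \<beta>
    assume "\<alpha> @ \<beta> \<in> ?\<Gamma>"
    then obtain \<gamma> k where "\<gamma> \<in> S" "k \<le> length \<gamma>" and eq: "\<alpha> @ \<beta> = drop k \<gamma>"
      by auto
    have "\<beta> = drop (length \<alpha>) (drop k \<gamma>)"
      by (simp flip: eq)
    moreover have "length \<alpha> + k \<le> length \<gamma>"
      using arg_cong[OF eq, of length] \<open>k \<le> length \<gamma>\<close> by simp
    ultimately show "\<beta> \<in> ?\<Gamma>"
      using \<open>\<gamma> \<in> S\<close> by (auto intro!: bexI[of _ \<gamma>] image_eqI[of _ _ "length \<alpha> + k"] simp: add.commute)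
  qed
  show "S \<subseteq> ?\<Gamma>"
    by (force intro!: image_eqI[of _ _ 0])
qed

definition rank_one :: "'b::complex_hilbert \<Rightarrow> 'a::complex_hilbert \<Rightarrow> ('a \<Rightarrow>\<^sub>L 'b)"
  where "rank_one a b = Blinfun (\<lambda>x. cinner x b *\<^sub>C a)"

lemma rank_one_apply [simp]: "blinfun_apply (rank_one a b) x = cinner x b *\<^sub>C a"
  and rank_one_bounded_ops [simp, intro]: "rank_one a b \<in> bounded_ops"
proof -
  have bound: "norm (cinner x b *\<^sub>C a) \<le> (norm a * norm b) * norm x" for x
    using mult_right_mono[OF norm_cinner_le[of x b] norm_ge_zero[of a]] by (simp add: norm_scaleC mult_ac)
  have add: "cinner (x + y) b *\<^sub>C a = cinner x b *\<^sub>C a + cinner y b *\<^sub>C a" for x y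
    by (simp add: cinner_add_left scaleC_add_left)
  have scale: "cinner (c *\<^sub>C x) b *\<^sub>C a = c *\<^sub>C cinner x b *\<^sub>C a" for c x
    by (simp add: cinner_scaleC_left scaleC_scaleC)
  show "blinfun_apply (rank_one a b) x = cinner x b *\<^sub>C a" and "rank_one a b \<in> bounded_ops"
    unfolding rank_one_def using blinfun_in_bounded_opsI[of "\<lambda>x. cinner x b *\<^sub>C a", OF add scale bound]
    by simp_all
qed

lemma adj_rank_one: "adj (rank_one a b) = rank_one b a"
proof (rule adj_unique)
  show "cinner (rank_one a b x) y = cinner x (rank_one b a y)" for x y
    by (simp add: cinner_scaleC_left cinner_scaleC_right) (metis cinner_commute)
qed simp

lemma adj_sum:
  assumes "\<And>i. i \<in> I \<Longrightarrow> f i \<in> bounded_ops"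
  shows "adj (\<Sum>i\<in>I. f i) = (\<Sum>i\<in>I. adj (f i))"
  using assms by (induction I rule: infinite_finite_induct) (simp_all add: adj_add bounded_ops_sum)

lemma norm_sum_orthonormal:
  assumes "finite I" and "\<And>i j. i \<in> I \<Longrightarrow> j \<in> I \<Longrightarrow> cinner (e i) (e j) = (if i = j then 1 else 0)"
  shows "(norm (\<Sum>i\<in>I. c i *\<^sub>C e i))\<^sup>2 = (\<Sum>i\<in>I. (cmod (c i))\<^sup>2)"
proof -
  have "cinner (\<Sum>i\<in>I. c i *\<^sub>C e i) (\<Sum>i\<in>I. c i *\<^sub>C e i) = (\<Sum>i\<in>I. \<Sum>j\<in>I. if i = j then c i * cnj (c i) else 0)"
    unfolding cinner.sum_left unfolding cinner.sum_right
    by (intro sum.cong refl) (simp add: cinner_scaleC_left cinner_scaleC_right assms(2))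
  also have "\<dots> = (\<Sum>i\<in>I. complex_of_real ((cmod (c i))\<^sup>2))"
    using assms(1) by (simp only: complex_norm_square) simp
  finally have "Re (cinner (\<Sum>i\<in>I. c i *\<^sub>C e i) (\<Sum>i\<in>I. c i *\<^sub>C e i)) = Re (\<Sum>i\<in>I. complex_of_real ((cmod (c i))\<^sup>2))"
    by (rule arg_cong)
  then show ?thesis
    by simp
qed

lemma bessel_inequality:
  assumes I: "finite I" and e: "\<And>i j. i \<in> I \<Longrightarrow> j \<in> I \<Longrightarrow> cinner (e i) (e j) = (if i = j then 1 else 0)"
  shows "(\<Sum>i\<in>I. (cmod (cinner z (e i)))\<^sup>2) \<le> (norm z)\<^sup>2"
proof -
  define p where "p = (\<Sum>i\<in>I. cinner z (e i) *\<^sub>C e i)"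
  have "cinner z p = (\<Sum>i\<in>I. complex_of_real ((cmod (cinner z (e i)))\<^sup>2))"
    unfolding p_def cinner.sum_right by (simp only: cinner_scaleC_right complex_norm_square) (simp add: mult.commute)
  then have "Re (cinner z p) = (\<Sum>i\<in>I. (cmod (cinner z (e i)))\<^sup>2)"
    by simp
  moreover have "(norm p)\<^sup>2 = (\<Sum>i\<in>I. (cmod (cinner z (e i)))\<^sup>2)"
    unfolding p_def by (rule norm_sum_orthonormal[OF I e])
  ultimately show ?thesis
    using zero_le_power2[of "norm (z - p)"] unfolding norm_diff_sqr by linarith
qed

lemma orthonormal_words_exist:
  assumes "infinite_dimensional TYPE('h::complex_hilbert)"
  obtains e :: "'n::countable list \<Rightarrow> 'h::complex_hilbert" where "\<And>\<alpha> \<beta>. cinner (e \<alpha>) (e \<beta>) = (if \<alpha> = \<beta> then 1 else 0)"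
proof -
  obtain v :: "nat \<Rightarrow> 'h" where v: "\<And>i j. cinner (v i) (v j) = (if i = j then 1 else 0)"
  proof (rule positive_kernel_realization[OF assms])
    fix S :: "nat set" and c :: "nat \<Rightarrow> complex"
    assume "finite S"
    then have "(\<Sum>i\<in>S. \<Sum>j\<in>S. c i * cnj (c j) * (if i = j then 1 else 0)) = (\<Sum>i\<in>S. c i * cnj (c i))"
      by (intro sum.cong refl) (simp add: if_distrib[of "\<lambda>x. _ * x"] cong: if_cong)
    then show "0 \<le> Re (\<Sum>i\<in>S. \<Sum>j\<in>S. c i * cnj (c j) * (if i = j then 1 else 0))"
      by (simp add: sum_nonneg)
  qed auto
  show thesis
    by (rule that[of "\<lambda>\<alpha>. v (to_nat \<alpha>)"]) (simp add: v)
qed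

text \<open>
  A finite-rank model of the left creation operators on the full Fock space, scaled by \<open>r\<close>: the basis vector of \<open>\<gamma>\<close> goes to
  that of \<open>i # \<gamma>\<close>, as long as this word belongs to \<open>\<Gamma>\<close>. Being nilpotent, it turns every power
  series into a finite sum.
\<close>

locale truncated_shift =
  fixes \<Gamma> :: "'n::countable list set" and e :: "'n list \<Rightarrow> 'h::complex_hilbert" and r :: real
  assumes fin: "finite \<Gamma>" and closed: "suffix_closed \<Gamma>"
    and on: "\<And>\<alpha> \<beta>. cinner (e \<alpha>) (e \<beta>) = (if \<alpha> = \<beta> then 1 else 0)"
    and r: "0 < r" "r < 1"
begin

definition X :: "'n \<Rightarrow> 'h \<Rightarrow>\<^sub>L 'h"
  where "X i = (\<Sum>\<gamma>\<in>{\<gamma>. i # \<gamma> \<in> \<Gamma>}. r *\<^sub>R rank_one (e (i # \<gamma>)) (e \<gamma>))"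

lemma finite_tails: "finite {\<gamma>. i # \<gamma> \<in> \<Gamma>}"
  by (rule finite_surj[OF fin, of _ tl]) force

lemma X_ops: "X i \<in> bounded_ops"
  unfolding X_def by (intro bounded_ops_sum bounded_ops_scaleR) simp

lemma X_basis: "blinfun_apply (X i) (e \<gamma>) = (if i # \<gamma> \<in> \<Gamma> then r *\<^sub>R e (i # \<gamma>) else 0)"
proof -
  have "X i (e \<gamma>) = (\<Sum>\<delta>\<in>{\<gamma>. i # \<gamma> \<in> \<Gamma>}. if \<delta> = \<gamma> then r *\<^sub>R e (i # \<delta>) else 0)"
    unfolding X_def blinfun.sum_left by (intro sum.cong refl) (auto simp: blinfun.bilinear_simps on)
  then show ?thesis
    by (simp add: finite_tails)
qed

lemma word_op_X_basis:
  "blinfun_apply (word_op X \<alpha>) (e \<beta>) = (if \<alpha> = [] \<or> \<alpha> @ \<beta> \<in> \<Gamma> then r ^ length \<alpha> *\<^sub>R e (\<alpha> @ \<beta>) else 0)"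
proof (induction \<alpha>)
  case (Cons i \<alpha>)
  have "\<alpha> @ \<beta> \<in> \<Gamma>" if "i # \<alpha> @ \<beta> \<in> \<Gamma>"
    using closed that unfolding suffix_closed_def by (metis append_Cons append_Nil)
  then show ?case
    by (auto simp: Cons X_basis blinfun.bilinear_simps)
qed simp

lemma adj_X: "blinfun_apply (adj (X i)) z = (\<Sum>\<gamma>\<in>{\<gamma>. i # \<gamma> \<in> \<Gamma>}. (complex_of_real r * cinner z (e (i # \<gamma>))) *\<^sub>C e \<gamma>)"
  unfolding X_def
  by (subst adj_sum) (auto simp: adj_scaleR adj_rank_one blinfun.sum_left blinfun.bilinear_simps
      scaleR_scaleC scaleC_scaleC)

lemma column_bound_adj_X: "column_bound (r\<^sup>2) UNIV (\<lambda>i. adj (X i))"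
  unfolding column_bound_def
proof (intro allI impI)
  fix F :: "'n set" and z
  assume F: "finite F"
  let ?T = "\<lambda>i. {\<gamma>. i # \<gamma> \<in> \<Gamma>}"
  have "(norm (adj (X i) z))\<^sup>2 = r\<^sup>2 * (\<Sum>\<gamma>\<in>?T i. (cmod (cinner z (e (i # \<gamma>))))\<^sup>2)" for i
    unfolding adj_X
    by (subst norm_sum_orthonormal) (simp_all add: finite_tails on norm_mult power_mult_distrib sum_distrib_left)
  then have "(\<Sum>i\<in>F. (norm (adj (X i) z))\<^sup>2) = r\<^sup>2 * (\<Sum>i\<in>F. \<Sum>\<gamma>\<in>?T i. (cmod (cinner z (e (i # \<gamma>))))\<^sup>2)"
    by (simp add: sum_distrib_left)
  also have "(\<Sum>i\<in>F. \<Sum>\<gamma>\<in>?T i. (cmod (cinner z (e (i # \<gamma>))))\<^sup>2)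
      = (\<Sum>p\<in>Sigma F ?T. (cmod (cinner z (e (fst p # snd p))))\<^sup>2)"
    using F by (simp add: sum.Sigma finite_tails split_def)
  also have "\<dots> = (\<Sum>\<gamma>\<in>(\<lambda>p. fst p # snd p) ` Sigma F ?T. (cmod (cinner z (e \<gamma>)))\<^sup>2)"
    by (subst sum.reindex) (auto simp: inj_on_def prod_eq_iff)
  also have "\<dots> \<le> (\<Sum>\<gamma>\<in>\<Gamma>. (cmod (cinner z (e \<gamma>)))\<^sup>2)"
    by (rule sum_mono2) (auto simp: fin)
  also have "\<dots> \<le> (norm z)\<^sup>2"
    by (rule bessel_inequality[OF fin on])
  finally show "(\<Sum>i\<in>F. (norm (adj (X i) z))\<^sup>2) \<le> r\<^sup>2 * (norm z)\<^sup>2"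
    using r by (simp add: mult_left_mono)
qed

lemma X_in_row_ball: "X \<in> row_ball"
proof -
  define I where "I = hd ` \<Gamma>"
  have "finite I"
    using fin by (simp add: I_def)
  have X_0: "X i = 0" if "i \<notin> I" for i
    using that unfolding X_def I_def by (intro sum.neutral) (force simp: image_iff)
  define T where "T = (\<Sum>i\<in>I. X i o\<^sub>L adj (X i))"
  have "((\<lambda>i. (X i o\<^sub>L adj (X i)) z) has_sum T z) UNIV" for z
  proof -
    have "((\<lambda>i. (X i o\<^sub>L adj (X i)) z) has_sum T z) I"
      unfolding T_def blinfun.sum_left by (rule has_sum_finite[OF \<open>finite I\<close>])
    then show ?thesis
      by (rule has_sum_cong_neutral[THEN iffD1, rotated 3]) (auto simp: X_0)
  qed
  then have sum: "strong_has_sum (\<lambda>i. X i o\<^sub>L adj (X i)) UNIV T"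
    by (simp add: strong_has_sum_def)
  have "norm T \<le> r\<^sup>2"
  proof (rule norm_blinfun_bound)
    fix z
    have "(norm (\<Sum>i\<in>I. X i (adj (X i) z)))\<^sup>2 \<le> r\<^sup>2 * (\<Sum>i\<in>I. (norm (adj (X i) z))\<^sup>2)"
      by (rule norm_row_column_sum_le[of UNIV, OF X_ops column_bound_adj_X \<open>finite I\<close>]) simp_all
    also have "\<dots> \<le> r\<^sup>2 * (r\<^sup>2 * (norm z)\<^sup>2)"
      by (intro mult_left_mono column_boundD[OF column_bound_adj_X \<open>finite I\<close>]) simp_all
    finally have "(norm (T z))\<^sup>2 \<le> (r\<^sup>2 * norm z)\<^sup>2"
      by (simp add: T_def blinfun.sum_left power_mult_distrib power2_eq_square mult_ac)
    then show "norm (T z) \<le> r\<^sup>2 * norm z"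
      by (rule power2_le_imp_le) simp
  qed simp
  also have "\<dots> < 1"
    using r by (simp add: power_less_one_iff)
  finally have "row_norm X < 1"
    by (simp add: row_norm_def strong_sum_eq[OF sum])
  then show ?thesis
    using X_ops sum by (auto simp: row_ball_def)
qed

text \<open>
  In the matrix of \<open>F X\<close> with respect to the orthonormal vectors, the words contributing to the row \<open>\<gamma>\<close> are the
  prefixes of \<open>\<gamma>\<close>, one for each length; so the matrix is that of the convolution by \<open>r\<^sup>k A \<alpha>\<close>, where \<open>k\<close> is the
  length of \<open>\<alpha>\<close>.
\<close>

lemma cinner_value_at_X:
  fixes tE :: "'h \<Rightarrow> 'e::complex_hilbert \<Rightarrow> 'he::complex_hilbert"
  assumes tE: "hilbert_tensor tE" and A: "\<And>\<alpha>. A \<alpha> \<in> bounded_ops"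
    and Y: "\<And>k. strong_has_sum (\<lambda>\<alpha>. tensor_op tE tE (word_op X \<alpha>) (A \<alpha>)) {\<alpha>. length \<alpha> = k} (Y k)"
    and FX: "Y sums FX" and \<gamma>: "\<gamma> \<in> \<Gamma>"
  shows "cinner (blinfun_apply FX (\<Sum>\<beta>\<in>\<Gamma>. tE (e \<beta>) (u \<beta>))) (tE (e \<gamma>) y)
    = cinner (conv (\<lambda>\<alpha> x. r ^ length \<alpha> *\<^sub>R blinfun_apply (A \<alpha>) x) u \<gamma>) y"
proof -
  interpret hilbert_tensor tE by fact
  define w where "w = (\<Sum>\<beta>\<in>\<Gamma>. tE (e \<beta>) (u \<beta>))"
  define a where "a k = r ^ k *\<^sub>R A (take k \<gamma>) (u (drop k \<gamma>))" for k
  have suffix: "drop k \<gamma> \<in> \<Gamma>" for k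
    using closed \<gamma> unfolding suffix_closed_def by (metis append_take_drop_id)
  have coef: "cinner (tensor_op tE tE (word_op X \<alpha>) (A \<alpha>) w) (tE (e \<gamma>) y)
      = (if \<alpha> = take (length \<alpha>) \<gamma> then cinner (a (length \<alpha>)) y else 0)" for \<alpha>
  proof -
    have "cinner (tensor_op tE tE (word_op X \<alpha>) (A \<alpha>) w) (tE (e \<gamma>) y)
        = (\<Sum>\<beta>\<in>\<Gamma>. cinner (word_op X \<alpha> (e \<beta>)) (e \<gamma>) * cinner (A \<alpha> (u \<beta>)) y)"
      unfolding w_def blinfun.sum_right cinner.sum_left
      by (simp add: tensor_op_apply tE A word_op_bounded_ops X_ops cinner_tensor)
    also have "\<dots> = (\<Sum>\<beta>\<in>\<Gamma>. if \<beta> = drop (length \<alpha>) \<gamma> then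
        (if \<alpha> = take (length \<alpha>) \<gamma> then cinner (a (length \<alpha>)) y else 0) else 0)"
    proof (intro sum.cong refl)
      fix \<beta>
      assume "\<beta> \<in> \<Gamma>"
      have "\<alpha> @ \<beta> = \<gamma> \<longleftrightarrow> \<alpha> = take (length \<alpha>) \<gamma> \<and> \<beta> = drop (length \<alpha>) \<gamma>"
        by (metis append_eq_conv_conj)
      then show "cinner (word_op X \<alpha> (e \<beta>)) (e \<gamma>) * cinner (A \<alpha> (u \<beta>)) y
        = (if \<beta> = drop (length \<alpha>) \<gamma> then
            (if \<alpha> = take (length \<alpha>) \<gamma> then cinner (a (length \<alpha>)) y else 0) else 0)"
        using \<gamma> by (auto simp: word_op_X_basis on a_def cinner.scaleR_left)
    qed
    also have "\<dots> = (if \<alpha> = take (length \<alpha>) \<gamma> then cinner (a (length \<alpha>)) y else 0)"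
      using fin suffix by simp
    finally show ?thesis .
  qed
  have Yk: "cinner (Y k w) (tE (e \<gamma>) y) = (if k \<le> length \<gamma> then cinner (a k) y else 0)" for k
  proof -
    have "((\<lambda>\<alpha>. tensor_op tE tE (word_op X \<alpha>) (A \<alpha>) w) has_sum Y k w) {\<alpha>. length \<alpha> = k}"
      using Y[of k] by (simp add: strong_has_sum_def)
    from has_sum_bounded_linear[OF cinner.bounded_linear_left this, of "tE (e \<gamma>) y"]
    have "((\<lambda>\<alpha>. if \<alpha> = take (length \<alpha>) \<gamma> then cinner (a (length \<alpha>)) y else 0)
        has_sum cinner (Y k w) (tE (e \<gamma>) y)) {\<alpha>. length \<alpha> = k}"
      by (simp add: o_def coef)
    moreover have "((\<lambda>\<alpha>. if \<alpha> = take (length \<alpha>) \<gamma> then cinner (a (length \<alpha>)) y else 0)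
        has_sum (if k \<le> length \<gamma> then cinner (a k) y else 0)) {\<alpha>. length \<alpha> = k}"
    proof (cases "k \<le> length \<gamma>")
      case True
      have "((\<lambda>\<alpha>. if \<alpha> = take (length \<alpha>) \<gamma> then cinner (a (length \<alpha>)) y else 0)
          has_sum cinner (a k) y) {take k \<gamma>}"
        using True by (intro has_sum_finiteI) (simp_all add: min_def)
      also have "?this \<longleftrightarrow> ((\<lambda>\<alpha>. if \<alpha> = take (length \<alpha>) \<gamma> then cinner (a (length \<alpha>)) y else 0)
          has_sum cinner (a k) y) {\<alpha>. length \<alpha> = k}"
        by (rule has_sum_cong_neutral) (use True in auto)
      finally show ?thesis
        using True by simp
    next
      case False
      then have "\<alpha> \<noteq> take k \<gamma>" if "length \<alpha> = k" for \<alpha>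
        using that by (metis length_take min.cobounded1)
      then have "((\<lambda>\<alpha>. if \<alpha> = take (length \<alpha>) \<gamma> then cinner (a (length \<alpha>)) y else 0)
          has_sum 0) {\<alpha>. length \<alpha> = k}"
        by (intro has_sum_0) auto
      then show ?thesis
        using False by simp
    qed
    ultimately show ?thesis
      by (rule has_sum_unique)
  qed
  have "(\<lambda>k. cinner (Y k w) (tE (e \<gamma>) y)) sums cinner (FX w) (tE (e \<gamma>) y)"
    by (intro bounded_linear.sums[OF cinner.bounded_linear_left] bounded_linear.sums[OF blinfun.bounded_linear_left] FX)
  moreover have "(\<lambda>k. cinner (Y k w) (tE (e \<gamma>) y)) sums (\<Sum>k\<in>{..length \<gamma>}. cinner (Y k w) (tE (e \<gamma>) y))"
    by (rule sums_finite) (auto simp: Yk)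
  ultimately have "cinner (FX w) (tE (e \<gamma>) y) = (\<Sum>k\<le>length \<gamma>. cinner (Y k w) (tE (e \<gamma>) y))"
    by (rule sums_unique2)
  also have "\<dots> = cinner (\<Sum>k\<le>length \<gamma>. a k) y"
    unfolding cinner.sum_left by (intro sum.cong refl) (simp add: Yk)
  also have "(\<Sum>k\<le>length \<gamma>. a k) = conv (\<lambda>\<alpha> x. r ^ length \<alpha> *\<^sub>R A \<alpha> x) u \<gamma>"
    unfolding conv_eq_sum a_def by (intro sum.cong refl) (simp add: min_def)
  finally show ?thesis
    by (simp add: w_def)
qed

end

text \<open>
  The truncated shift with \<open>r < 1\<close> lies in the ball, and the inequality for \<open>r = 1\<close> follows by continuity.
\<close>

lemma coefficients_contractive:
  fixes tE :: "'h::complex_hilbert \<Rightarrow> 'e::complex_hilbert \<Rightarrow> 'he::complex_hilbert"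
    and F :: "('n::countable \<Rightarrow> 'h \<Rightarrow>\<^sub>L 'h) \<Rightarrow> ('he \<Rightarrow>\<^sub>L 'he)"
  assumes inf: "infinite_dimensional TYPE('h)" and tE: "hilbert_tensor tE"
    and A: "\<And>\<alpha>. A \<alpha> \<in> bounded_ops"
    and F: "\<And>X. X \<in> row_ball \<Longrightarrow> \<exists>Y. (\<forall>k. strong_has_sum
      (\<lambda>\<alpha>. tensor_op tE tE (word_op X \<alpha>) (A \<alpha>)) {\<alpha>. length \<alpha> = k} (Y k)) \<and> Y sums F X"
    and F1: "\<And>X. X \<in> row_ball \<Longrightarrow> norm (F X) \<le> 1"
    and \<Gamma>: "finite \<Gamma>" "suffix_closed \<Gamma>"
  shows "(\<Sum>\<gamma>\<in>\<Gamma>. (norm (conv (\<lambda>\<alpha>. blinfun_apply (A \<alpha>)) u \<gamma>))\<^sup>2) \<le> (\<Sum>\<gamma>\<in>\<Gamma>. (norm (u \<gamma>))\<^sup>2)"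
proof -
  interpret hilbert_tensor tE by fact
  obtain e :: "'n list \<Rightarrow> 'h" where on: "\<And>\<alpha> \<beta>. cinner (e \<alpha>) (e \<beta>) = (if \<alpha> = \<beta> then 1 else 0)"
    using orthonormal_words_exist[OF inf] by blast
  define g where "g r = conv (\<lambda>\<alpha> x. r ^ length \<alpha> *\<^sub>R A \<alpha> x) u" for r :: real
  have le: "(\<Sum>\<gamma>\<in>\<Gamma>. (norm (g r \<gamma>))\<^sup>2) \<le> (\<Sum>\<gamma>\<in>\<Gamma>. (norm (u \<gamma>))\<^sup>2)" if r: "0 < r" "r < 1" for r
  proof -
    interpret truncated_shift \<Gamma> e r
      by unfold_locales (use \<Gamma> on r in auto)
    obtain Y where Y: "\<And>k. strong_has_sum (\<lambda>\<alpha>. tensor_op tE tE (word_op X \<alpha>) (A \<alpha>)) {\<alpha>. length \<alpha> = k} (Y k)"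
      "Y sums F X"
      using F[OF X_in_row_ball] by blast
    define w where "w = (\<Sum>\<beta>\<in>\<Gamma>. tE (e \<beta>) (u \<beta>))"
    define z where "z = (\<Sum>\<gamma>\<in>\<Gamma>. tE (e \<gamma>) (g r \<gamma>))"
    have w: "(norm w)\<^sup>2 = (\<Sum>\<gamma>\<in>\<Gamma>. (norm (u \<gamma>))\<^sup>2)" and z: "(norm z)\<^sup>2 = (\<Sum>\<gamma>\<in>\<Gamma>. (norm (g r \<gamma>))\<^sup>2)"
      unfolding w_def z_def by (intro norm_sum_tensor_orthonormal fin on)+
    have "cinner (F X w) z = (\<Sum>\<gamma>\<in>\<Gamma>. cinner (g r \<gamma>) (g r \<gamma>))"
      unfolding z_def cinner.sum_right w_def g_def
      by (intro sum.cong refl cinner_value_at_X[OF tE A Y])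
    from arg_cong[OF this, of Re] have "(norm z)\<^sup>2 = Re (cinner (F X w) z)"
      by (simp add: z)
    also have "\<dots> \<le> norm (F X w) * norm z"
      by (rule order_trans[OF complex_Re_le_cmod norm_cinner_le])
    also have "\<dots> \<le> norm w * norm z"
      using norm_blinfun[of "F X" w] mult_right_mono[OF F1[OF X_in_row_ball] norm_ge_zero[of w]]
      by (intro mult_right_mono) simp_all
    finally have "norm z \<le> norm w"
      by (cases "z = 0") (simp_all add: power2_eq_square)
    then have "(norm z)\<^sup>2 \<le> (norm w)\<^sup>2"
      by (intro power_mono) simp_all
    then show ?thesis
      by (simp add: w z)
  qed
  have "((\<lambda>r. \<Sum>\<gamma>\<in>\<Gamma>. (norm (g r \<gamma>))\<^sup>2) \<longlongrightarrow> (\<Sum>\<gamma>\<in>\<Gamma>. (norm (g 1 \<gamma>))\<^sup>2)) (at_left 1)"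
    unfolding g_def conv_eq_sum by (intro tendsto_intros)
  moreover have "eventually (\<lambda>r. (\<Sum>\<gamma>\<in>\<Gamma>. (norm (g r \<gamma>))\<^sup>2) \<le> (\<Sum>\<gamma>\<in>\<Gamma>. (norm (u \<gamma>))\<^sup>2)) (at_left 1)"
    using eventually_at_left_real[OF zero_less_one] by (rule eventually_mono) (simp add: le)
  ultimately have "(\<Sum>\<gamma>\<in>\<Gamma>. (norm (g 1 \<gamma>))\<^sup>2) \<le> (\<Sum>\<gamma>\<in>\<Gamma>. (norm (u \<gamma>))\<^sup>2)"
    by (rule tendsto_upperbound) simp
  then show ?thesis
    by (simp add: g_def)
qed

section \<open>The positive kernel of the Cayley transform\<close>

text \<open>
  A formal power series \<open>A\<close> of operators that acts contractively by convolution. In the locale the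
  fractional transform and the Cayley transform are inverted formally. With the notation of the introduction and
  formal series \<open>H\<close>, \<open>G\<close>: the symbol \<open>A\<close> is the fractional transform of \<open>H\<close>, and \<open>H\<close> is the Cayley transform of
  \<open>G = id + 2 C\<close>.
\<close>

locale contractive_symbol =
  fixes A :: "'n::countable list \<Rightarrow> ('e::complex_hilbert \<Rightarrow>\<^sub>L 'e)"
  assumes A_ops: "\<And>\<alpha>. A \<alpha> \<in> bounded_ops" and A1: "norm (A []) < 1"
    and contractive: "\<And>\<Gamma> u. finite \<Gamma> \<Longrightarrow> suffix_closed \<Gamma> \<Longrightarrow>
      (\<Sum>\<gamma>\<in>\<Gamma>. (norm (conv (\<lambda>\<alpha>. blinfun_apply (A \<alpha>)) u \<gamma>))\<^sup>2) \<le> (\<Sum>\<gamma>\<in>\<Gamma>. (norm (u \<gamma>))\<^sup>2)"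
begin

abbreviation "D \<equiv> defect_op (A [])"
abbreviation "Ds \<equiv> defect_op (adj (A []))"

text \<open>
  Eliminating \<open>H\<close> from \<open>Z = (id - H A0*)\<^sup>-\<^sup>1 H\<close> and \<open>C = (id - H)\<^sup>-\<^sup>1 H\<close> gives \<open>Z = C + Z b C\<close> for this \<open>b\<close>.
\<close>

definition "b = adj (A []) - id_blinfun"

text \<open>
  The formal series \<open>(id - H A0*)\<^sup>-\<^sup>1 H\<close>, read off from the definition of the fractional transform.
\<close>

definition "Z \<alpha> = (if \<alpha> = [] then 0 else - (op_inv Ds o\<^sub>L A \<alpha> o\<^sub>L op_inv D))"

lemma adj_A: "adj (A []) \<in> bounded_ops" "norm (adj (A [])) < 1"
  using A_ops A1 by (simp_all add: norm_adj)

lemma b_ops: "b \<in> bounded_ops"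
  using A_ops by (auto simp: b_def)

lemma op_inv_defect:
  assumes "B \<in> bounded_ops" "norm B < 1"
  shows "op_inv (defect_op B) \<in> bounded_ops"
    and "blinfun_apply (op_inv (defect_op B)) (blinfun_apply (defect_op B) x) = x"
    and "blinfun_apply (defect_op B) (blinfun_apply (op_inv (defect_op B)) x) = x"
proof -
  obtain E where E: "E \<in> bounded_ops" "E o\<^sub>L defect_op B = id_blinfun" "defect_op B o\<^sub>L E = id_blinfun"
    using assms by (rule defect_op_invertible)
  have "op_inv (defect_op B) = E"
    by (rule op_inv_eq) fact+
  with E(1) arg_cong[OF E(2), of "\<lambda>S. blinfun_apply S x"] arg_cong[OF E(3), of "\<lambda>S. blinfun_apply S x"]
  show "op_inv (defect_op B) \<in> bounded_ops" "op_inv (defect_op B) (defect_op B x) = x"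
    "defect_op B (op_inv (defect_op B) x) = x"
    by simp_all
qed

lemma Z_ops: "Z \<alpha> \<in> bounded_ops"
  unfolding Z_def using A_ops A1 adj_A
  by (auto intro!: bounded_ops_minus bounded_ops_compose op_inv_defect(1))

text \<open>
  The series \<open>(id - H)\<^sup>-\<^sup>1 H = (G - id) / 2\<close>, as the solution of \<open>C + Z b C = Z\<close>.
\<close>

definition "C = (SOME C. (\<forall>\<gamma>. C \<gamma> \<in> bounded_ops) \<and>
  (\<forall>\<gamma>. C \<gamma> + conv (\<lambda>\<alpha> T. Z \<alpha> o\<^sub>L (b o\<^sub>L T)) C \<gamma> = Z \<gamma>))"

lemma C: "C \<gamma> \<in> bounded_ops" "C \<gamma> + conv (\<lambda>\<alpha> T. Z \<alpha> o\<^sub>L (b o\<^sub>L T)) C \<gamma> = Z \<gamma>"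
proof -
  have "\<exists>C. (\<forall>\<gamma>. C \<gamma> \<in> bounded_ops) \<and> (\<forall>\<gamma>. C \<gamma> + conv (\<lambda>\<alpha> T. Z \<alpha> o\<^sub>L (b o\<^sub>L T)) C \<gamma> = Z \<gamma>)"
    by (rule conv_equation_solvable[of "\<lambda>\<alpha> T. Z \<alpha> o\<^sub>L (b o\<^sub>L T)" Z bounded_ops])
      (auto simp: Z_ops b_ops Z_def[of "[]"] intro!: bounded_ops_compose)
  from someI_ex[OF this] show "C \<gamma> \<in> bounded_ops" "C \<gamma> + conv (\<lambda>\<alpha> T. Z \<alpha> o\<^sub>L (b o\<^sub>L T)) C \<gamma> = Z \<gamma>"
    unfolding C_def by simp_all
qed

lemma C_Nil [simp]: "C [] = 0"
  using C(2)[of "[]"] by (simp add: Z_def)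

lemma Z_eq: "blinfun_apply (Z \<gamma>) x
  = blinfun_apply (C \<gamma>) x + conv (\<lambda>\<alpha> y. blinfun_apply (Z \<alpha>) (blinfun_apply b y)) (\<lambda>\<beta>. blinfun_apply (C \<beta>) x) \<gamma>"
proof -
  have "blinfun_apply (conv (\<lambda>\<alpha> T. Z \<alpha> o\<^sub>L (b o\<^sub>L T)) C \<gamma>) x
      = conv (\<lambda>\<alpha> y. Z \<alpha> (b y)) (\<lambda>\<beta>. C \<beta> x) \<gamma>"
    unfolding conv_eq_sum by (simp add: blinfun.sum_left)
  then show ?thesis
    using arg_cong[OF C(2), of "\<lambda>T. blinfun_apply T x" \<gamma>] by (simp add: blinfun.bilinear_simps)
qed

text \<open>
  If \<open>p\<close> solves \<open>(id - H) p = f\<close>, then \<open>q f = H p\<close> and \<open>p = f + q f\<close>.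
\<close>

definition "q f = conv (\<lambda>\<alpha>. blinfun_apply (C \<alpha>)) f"

lemma q_sum: "q (\<lambda>\<gamma>. \<Sum>s\<in>S. f s \<gamma>) \<gamma> = (\<Sum>s\<in>S. q (f s) \<gamma>)"
  unfolding q_def conv_eq_sum blinfun.sum_right by (rule sum.swap)

lemma q_scale: "q (\<lambda>\<gamma>. c *\<^sub>C f \<gamma>) \<gamma> = c *\<^sub>C q f \<gamma>"
  by (simp add: q_def conv_eq_sum bounded_opsD[OF C(1)] scaleC.sum_right)

text \<open>
  The left-hand side is the energy of \<open>H p\<close> and the right-hand side that of \<open>p\<close>, with \<open>p = f + q f\<close>: the
  inequality says that \<open>H\<close> is contractive, or equivalently that \<open>G\<close> has positive real part. To see it,
  choose \<open>u\<close> with \<open>D u = f - b (q f)\<close>. Then the convolution of \<open>A\<close> with \<open>u\<close> is \<open>A0 u - Ds (q f)\<close>, and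
  \<open>p = D u + A0* (q f)\<close>, so that the Julia identity transports the contractivity of \<open>A\<close>.
\<close>

lemma symbol_positive:
  assumes \<Gamma>: "finite \<Gamma>" "suffix_closed \<Gamma>"
  shows "(\<Sum>\<gamma>\<in>\<Gamma>. (norm (q f \<gamma>))\<^sup>2) \<le> (\<Sum>\<gamma>\<in>\<Gamma>. (norm (f \<gamma> + q f \<gamma>))\<^sup>2)"
proof -
  define h where "h \<gamma> = f \<gamma> - b (q f \<gamma>)" for \<gamma>
  define u where "u \<gamma> = op_inv D (h \<gamma>)" for \<gamma>
  define cZ where "cZ = conv (\<lambda>\<alpha>. blinfun_apply (Z \<alpha>))"
  have "cZ f \<gamma> = q f \<gamma> + cZ (\<lambda>\<beta>. b (q f \<beta>)) \<gamma>" for \<gamma>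
  proof -
    have "cZ f \<gamma> = q f \<gamma> + conv (\<lambda>\<alpha> x. conv (\<lambda>\<alpha> y. Z \<alpha> (b y)) (\<lambda>\<beta>. C \<beta> x) \<alpha>) f \<gamma>"
    proof -
      have "(\<lambda>\<alpha>. blinfun_apply (Z \<alpha>))
          = (\<lambda>\<alpha> x. C \<alpha> x + conv (\<lambda>\<alpha> y. Z \<alpha> (b y)) (\<lambda>\<beta>. C \<beta> x) \<alpha>)"
        by (intro ext) (rule Z_eq)
      from arg_cong[OF this, of "\<lambda>K. conv K f \<gamma>"] show ?thesis
        unfolding cZ_def q_def conv_add_left .
    qed
    also have "conv (\<lambda>\<alpha> x. conv (\<lambda>\<alpha> y. Z \<alpha> (b y)) (\<lambda>\<beta>. C \<beta> x) \<alpha>) f \<gamma>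
        = conv (\<lambda>\<alpha> y. Z \<alpha> (b y)) (q f) \<gamma>"
      unfolding q_def by (rule conv_assoc[symmetric]) (simp add: blinfun.bilinear_simps)
    also have "\<dots> = cZ (\<lambda>\<beta>. b (q f \<beta>)) \<gamma>"
      unfolding cZ_def by (rule conv_precompose)
    finally show ?thesis .
  qed
  moreover have "cZ f \<gamma> = cZ h \<gamma> + cZ (\<lambda>\<beta>. b (q f \<beta>)) \<gamma>" for \<gamma>
    unfolding cZ_def
    by (subst conv_add_right[symmetric]) (simp_all add: h_def blinfun.bilinear_simps)
  ultimately have cZ_h: "cZ h \<gamma> = q f \<gamma>" for \<gamma>
    by (metis add_right_cancel)
  have Du: "D (u \<gamma>) = h \<gamma>" for \<gamma>
    using A_ops A1 by (simp add: u_def op_inv_defect)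
  have w: "conv (\<lambda>\<alpha>. blinfun_apply (A \<alpha>)) u \<gamma> = A [] (u \<gamma>) - Ds (q f \<gamma>)" for \<gamma>
  proof -
    define N where "N \<alpha> x = (if \<alpha> = [] then A [] x else 0)" for \<alpha> :: "'n list" and x
    have "blinfun_apply (A \<alpha>) = (\<lambda>x. N \<alpha> x + (- Ds (Z \<alpha> (D x))))" for \<alpha>
      using A_ops A1 adj_A
      by (auto simp: N_def Z_def op_inv_defect blinfun.bilinear_simps)
    then have "(\<lambda>\<alpha>. blinfun_apply (A \<alpha>)) = (\<lambda>\<alpha> x. N \<alpha> x + (- Ds (Z \<alpha> (D x))))"
      by (rule ext)
    from arg_cong[OF this, of "\<lambda>K. conv K u \<gamma>"]
    have "conv (\<lambda>\<alpha>. blinfun_apply (A \<alpha>)) u \<gamma> = conv N u \<gamma> + conv (\<lambda>\<alpha> x. - Ds (Z \<alpha> (D x))) u \<gamma>"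
      unfolding conv_add_left .
    also have "conv (\<lambda>\<alpha> x. - Ds (Z \<alpha> (D x))) u \<gamma> = - Ds (cZ h \<gamma>)"
    proof -
      have "conv (\<lambda>\<alpha> x. - Ds (Z \<alpha> (D x))) u \<gamma> = conv (\<lambda>\<alpha> x. - Ds (Z \<alpha> x)) (\<lambda>\<beta>. D (u \<beta>)) \<gamma>"
        by (rule conv_precompose)
      also have "\<dots> = - Ds (conv (\<lambda>\<alpha>. blinfun_apply (Z \<alpha>)) (\<lambda>\<beta>. D (u \<beta>)) \<gamma>)"
        by (rule conv_map) (simp add: blinfun.bilinear_simps)
      finally show ?thesis
        by (simp add: Du cZ_def)
    qed
    also have "conv N u \<gamma> = A [] (u \<gamma>)"
    proof (cases \<gamma>)
      case (Cons i \<delta>)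
      have "conv (\<lambda>\<alpha>. N (i # \<alpha>)) u \<delta> = 0"
        by (simp add: N_def conv_eq_sum)
      then show ?thesis
        using Cons by (simp add: N_def)
    qed (simp add: N_def)
    finally show ?thesis
      by (simp add: cZ_h)
  qed
  have p: "f \<gamma> + q f \<gamma> = D (u \<gamma>) + adj (A []) (q f \<gamma>)" for \<gamma>
    by (simp add: Du h_def b_def blinfun.bilinear_simps)
  have "(norm (conv (\<lambda>\<alpha>. blinfun_apply (A \<alpha>)) u \<gamma>))\<^sup>2 + (norm (f \<gamma> + q f \<gamma>))\<^sup>2
      = (norm (u \<gamma>))\<^sup>2 + (norm (q f \<gamma>))\<^sup>2" for \<gamma>
    unfolding w p by (rule julia_identity[OF A_ops A1])
  then have "(\<Sum>\<gamma>\<in>\<Gamma>. (norm (conv (\<lambda>\<alpha>. blinfun_apply (A \<alpha>)) u \<gamma>))\<^sup>2) + (\<Sum>\<gamma>\<in>\<Gamma>. (norm (f \<gamma> + q f \<gamma>))\<^sup>2)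
      = (\<Sum>\<gamma>\<in>\<Gamma>. (norm (u \<gamma>))\<^sup>2) + (\<Sum>\<gamma>\<in>\<Gamma>. (norm (q f \<gamma>))\<^sup>2)"
    by (simp flip: sum.distrib)
  then show ?thesis
    using contractive[OF \<Gamma>, of u] by linarith
qed

text \<open>
  The kernel of the real part of convolution by \<open>G\<close>, at the words \<open>\<alpha>\<close> and \<open>\<beta>\<close>.
\<close>

definition kernel :: "'n list \<Rightarrow> 'n list \<Rightarrow> 'e \<Rightarrow> 'e \<Rightarrow> complex"
  where "kernel \<alpha> \<beta> x y = (if \<alpha> = \<beta> then cinner x y else 0)
    + cinner x (q (delta \<beta> y) \<alpha>) + cinner (q (delta \<alpha> x) \<beta>) y"

lemma kernel_commute: "kernel \<alpha> \<beta> x y = cnj (kernel \<beta> \<alpha> y x)"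
  by (simp add: kernel_def flip: cinner_commute)

lemma q_Nil: "q f [] = 0"
  by (simp add: q_def)

lemma kernel_Nil_Nil: "kernel [] [] x y = cinner x y"
  by (simp add: kernel_def q_Nil)

lemma kernel_Nil_right:
  assumes "\<alpha> \<noteq> []"
  shows "kernel \<alpha> [] x y = cinner x (blinfun_apply (C \<alpha>) y)"
  using assms by (simp add: kernel_def q_Nil) (simp add: q_def conv_delta_Nil)

text \<open>
  The Toeplitz property: convolution acts from the left and commutes with appending a letter on the right.
\<close>

lemma kernel_snoc: "kernel (\<alpha> @ [i]) (\<beta> @ [j]) x y = (if i = j then kernel \<alpha> \<beta> x y else 0)"
  by (auto simp: kernel_def q_def conv_delta_snoc)

text \<open>
  For \<open>f = \<Sum>s. c s *\<^sub>C delta (a s) (x s)\<close> the quadratic form of the kernel is the sum of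
  \<open>(norm (f \<gamma> + q f \<gamma>))\<^sup>2 - (norm (q f \<gamma>))\<^sup>2\<close> over a finite suffix-closed set of words that contains all \<open>a s\<close>.
\<close>

lemma kernel_positive:
  fixes a :: "nat \<Rightarrow> 'n list" and x :: "nat \<Rightarrow> 'e"
  assumes S: "finite S"
  shows "0 \<le> Re (\<Sum>s\<in>S. \<Sum>r\<in>S. c s * cnj (c r) * kernel (a s) (a r) (x s) (x r))"
proof -
  obtain \<Gamma> where \<Gamma>: "finite \<Gamma>" "suffix_closed \<Gamma>" "a ` S \<subseteq> \<Gamma>"
    using suffix_closure[of "a ` S"] S by blast
  define f where "f \<gamma> = (\<Sum>s\<in>S. c s *\<^sub>C delta (a s) (x s) \<gamma>)" for \<gamma>
  have qf: "q f \<gamma> = (\<Sum>s\<in>S. c s *\<^sub>C q (delta (a s) (x s)) \<gamma>)" for \<gamma>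
    unfolding f_def[abs_def] q_sum q_scale ..
  have pair: "(\<Sum>\<gamma>\<in>\<Gamma>. cinner (f \<gamma>) (g \<gamma>)) = (\<Sum>s\<in>S. c s * cinner (x s) (g (a s)))" for g
  proof -
    have "(\<Sum>\<gamma>\<in>\<Gamma>. cinner (f \<gamma>) (g \<gamma>)) = (\<Sum>\<gamma>\<in>\<Gamma>. \<Sum>s\<in>S. if \<gamma> = a s then c s * cinner (x s) (g (a s)) else 0)"
      unfolding f_def cinner.sum_left by (intro sum.cong refl) (auto simp: delta_def cinner_scaleC_left)
    also have "\<dots> = (\<Sum>s\<in>S. \<Sum>\<gamma>\<in>\<Gamma>. if \<gamma> = a s then c s * cinner (x s) (g (a s)) else 0)"
      by (rule sum.swap)
    also have "\<dots> = (\<Sum>s\<in>S. c s * cinner (x s) (g (a s)))"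
      using \<Gamma> by (intro sum.cong refl) auto
    finally show ?thesis .
  qed
  have 1: "(\<Sum>\<gamma>\<in>\<Gamma>. cinner (f \<gamma>) (f \<gamma>))
      = (\<Sum>s\<in>S. \<Sum>r\<in>S. c s * cnj (c r) * (if a s = a r then cinner (x s) (x r) else 0))"
    unfolding pair unfolding f_def cinner.sum_right sum_distrib_left
    by (intro sum.cong refl) (auto simp: delta_def cinner_scaleC_right)
  have 2: "(\<Sum>\<gamma>\<in>\<Gamma>. cinner (f \<gamma>) (q f \<gamma>))
      = (\<Sum>s\<in>S. \<Sum>r\<in>S. c s * cnj (c r) * cinner (x s) (q (delta (a r) (x r)) (a s)))"
    unfolding pair unfolding qf cinner.sum_right sum_distrib_left
    by (intro sum.cong refl) (simp add: cinner_scaleC_right)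
  have 3: "(\<Sum>\<gamma>\<in>\<Gamma>. cinner (q f \<gamma>) (f \<gamma>))
      = (\<Sum>s\<in>S. \<Sum>r\<in>S. c s * cnj (c r) * cinner (q (delta (a s) (x s)) (a r)) (x r))"
  proof -
    have "(\<Sum>\<gamma>\<in>\<Gamma>. cinner (q f \<gamma>) (f \<gamma>)) = cnj (\<Sum>\<gamma>\<in>\<Gamma>. cinner (f \<gamma>) (q f \<gamma>))"
      unfolding cnj_sum by (intro sum.cong refl cinner_commute)
    also have "\<dots> = (\<Sum>s\<in>S. \<Sum>r\<in>S. c r * cnj (c s) * cnj (cinner (x s) (q (delta (a r) (x r)) (a s))))"
      unfolding 2 cnj_sum by (simp add: mult_ac)
    also have "\<dots> = (\<Sum>r\<in>S. \<Sum>s\<in>S. c r * cnj (c s) * cinner (q (delta (a r) (x r)) (a s)) (x s))"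
      by (subst sum.swap) (intro sum.cong refl, simp flip: cinner_commute)
    finally show ?thesis .
  qed
  have "(\<Sum>s\<in>S. \<Sum>r\<in>S. c s * cnj (c r) * kernel (a s) (a r) (x s) (x r))
      = (\<Sum>\<gamma>\<in>\<Gamma>. cinner (f \<gamma>) (f \<gamma>) + cinner (f \<gamma>) (q f \<gamma>) + cinner (q f \<gamma>) (f \<gamma>))"
    unfolding sum.distrib 1 2 3 kernel_def by (simp add: distrib_left sum.distrib)
  also have "Re \<dots> = (\<Sum>\<gamma>\<in>\<Gamma>. (norm (f \<gamma> + q f \<gamma>))\<^sup>2 - (norm (q f \<gamma>))\<^sup>2)"
  proof -
    have "Re (cinner (f \<gamma>) (f \<gamma>) + cinner (f \<gamma>) (q f \<gamma>) + cinner (q f \<gamma>) (f \<gamma>))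
        = (norm (f \<gamma> + q f \<gamma>))\<^sup>2 - (norm (q f \<gamma>))\<^sup>2" for \<gamma>
      using cinner_commute[of "q f \<gamma>" "f \<gamma>"] by (simp add: norm_add_sqr)
    then show ?thesis
      unfolding Re_sum by (intro sum.cong refl)
  qed
  also have "\<dots> \<ge> 0"
    using symbol_positive[OF \<Gamma>(1,2), of f] by (simp add: sum_subtractf)
  finally show ?thesis .
qed

end

section \<open>The isometric dilation\<close>

lemma closure_csubspace:
  assumes G: "complex_vector.subspace G"
  shows "complex_vector.subspace (closure G)"
proof (rule complex_vector.subspaceI)
  show "0 \<in> closure G"
    using complex_vector.subspace_0[OF G] closure_subset by blast
  show "x + y \<in> closure G" if "x \<in> closure G" "y \<in> closure G" for x y
    by (rule closure_add_mem[OF _ that]) (rule complex_vector.subspace_add[OF G])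
  show "c *\<^sub>C x \<in> closure G" if "x \<in> closure G" for c x
  proof -
    have "(\<lambda>x. c *\<^sub>C x) ` closure G \<subseteq> closure G"
      using complex_vector.subspace_scale[OF G] closure_subset
      by (intro image_closure_subset scaleC.continuous_on continuous_intros) auto
    then show ?thesis
      using that by auto
  qed
qed

lemma closure_span_induct:
  assumes "x \<in> closure (complex_vector.span B)" and "B \<subseteq> Q" and "complex_vector.subspace Q" and "closed Q"
  shows "x \<in> Q"
  using assms closure_minimal[OF complex_vector.span_minimal[OF assms(2,3)] assms(4)] by blast

text \<open>
  Transfers isometry and orthogonality of ranges from generators to the closed span.
\<close>

lemma cinner_eq_on_closure_span:
  fixes S S' :: "'a::complex_hilbert \<Rightarrow>\<^sub>L 'b::complex_hilbert" and T T' :: "'a \<Rightarrow>\<^sub>L 'b"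
  assumes ops: "S \<in> bounded_ops" "S' \<in> bounded_ops" "T \<in> bounded_ops" "T' \<in> bounded_ops"
    and eq: "\<And>x y. x \<in> B \<Longrightarrow> y \<in> B \<Longrightarrow> cinner (blinfun_apply S x) (blinfun_apply T y)
      = cinner (blinfun_apply S' x) (blinfun_apply T' y)"
    and x: "x \<in> closure (complex_vector.span B)" and y: "y \<in> closure (complex_vector.span B)"
  shows "cinner (blinfun_apply S x) (blinfun_apply T y) = cinner (blinfun_apply S' x) (blinfun_apply T' y)"
proof -
  have 1: "cinner (S x) (T y) = cinner (S' x) (T' y)" if "y \<in> B" for y
  proof -
    have "x \<in> {x. cinner (S x) (T y) = cinner (S' x) (T' y)}"
    proof (rule closure_span_induct[OF x])
      show "complex_vector.subspace {x. cinner (S x) (T y) = cinner (S' x) (T' y)}"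
        by (rule complex_vector.subspaceI)
          (simp_all add: blinfun.bilinear_simps cinner_add_left bounded_opsD ops cinner_scaleC_left)
      show "closed {x. cinner (S x) (T y) = cinner (S' x) (T' y)}"
        by (intro closed_Collect_eq cinner.continuous_on blinfun.continuous_on continuous_intros)
    qed (use eq that in auto)
    then show ?thesis
      by simp
  qed
  have "y \<in> {y. cinner (S x) (T y) = cinner (S' x) (T' y)}"
  proof (rule closure_span_induct[OF y])
    show "complex_vector.subspace {y. cinner (S x) (T y) = cinner (S' x) (T' y)}"
      by (rule complex_vector.subspaceI)
        (simp_all add: blinfun.bilinear_simps cinner_add_right bounded_opsD ops cinner_scaleC_right)
    show "closed {y. cinner (S x) (T y) = cinner (S' x) (T' y)}"
      by (intro closed_Collect_eq cinner.continuous_on blinfun.continuous_on continuous_intros)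
  qed (use 1 in auto)
  then show ?thesis
    by simp
qed

lemma norm_sum_le_of_gram_eq:
  assumes "\<And>i j. cinner (v i) (v j) = cinner (u i) (u j)"
  shows "norm (\<Sum>i\<in>S. c i *\<^sub>C v i) \<le> 1 * norm (\<Sum>i\<in>S. c i *\<^sub>C u i)"
proof -
  have "cinner (\<Sum>i\<in>S. c i *\<^sub>C v i) (\<Sum>i\<in>S. c i *\<^sub>C v i) = cinner (\<Sum>i\<in>S. c i *\<^sub>C u i) (\<Sum>i\<in>S. c i *\<^sub>C u i)"
    unfolding cinner.sum_left unfolding cinner.sum_right
    by (simp add: cinner_scaleC_left cinner_scaleC_right assms)
  from arg_cong[OF this, of Re] have "(norm (\<Sum>i\<in>S. c i *\<^sub>C v i))\<^sup>2 = (norm (\<Sum>i\<in>S. c i *\<^sub>C u i))\<^sup>2"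
    by simp
  then show ?thesis
    by (simp add: power2_eq_iff_nonneg)
qed

lemma dense_sequence_exists:
  assumes "separable_hilbert TYPE('e::complex_hilbert)"
  obtains d :: "nat \<Rightarrow> 'e::complex_hilbert" where "closure (range d) = UNIV"
proof -
  obtain C :: "'e set" where C: "countable C" "closure C = UNIV"
    using assms unfolding separable_hilbert_def separable_space_def by auto
  then have "C \<noteq> {}"
    by auto
  then have "range (from_nat_into C) = C"
    using C(1) by (rule range_from_nat_into)
  then show thesis
    using C(2) that by metis
qed

text \<open>
  The vectors \<open>u (\<alpha>, n)\<close> realize the kernel at \<open>\<alpha>\<close> and the \<open>n\<close>-th member of a dense sequence \<open>d\<close>; a countable index set
  makes every infinite-dimensional space large enough to contain them. The Toeplitz property of the kernel
  makes the maps \<open>u (\<alpha>, n) \<mapsto> u (\<alpha> @ [i], n)\<close> isometric with orthogonal ranges. Letters are appended at the end,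
  so the adjoints occur in the order of the word: \<open>u (\<alpha>, m)\<close> is the adjoint of
  \<open>word_op (\<lambda>i. adj (V i)) \<alpha>\<close> applied to \<open>u ([], m)\<close>.
\<close>

lemma (in contractive_symbol) dilation_exists:
  assumes sep: "separable_hilbert TYPE('e)" and inf: "infinite_dimensional TYPE('k::complex_hilbert)"
  obtains K :: "'k::complex_hilbert set" and V :: "'n \<Rightarrow> ('k \<Rightarrow>\<^sub>L 'k)" and W :: "'e \<Rightarrow>\<^sub>L 'k"
  where "complex_vector.subspace K" and "closed K" and "isometries_with_orthogonal_ranges K V"
    and "isometry_into K W"
    and "\<And>\<alpha>. \<alpha> \<noteq> [] \<Longrightarrow> C \<alpha> = adj W o\<^sub>L word_op (\<lambda>i. adj (V i)) \<alpha> o\<^sub>L W"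
proof -
  obtain d :: "nat \<Rightarrow> 'e" where d: "closure (range d) = UNIV"
    using sep by (rule dense_sequence_exists)
  define a where "a s = fst (from_nat s :: 'n list \<times> nat)" for s
  define x where "x s = d (snd (from_nat s :: 'n list \<times> nat))" for s
  obtain v :: "nat \<Rightarrow> 'k" where v: "\<And>s r. cinner (v s) (v r) = kernel (a s) (a r) (x s) (x r)"
  proof (rule positive_kernel_realization[OF inf, of "\<lambda>s r. kernel (a s) (a r) (x s) (x r)"])
    show "kernel (a i) (a j) (x i) (x j) = cnj (kernel (a j) (a i) (x j) (x i))" for i j
      by (rule kernel_commute)
    show "0 \<le> Re (\<Sum>i\<in>S. \<Sum>j\<in>S. c i * cnj (c j) * kernel (a i) (a j) (x i) (x j))"
      if "finite S" for S and c :: "nat \<Rightarrow> complex"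
      using that by (rule kernel_positive)
  qed (rule that)
  define u where "u p = v (to_nat p)" for p :: "'n list \<times> nat"
  have u: "cinner (u (\<alpha>, m)) (u (\<beta>, n)) = kernel \<alpha> \<beta> (d m) (d n)" for \<alpha> \<beta> m n
    by (simp add: u_def v a_def x_def)
  define K where "K = closure (complex_vector.span (range u))"
  have K_sub: "complex_vector.subspace K"
    unfolding K_def by (intro closure_csubspace complex_vector.subspace_span)
  have K_closed: "closed K"
    by (simp add: K_def)
  have u_K: "u p \<in> K" for p
    unfolding K_def by (rule subsetD[OF closure_subset complex_vector.span_base]) simp
  have "\<exists>R. R \<in> bounded_ops \<and> norm R \<le> 1 \<and> (\<forall>n. blinfun_apply R (d n) = u ([], n)) \<and>
    (\<forall>z. (\<forall>n. cinner (d n) z = 0) \<longrightarrow> blinfun_apply R z = 0)"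
    by (rule bounded_op_extension) (simp, rule norm_sum_le_of_gram_eq, simp add: u kernel_Nil_Nil)
  then obtain W where W: "W \<in> bounded_ops" "\<And>n. blinfun_apply W (d n) = u ([], n)"
    by blast
  have V_ex: "\<exists>R. R \<in> bounded_ops \<and> norm R \<le> 1 \<and> (\<forall>p. blinfun_apply R (u p) = u (fst p @ [i], snd p)) \<and>
    (\<forall>z. (\<forall>p. cinner (u p) z = 0) \<longrightarrow> blinfun_apply R z = 0)" for i
    by (rule bounded_op_extension)
      (simp, rule norm_sum_le_of_gram_eq, auto simp: u kernel_snoc)
  then obtain V where V: "\<And>i. V i \<in> bounded_ops" "\<And>i p. blinfun_apply (V i) (u p) = u (fst p @ [i], snd p)"
    "\<And>i z. \<forall>p. cinner (u p) z = 0 \<Longrightarrow> blinfun_apply (V i) z = 0"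
    by metis
  have V_K: "V i y \<in> K" if "y \<in> K" for i y
  proof -
    have "y \<in> {y. V i y \<in> K}"
    proof (rule closure_span_induct[OF that[unfolded K_def]])
      show "complex_vector.subspace {y. V i y \<in> K}"
        using K_sub by (intro complex_vector.subspaceI)
          (simp_all add: blinfun.bilinear_simps bounded_opsD V(1) complex_vector.subspace_0
            complex_vector.subspace_add complex_vector.subspace_scale)
      show "closed {y. V i y \<in> K}"
        using continuous_closed_vimage[OF K_closed, of "blinfun_apply (V i)"]
        by (simp add: vimage_def blinfun.continuous)
    qed (auto simp: V(2) u_K)
    then show ?thesis
      by simp
  qed
  have V_cinner: "cinner (V i y) (V i z) = cinner y z" if "y \<in> K" "z \<in> K" for i y z
    using cinner_eq_on_closure_span[OF V(1)[of i] bounded_ops_id V(1)[of i] bounded_ops_id _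
        that[unfolded K_def]] V(2) u by (force simp: kernel_snoc)
  have V_orth: "cinner (V i y) (V j z) = 0" if "y \<in> K" "z \<in> K" "i \<noteq> j" for i j y z
    using cinner_eq_on_closure_span[OF V(1)[of i] bounded_ops_zero V(1)[of j] bounded_ops_zero _
        that(1,2)[unfolded K_def]] V(2) u that(3) by (force simp: kernel_snoc)
  have V_iso: "isometries_with_orthogonal_ranges K V"
    unfolding isometries_with_orthogonal_ranges_def operator_on_def
  proof (intro conjI allI ballI impI)
    show "norm (V i y) = norm y" if "y \<in> K" for i y
    proof -
      have "(norm (V i y))\<^sup>2 = (norm y)\<^sup>2"
        using arg_cong[OF V_cinner[OF that that, of i], of Re] by simp
      then show ?thesis
        by (simp add: power2_eq_iff_nonneg)
    qed
    show "V i z = 0" if "\<forall>y\<in>K. cinner y z = 0" for i z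
      using that u_K by (intro V(3)) blast
  qed (use V(1) V_K V_orth in auto)
  have W_iso: "isometry_into K W"
    unfolding isometry_into_def
  proof (intro conjI allI)
    have "closure (range d) \<subseteq> {y. norm (W y) = norm y}"
    proof (rule closure_minimal)
      have "(norm (u ([], n)))\<^sup>2 = (norm (d n))\<^sup>2" for n
        using arg_cong[OF u[of "[]" n "[]" n], of Re] by (simp add: kernel_Nil_Nil)
      then show "range d \<subseteq> {y. norm (W y) = norm y}"
        by (auto simp: W(2) power2_eq_iff_nonneg)
      show "closed {y. norm (W y) = norm y}"
        by (intro closed_Collect_eq continuous_intros blinfun.continuous_on)
    qed
    then show "norm (W y) = norm y" for y
      by (auto simp: d)
    have "closure (range d) \<subseteq> {y. W y \<in> K}"
    proof (rule closure_minimal)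
      show "range d \<subseteq> {y. W y \<in> K}"
        by (auto simp: W(2) u_K)
      show "closed {y. W y \<in> K}"
        using continuous_closed_vimage[OF K_closed, of "blinfun_apply W"]
        by (simp add: vimage_def blinfun.continuous)
    qed
    then show "range (blinfun_apply W) \<subseteq> K"
      by (auto simp: d)
  qed (rule W(1))
  have word: "adj (word_op (\<lambda>i. adj (V i)) \<alpha>) (u (\<beta>, m)) = u (\<beta> @ \<alpha>, m)" for \<alpha> \<beta> m
  proof (induction \<alpha> arbitrary: \<beta>)
    case (Cons i \<alpha>)
    then show ?case
      by (simp add: adj_compose V word_op_bounded_ops)
  qed simp
  have coeff: "C \<alpha> = adj W o\<^sub>L word_op (\<lambda>i. adj (V i)) \<alpha> o\<^sub>L W" if "\<alpha> \<noteq> []" for \<alpha>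
  proof (rule blinfun_eqI)
    fix y
    let ?R = "adj W o\<^sub>L word_op (\<lambda>i. adj (V i)) \<alpha> o\<^sub>L W"
    have eq: "cinner (d m) (?R (d n)) = cinner (d m) (C \<alpha> (d n))" for m n
    proof -
      have "cinner (d m) (?R (d n)) = cinner (u (\<alpha>, m)) (u ([], n))"
        using word[of \<alpha> "[]" m]
        by (simp add: cinner_adj_right W(1)) (simp add: W(2) V word_op_bounded_ops flip: cinner_adj_left)
      then show ?thesis
        by (simp add: u kernel_Nil_right[OF that])
    qed
    have "?R (d n) = C \<alpha> (d n)" for n
    proof (rule cinner_eqI)
      fix z
      have "closure (range d) \<subseteq> {z. cinner z (?R (d n)) = cinner z (C \<alpha> (d n))}"
        by (rule closure_minimal)
          (use eq in \<open>auto intro!: closed_Collect_eq cinner.continuous_on continuous_intros simp del: blinfun_apply_blinfun_compose\<close>)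
      then have "cinner z (?R (d n)) = cinner z (C \<alpha> (d n))"
        by (auto simp: d)
      then show "cinner (?R (d n)) z = cinner (C \<alpha> (d n)) z"
        using cinner_commute[of _ z] by metis
    qed
    then have "closure (range d) \<subseteq> {y. C \<alpha> y = ?R y}"
      by (intro closure_minimal closed_Collect_eq blinfun.continuous_on continuous_intros) auto
    then show "C \<alpha> y = ?R y"
      by (auto simp: d)
  qed
  show thesis
    by (rule that[OF K_sub K_closed V_iso W_iso coeff])
qed

text \<open>
  Up to the outer factors, the coefficients of the state space formula are words \<open>Z'\<close> in \<open>adj (V i)\<close> with factors
  \<open>feedback W (A []) = id_blinfun + W b (adj W)\<close> in between. Splitting such a word at the last occurrence of
  \<open>W b (adj W)\<close> gives \<open>Z' = C + Z' b C\<close>, the equation that \<open>Z\<close> satisfies too. It determines its solution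
  recursively from the values at proper prefixes.
\<close>

lemma (in contractive_symbol) transfer_coeff_eq:
  assumes W: "W \<in> bounded_ops" and V: "\<And>i. V i \<in> bounded_ops"
    and C_eq: "\<And>\<alpha>. \<alpha> \<noteq> [] \<Longrightarrow> C \<alpha> = adj W o\<^sub>L word_op (\<lambda>i. adj (V i)) \<alpha> o\<^sub>L W"
  shows "transfer_coeff (A []) V W = A"
proof
  fix \<alpha>
  define B where "B i = feedback W (A []) o\<^sub>L adj (V i)" for i
  define Z' where "Z' \<alpha> y = (if \<alpha> = [] then 0 else adj W (adj (V (hd \<alpha>)) (word_op B (tl \<alpha>) (W y))))"
    for \<alpha> y
  have M: "feedback W (A []) w = w + W (b (adj W w))" for w
    by (simp add: feedback_def b_def blinfun.bilinear_simps)
  have expand: "word_op B \<gamma> (W y) = word_op (\<lambda>i. adj (V i)) \<gamma> (W y)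
      + conv (\<lambda>\<alpha> x. word_op B \<alpha> (W (b x))) (\<lambda>\<beta>. C \<beta> y) \<gamma>" for \<gamma> y
  proof (induction \<gamma>)
    case (Cons j \<gamma>)
    define w where "w = word_op (\<lambda>i. adj (V i)) (j # \<gamma>) (W y)"
    have "word_op B (j # \<gamma>) (W y) = B j (word_op (\<lambda>i. adj (V i)) \<gamma> (W y))
        + B j (conv (\<lambda>\<alpha> x. word_op B \<alpha> (W (b x))) (\<lambda>\<beta>. C \<beta> y) \<gamma>)"
      by (simp add: Cons blinfun.bilinear_simps)
    also have "B j (word_op (\<lambda>i. adj (V i)) \<gamma> (W y)) = w + W (b (C (j # \<gamma>) y))"
      by (simp add: B_def M w_def C_eq)
    also have "B j (conv (\<lambda>\<alpha> x. word_op B \<alpha> (W (b x))) (\<lambda>\<beta>. C \<beta> y) \<gamma>)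
        = conv (\<lambda>\<alpha> x. B j (word_op B \<alpha> (W (b x)))) (\<lambda>\<beta>. C \<beta> y) \<gamma>"
      by (rule conv_map[symmetric]) (simp add: blinfun.bilinear_simps)
    finally show ?case
      by (simp add: w_def add.assoc)
  qed (simp add: blinfun.bilinear_simps)
  have Z'_eq: "Z' \<gamma> y = C \<gamma> y + conv (\<lambda>\<alpha> x. Z' \<alpha> (b x)) (\<lambda>\<beta>. C \<beta> y) \<gamma>" for \<gamma> y
  proof (cases \<gamma>)
    case (Cons i \<delta>)
    have "Z' \<gamma> y = adj W (adj (V i) (word_op (\<lambda>i. adj (V i)) \<delta> (W y)))
        + adj W (adj (V i) (conv (\<lambda>\<alpha> x. word_op B \<alpha> (W (b x))) (\<lambda>\<beta>. C \<beta> y) \<delta>))"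
      by (simp add: Cons Z'_def expand[of \<delta> y] blinfun.bilinear_simps)
    also have "adj W (adj (V i) (conv (\<lambda>\<alpha> x. word_op B \<alpha> (W (b x))) (\<lambda>\<beta>. C \<beta> y) \<delta>))
        = conv (\<lambda>\<alpha> x. Z' (i # \<alpha>) (b x)) (\<lambda>\<beta>. C \<beta> y) \<delta>"
      unfolding Z'_def
      by (subst conv_map[symmetric, of "\<lambda>z. adj W (adj (V i) z)"]) (simp_all add: blinfun.bilinear_simps)
    finally show ?thesis
      by (simp add: Cons C_eq) (simp add: Z'_def)
  qed (simp add: Z'_def)
  have Z_Z': "blinfun_apply (Z \<gamma>) = Z' \<gamma>" for \<gamma>
  proof (induction \<gamma> rule: length_induct)
    case (1 \<gamma>)
    have "conv (\<lambda>\<alpha> x. Z \<alpha> (b x)) (\<lambda>\<beta>. C \<beta> y) \<gamma> = conv (\<lambda>\<alpha> x. Z' \<alpha> (b x)) (\<lambda>\<beta>. C \<beta> y) \<gamma>" for y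
      by (rule conv_cong_prefix) (use 1 in \<open>simp_all add: Z'_def\<close>)
    then show ?case
      by (intro ext) (simp add: Z_eq[of \<gamma>] Z'_eq[of \<gamma>])
  qed
  show "transfer_coeff (A []) V W \<alpha> = A \<alpha>"
  proof (cases "\<alpha> = []")
    case False
    have "transfer_coeff (A []) V W \<alpha> x = - Ds (Z \<alpha> (D x))" for x
      using False by (simp add: transfer_coeff_def Z_Z' Z'_def B_def[abs_def] blinfun.bilinear_simps)
    then show ?thesis
      using False A_ops A1 adj_A
      by (intro blinfun_eqI) (simp add: Z_def blinfun.bilinear_simps op_inv_defect)
  qed (simp add: transfer_coeff_def)
qed

text \<open>
  On the ambient space the \<open>V i\<close> are partial isometries that vanish off \<open>K\<close>, so contractivity and orthogonality of
  the ranges extend from \<open>K\<close> to all vectors.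
\<close>

lemma column_bound_of_isometries:
  assumes K: "complex_vector.subspace K" "closed K" and V: "isometries_with_orthogonal_ranges K V"
  shows "V i \<in> bounded_ops" and "column_bound 1 UNIV (\<lambda>i. adj (V i))"
proof -
  have ops: "V i \<in> bounded_ops" for i
    using V by (simp add: isometries_with_orthogonal_ranges_def operator_on_def)
  then show "V i \<in> bounded_ops" .
  have compress: "\<exists>p\<in>K. (\<forall>i. V i x = V i p) \<and> norm p \<le> norm x" for x
  proof -
    obtain p where p: "p \<in> K" and orth: "\<And>z. z \<in> K \<Longrightarrow> cinner (x - p) z = 0"
      using orthogonal_decomposition[OF K] by blast
    have "V i (x - p) = 0" for i
    proof -
      have "\<forall>z\<in>K. cinner z (x - p) = 0"
        using orth by (metis cinner_commute complex_cnj_zero)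
      then show ?thesis
        using V by (simp add: isometries_with_orthogonal_ranges_def operator_on_def)
    qed
    moreover have "(norm ((x - p) + p))\<^sup>2 = (norm (x - p))\<^sup>2 + (norm p)\<^sup>2"
      by (subst norm_add_sqr) (simp add: orth[OF p])
    then have "(norm p)\<^sup>2 \<le> (norm x)\<^sup>2"
      by simp
    then have "norm p \<le> norm x"
      by (rule power2_le_imp_le) simp
    ultimately show ?thesis
      using p by (auto simp: blinfun.bilinear_simps)
  qed
  show "column_bound 1 UNIV (\<lambda>i. adj (V i))"
  proof (rule column_bound_orthogonal_ranges[OF ops])
    show "norm (V i x) \<le> norm x" for i x
      using compress[of x] V by (auto simp: isometries_with_orthogonal_ranges_def)
    show "cinner (V i x) (V j y) = 0" if "i \<noteq> j" for i j x y
      using compress[of x] compress[of y] V that by (auto simp: isometries_with_orthogonal_ranges_def)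
  qed
qed

section \<open>The characterization\<close>

lemma value_at_zero:
  fixes tE :: "'h::complex_hilbert \<Rightarrow> 'e::complex_hilbert \<Rightarrow> 'he::complex_hilbert"
    and A :: "'n::countable list \<Rightarrow> ('e \<Rightarrow>\<^sub>L 'e)"
  assumes tE: "hilbert_tensor tE"
    and Y: "\<And>k. strong_has_sum (\<lambda>\<alpha>. tensor_op tE tE (word_op (\<lambda>i. 0) \<alpha>) (A \<alpha>)) {\<alpha>. length \<alpha> = k} (Y k)"
    and F0: "Y sums F0"
  shows "F0 = tensor_op tE tE id_blinfun (A [])"
proof -
  have "Y (Suc k) = 0" for k
  proof (rule strong_has_sum_unique[OF Y])
    have "strong_has_sum (\<lambda>\<alpha> :: 'n list. 0) {\<alpha>. length \<alpha> = Suc k} 0"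
      by (simp add: strong_has_sum_def has_sum_0)
    then show "strong_has_sum (\<lambda>\<alpha>. tensor_op tE tE (word_op (\<lambda>i. 0) \<alpha>) (A \<alpha>)) {\<alpha>. length \<alpha> = Suc k} 0"
      by (rule strong_has_sum_cong[THEN iffD1, rotated])
        (auto simp: length_Suc_conv tensor_op_zero_left[OF tE tE])
  qed
  then have "Y k = 0" if "k \<notin> {0}" for k
    using that by (cases k) auto
  from sums_finite[of "{0}" Y, OF _ this] have "Y sums Y 0"
    by simp
  moreover have "Y 0 = tensor_op tE tE id_blinfun (A [])"
  proof (rule strong_has_sum_unique[OF Y])
    have "((\<lambda>\<alpha>. tensor_op tE tE (word_op (\<lambda>i. 0) \<alpha>) (A \<alpha>) x) has_sum tensor_op tE tE id_blinfun (A []) x) {[]}" for x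
      by (rule has_sum_finiteI) simp_all
    then show "strong_has_sum (\<lambda>\<alpha>. tensor_op tE tE (word_op (\<lambda>i. 0) \<alpha>) (A \<alpha>)) {\<alpha>. length \<alpha> = 0}
        (tensor_op tE tE id_blinfun (A []))"
      by (simp add: strong_has_sum_def)
  qed
  ultimately show ?thesis
    using F0 sums_unique2 by metis
qed

lemma norm_tensor_op_id:
  fixes tE :: "'h::complex_hilbert \<Rightarrow> 'e::complex_hilbert \<Rightarrow> 'he::complex_hilbert"
  assumes inf: "infinite_dimensional TYPE('h)" and tE: "hilbert_tensor tE" and A: "A \<in> bounded_ops"
  shows "norm (tensor_op tE tE id_blinfun A) = norm A"
proof (rule antisym)
  interpret hilbert_tensor tE by fact
  show "norm (tensor_op tE tE id_blinfun A) \<le> norm A"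
    by (rule norm_tensor_op_id_le[OF tE tE A])
  obtain h :: 'h where "cinner h h = 1"
    using unit_vector_orthogonal_to_finite_set[OF inf, of "{}"] by blast
  then have h: "norm h = 1"
    by (rule norm_eq_1_of_cinner)
  show "norm A \<le> norm (tensor_op tE tE id_blinfun A)"
  proof (rule norm_blinfun_bound)
    fix x
    have "norm (A x) = norm (tensor_op tE tE id_blinfun A (tE h x))"
      by (simp add: tensor_op_apply tE A norm_tensor h)
    also have "\<dots> \<le> norm (tensor_op tE tE id_blinfun A) * norm x"
      using norm_blinfun[of "tensor_op tE tE id_blinfun A" "tE h x"] by (simp add: norm_tensor h)
    finally show "norm (A x) \<le> norm (tensor_op tE tE id_blinfun A) * norm x" .
  qed simp
qed

lemma represents_imp:
  fixes tE :: "'h::complex_hilbert \<Rightarrow> 'e::complex_hilbert \<Rightarrow> 'he::complex_hilbert"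
    and tK :: "'h \<Rightarrow> 'k::complex_hilbert \<Rightarrow> 'hk::complex_hilbert"
    and F :: "('n::countable \<Rightarrow> 'h \<Rightarrow>\<^sub>L 'h) \<Rightarrow> ('he \<Rightarrow>\<^sub>L 'he)"
  assumes inf: "infinite_dimensional TYPE('h)" and tE: "hilbert_tensor tE" and tK: "hilbert_tensor tK"
    and rep: "represents tE tK F K A0 V W"
  shows "free_holomorphic tE F" and "bounded_on_ball F" and "sup_norm F \<le> 1"
    and "F (\<lambda>i. 0) = tensor_op tE tE id_blinfun A0" and "norm (F (\<lambda>i. 0)) < 1"
proof -
  have K: "complex_vector.subspace K" "closed K" and A0: "A0 \<in> bounded_ops" "norm A0 < 1"
    and iso: "isometries_with_orthogonal_ranges K V" and W_into: "isometry_into K W"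
    and F: "\<And>X. X \<in> row_ball \<Longrightarrow> F X = (fractional_transform (tensor_op tE tE id_blinfun A0) \<circ> cayley_transform)
        (isometric_transfer tE tK V W) X"
    using rep by (simp_all add: represents_def)
  note V = column_bound_of_isometries[OF K iso]
  have W: "W \<in> bounded_ops" "\<And>x. norm (W x) = norm x"
    using W_into by (simp_all add: isometry_into_def)
  note expansion = transfer_expansion[OF tE tK A0 W V]
  have Y: "\<exists>Y. (\<forall>k. strong_has_sum (\<lambda>\<alpha>. tensor_op tE tE (word_op X \<alpha>) (transfer_coeff A0 V W \<alpha>))
      {\<alpha>. length \<alpha> = k} (Y k)) \<and> Y sums F X" if "X \<in> row_ball" for X
    unfolding F[OF that] by (rule expansion(1)[OF that])
  have le: "norm (F X) \<le> 1" if "X \<in> row_ball" for X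
    unfolding F[OF that] by (rule expansion(2)[OF that])
  have A0': "adj A0 \<in> bounded_ops" "norm (adj A0) < 1"
    using A0 by (simp_all add: norm_adj)
  have "transfer_coeff A0 V W \<alpha> \<in> bounded_ops" for \<alpha>
    unfolding transfer_coeff_def using A0 A0' W V(1)
    by (auto intro!: bounded_ops_compose bounded_ops_minus feedback_bounded_ops word_op_bounded_ops)
  then show "free_holomorphic tE F"
    unfolding free_holomorphic_def using Y by (intro exI[of _ "transfer_coeff A0 V W"]) blast
  show "bounded_on_ball F"
    unfolding bounded_on_ball_def by (rule bdd_aboveI2[of _ _ 1]) (rule le)
  show "sup_norm F \<le> 1"
    unfolding sup_norm_def by (rule cSUP_least) (use zero_in_row_ball le in auto)
  obtain Y where "\<And>k. strong_has_sum (\<lambda>\<alpha>. tensor_op tE tE (word_op (\<lambda>i. 0) \<alpha>) (transfer_coeff A0 V W \<alpha>))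
      {\<alpha>. length \<alpha> = k} (Y k)" "Y sums F (\<lambda>i. 0)"
    using Y[OF zero_in_row_ball] by blast
  from value_at_zero[OF tE this] show "F (\<lambda>i. 0) = tensor_op tE tE id_blinfun A0"
    by (simp add: transfer_coeff_def)
  then show "norm (F (\<lambda>i. 0)) < 1"
    using A0 by (simp add: norm_tensor_op_id inf tE)
qed

text \<open>
  With the isometries of the dilation, \<open>F\<close> and the function represented by them have the same coefficients.
\<close>

lemma represents_exists:
  fixes tE :: "'h::complex_hilbert \<Rightarrow> 'e::complex_hilbert \<Rightarrow> 'he::complex_hilbert"
    and tK :: "'h \<Rightarrow> 'k::complex_hilbert \<Rightarrow> 'hk::complex_hilbert"
    and F :: "('n::countable \<Rightarrow> 'h \<Rightarrow>\<^sub>L 'h) \<Rightarrow> ('he \<Rightarrow>\<^sub>L 'he)"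
  assumes inf: "infinite_dimensional TYPE('h)" and sep: "separable_hilbert TYPE('e)"
    and infK: "infinite_dimensional TYPE('k)"
    and tE: "hilbert_tensor tE" and tK: "hilbert_tensor tK"
    and F: "free_holomorphic tE F" and bdd: "bounded_on_ball F" and sup: "sup_norm F \<le> 1"
    and F0: "norm (F (\<lambda>i. 0)) < 1"
  shows "\<exists>K A0 V W. represents tE tK F K A0 V W"
proof -
  obtain A :: "'n list \<Rightarrow> ('e \<Rightarrow>\<^sub>L 'e)" where A: "\<And>\<alpha>. A \<alpha> \<in> bounded_ops"
    and Y: "\<And>X. X \<in> row_ball \<Longrightarrow> \<exists>Y. (\<forall>k. strong_has_sum
      (\<lambda>\<alpha>. tensor_op tE tE (word_op X \<alpha>) (A \<alpha>)) {\<alpha>. length \<alpha> = k} (Y k)) \<and> Y sums F X"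
    using F unfolding free_holomorphic_def by blast
  have le: "norm (F X) \<le> 1" if "X \<in> row_ball" for X
    using cSUP_upper[OF that bdd[unfolded bounded_on_ball_def]] sup unfolding sup_norm_def by linarith
  obtain Y0 where "\<And>k. strong_has_sum (\<lambda>\<alpha>. tensor_op tE tE (word_op (\<lambda>i. 0) \<alpha>) (A \<alpha>)) {\<alpha>. length \<alpha> = k} (Y0 k)"
    "Y0 sums F (\<lambda>i. 0)"
    using Y[OF zero_in_row_ball] by blast
  from value_at_zero[OF tE this] have A1: "norm (A []) < 1"
    using F0 by (simp add: norm_tensor_op_id inf tE A)
  interpret contractive_symbol A
    by unfold_locales (use A A1 coefficients_contractive[OF inf tE A Y le] in auto)
  obtain K :: "'k set" and V W where K: "complex_vector.subspace K" "closed K"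
    and iso: "isometries_with_orthogonal_ranges K V" and W_into: "isometry_into K W"
    and C_eq: "\<And>\<alpha>. \<alpha> \<noteq> [] \<Longrightarrow> C \<alpha> = adj W o\<^sub>L word_op (\<lambda>i. adj (V i)) \<alpha> o\<^sub>L W"
    using dilation_exists[OF sep infK] by blast
  note V = column_bound_of_isometries[OF K iso]
  have W: "W \<in> bounded_ops" "\<And>x. norm (W x) = norm x"
    using W_into by (simp_all add: isometry_into_def)
  have coeff: "transfer_coeff (A []) V W = A"
    by (rule transfer_coeff_eq[OF W(1) V(1) C_eq])
  have "F X = (fractional_transform (tensor_op tE tE id_blinfun (A [])) \<circ> cayley_transform)
      (isometric_transfer tE tK V W) X" (is "_ = ?\<Psi>") if X: "X \<in> row_ball" for X
  proof -
    obtain Y1 where Y1: "\<And>k. strong_has_sum (\<lambda>\<alpha>. tensor_op tE tE (word_op X \<alpha>) (A \<alpha>)) {\<alpha>. length \<alpha> = k} (Y1 k)"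
      "Y1 sums F X"
      using Y[OF X] by blast
    obtain Y2 where Y2: "\<And>k. strong_has_sum (\<lambda>\<alpha>. tensor_op tE tE (word_op X \<alpha>) (A \<alpha>)) {\<alpha>. length \<alpha> = k} (Y2 k)"
      "Y2 sums ?\<Psi>"
      using transfer_expansion(1)[OF tE tK A A1 W V X] unfolding coeff by blast
    have "Y1 = Y2"
      by (intro ext strong_has_sum_unique[OF Y1(1) Y2(1)])
    then show ?thesis
      using Y1(2) Y2(2) sums_unique2 by blast
  qed
  then have "represents tE tK F K (A []) V W"
    unfolding represents_def using K A A1 iso W_into by blast
  then show ?thesis
    by blast
qed

theorem theorem1p7:
  fixes tE :: "'h::complex_hilbert \<Rightarrow> 'e::complex_hilbert \<Rightarrow> 'he::complex_hilbert"
    and tK :: "'h \<Rightarrow> 'k::complex_hilbert \<Rightarrow> 'hk::complex_hilbert"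
    and F :: "('n::countable \<Rightarrow> 'h \<Rightarrow>\<^sub>L 'h) \<Rightarrow> ('he \<Rightarrow>\<^sub>L 'he)"
  assumes "separable_hilbert TYPE('h)" and "infinite_dimensional TYPE('h)"
    and "separable_hilbert TYPE('e)"
    and "infinite_dimensional TYPE('k)"
    and "hilbert_tensor tE" and "hilbert_tensor tK"
    and "\<And>X. X \<in> row_ball \<Longrightarrow> F X \<in> spatial_tensor tE"
  shows "(free_holomorphic tE F \<and> bounded_on_ball F \<and> sup_norm F \<le> 1 \<and> norm (F (\<lambda>i. 0)) < 1
            \<longleftrightarrow> (\<exists>K A0 V W. represents tE tK F K A0 V W)) \<and>
         (\<forall>K A0 V W. represents tE tK F K A0 V W \<longrightarrow> F (\<lambda>i. 0) = tensor_op tE tE id_blinfun A0)"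
proof (intro conjI iffI allI impI)
  assume "free_holomorphic tE F \<and> bounded_on_ball F \<and> sup_norm F \<le> 1 \<and> norm (F (\<lambda>i. 0)) < 1"
  then show "\<exists>K A0 V W. represents tE tK F K A0 V W"
    using represents_exists[OF assms(2-6)] by blast
next
  assume "\<exists>K A0 V W. represents tE tK F K A0 V W"
  then obtain K A0 V W where rep: "represents tE tK F K A0 V W"
    by blast
  note F = represents_imp[OF assms(2,5,6) rep]
  show "free_holomorphic tE F" "bounded_on_ball F" "sup_norm F \<le> 1" "norm (F (\<lambda>i. 0)) < 1"
    by (fact F)+
next
  fix K A0 V W
  assume "represents tE tK F K A0 V W"
  then show "F (\<lambda>i. 0) = tensor_op tE tE id_blinfun A0"
    by (rule represents_imp(4)[OF assms(2,5,6)])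
qed

end
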